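(* Let $\mathcal A=\mathbb Z[q,q^{-1}]$ and $i\in\{0,1\}$. The $\mathcal A$-lattice generated by the Schur functions $\{s_\mu e^{m\alpha}e^{i\alpha/2}\}$, with $m\in\mathbb Z$ and $\mu$ running over all partitions, is invariant under the integral form $U_q(\widehat{sl}_2)_{\mathcal A}$.
   Context: $q$ is an indeterminate; $[n]=\frac{q^n-q^{-n}}{q-q^{-1}}$, $[n]!=[n]\cdots[1]$, $a^{(n)}=a^n/[n]!$. $U_q(\widehat{sl}_2)$ is generated by Chevalley generators $e_j,f_j,K_j^{\pm1}$ ($j=0,1$) and $q^{\pm d}$ with the usual Drinfeld-Jimbo relations for the Cartan matrix $\begin{pmatrix}2&-2\\-2&2\end{pmatrix}$. $U_q(\widehat{sl}_2)_{\mathcal A}$ is the $\mathcal A$-algebra generated by $e_j^{(n)}$, $f_j^{(n)}$, $K_j^{\pm1}$ ($j=0,1$, $n\ge1$). Fock space: let $\{a_n\mid n\ne0\}$ generate the Heisenberg algebra with $[a_m,a_n]=\delta_{m,-n}\frac{m}{1+q^{2|m|}}$, acting on $\mathrm{Sym}(a_{-n}\text{'s}, n\ge1)$ in the standard way ($a_{-n}$ by multiplication, $a_n\cdot1=0$ for $n\ge1$). The Fock space is $\mathrm{Sym}(a_{-n}\text{'s})\otimes\mathbb C[\mathbb Z\alpha]e^{i\alpha/2}$, where $\mathbb C[\mathbb Z\alpha]e^{i\alpha/2}$ has basis $e^{m\alpha}e^{i\alpha/2}$, $m\in\mathbb Z$ (scalars contain $\mathbb Q(q^{1/2})$). $\mathrm{Sym}(a_{-n}\text{'s})$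 is identified with the ring of symmetric functions by $a_{-n}\mapsto p_n$ (power sums), and $s_\mu$ is the Schur function. Operators: $e^{n\alpha}\cdot e^{m\alpha}e^{i\alpha/2}=e^{(m+n)\alpha}e^{i\alpha/2}$, $\partial\cdot e^{m\alpha}e^{i\alpha/2}=(2m+i)e^{m\alpha}e^{i\alpha/2}$. Define $X_n^\pm$ by $$X^+(z)=\exp\Bigl(\sum_{n\ge1}\tfrac{(1+q^{2n})q^{-n}}{n}a_{-n}z^n\Bigr)\exp\Bigl(-\sum_{n\ge1}\tfrac{(1+q^{2n})q^{-n}}{n}a_nz^{-n}\Bigr)e^{\alpha}z^{\partial}=\sum_{n\in\mathbb Z}X_n^+z^{-n-1},$$ $$X^-(z)=\exp\Bigl(-\sum_{n\ge1}\tfrac{1+q^{2n}}{n}a_{-n}z^n\Bigr)\exp\Bigl(\sum_{n\ge1}\tfrac{1+q^{2n}}{n}a_nz^{-n}\Bigr)e^{-\alpha}z^{-\partial}=\sum_{n\in\mathbb Z}X_n^-z^{-n-1}.$$ The Chevalley generators act on the Fock space (the level one irreducible module $V(\Lambda_i)$) by $e_1\mapsto X_0^+$, $f_1\mapsto X_0^-$, $K_1\mapsto q^{\partial}$, $e_0\mapsto X_1^-q^{-\partial}$, $f_0\mapsto q^{\partial}X_{-1}^+$, $K_0\mapsto q^{1-\partial}$. *)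

theory Defs
  imports
    "HOL-Library.Poly_Mapping"
    "HOL-Library.Groups_Big_Fun"
    "HOL-Computational_Algebra.Polynomial"
    "Jordan_Normal_Form.Determinant"
begin

definition qint :: "'k::field \<Rightarrow> nat \<Rightarrow> 'k" where
  "qint q n = (q ^ n - inverse q ^ n) / (q - inverse q)"

definition qfact :: "'k::field \<Rightarrow> nat \<Rightarrow> 'k" where
  "qfact q n = (\<Prod>r=1..n. qint q r)"

definition laurent_ring :: "'k::field \<Rightarrow> 'k set" where
  "laurent_ring q = {poly (map_poly of_int p) q * inverse q ^ n | (p :: int poly) (n :: nat). True}"

definition cartan :: "nat \<Rightarrow> nat \<Rightarrow> int" where
  "cartan j k = (if j = k then 2 else - 2)"

definition divided_power :: "('k::field \<Rightarrow> 'u::ring_1 \<Rightarrow> 'u) \<Rightarrow> 'k \<Rightarrow> 'u \<Rightarrow> nat \<Rightarrow> 'u" where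
  "divided_power scale q x n = scale (inverse (qfact q n)) (x ^ n)"

text \<open>
  An algebra over the field \<open>'k\<close> together with elements \<open>e\<^sub>j, f\<^sub>j, K\<^sub>j\<^sup>\<plusminus>\<^sup>1\<close> (\<open>j = 0, 1\<close>) and
  \<open>q\<^sup>\<plusminus>\<^sup>d\<close> (here \<open>D\<close>, \<open>Di\<close>) that satisfy the Drinfeld-Jimbo relations of type \<open>A\<^sub>1\<^sup>(\<^sup>1\<^sup>)\<close>.  The algebra
  \<open>U\<^sub>q\<close> is the universal instance; what is stated for all instances holds for it in particular.
  Values of the families at indices other than 0 and 1 are irrelevant.
\<close>

locale quantum_affine_sl2 = vector_space scale
  for scale :: "'k::field \<Rightarrow> 'u::ring_1 \<Rightarrow> 'u" +
  fixes q :: 'k and e f K Ki :: "nat \<Rightarrow> 'u" and D Di :: 'u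
  assumes scale_mult_left: "scale c x * y = scale c (x * y)"
    and scale_mult_right: "x * scale c y = scale c (x * y)"
    and K_inverse: "j \<in> {0, 1} \<Longrightarrow> K j * Ki j = 1" "j \<in> {0, 1} \<Longrightarrow> Ki j * K j = 1"
    and D_inverse: "D * Di = 1" "Di * D = 1"
    and K_commute: "j \<in> {0, 1} \<Longrightarrow> k \<in> {0, 1} \<Longrightarrow> K j * K k = K k * K j"
    and D_K_commute: "j \<in> {0, 1} \<Longrightarrow> D * K j = K j * D"
    and K_e: "j \<in> {0, 1} \<Longrightarrow> k \<in> {0, 1} \<Longrightarrow> K j * e k * Ki j = scale (q powi cartan j k) (e k)"
    and K_f: "j \<in> {0, 1} \<Longrightarrow> k \<in> {0, 1} \<Longrightarrow> K j * f k * Ki j = scale (q powi (- cartan j k)) (f k)"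
    and D_e: "j \<in> {0, 1} \<Longrightarrow> D * e j * Di = scale (if j = 0 then q else 1) (e j)"
    and D_f: "j \<in> {0, 1} \<Longrightarrow> D * f j * Di = scale (if j = 0 then inverse q else 1) (f j)"
    and e_f: "j \<in> {0, 1} \<Longrightarrow> k \<in> {0, 1} \<Longrightarrow>
      e j * f k - f k * e j = (if j = k then scale (inverse (q - inverse q)) (K j - Ki j) else 0)"
    and serre_e: "j \<in> {0, 1} \<Longrightarrow> k \<in> {0, 1} \<Longrightarrow> j \<noteq> k \<Longrightarrow>
      (\<Sum>r=0..3. (- 1) ^ r * divided_power scale q (e j) r * e k * divided_power scale q (e j) (3 - r)) = 0"
    and serre_f: "j \<in> {0, 1} \<Longrightarrow> k \<in> {0, 1} \<Longrightarrow> j \<noteq> k \<Longrightarrow>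
      (\<Sum>r=0..3. (- 1) ^ r * divided_power scale q (f j) r * f k * divided_power scale q (f j) (3 - r)) = 0"

inductive_set integral_form ::
  "('k::field \<Rightarrow> 'u::ring_1 \<Rightarrow> 'u) \<Rightarrow> 'k \<Rightarrow>
    (nat \<Rightarrow> 'u) \<Rightarrow> (nat \<Rightarrow> 'u) \<Rightarrow> (nat \<Rightarrow> 'u) \<Rightarrow> (nat \<Rightarrow> 'u) \<Rightarrow> 'u set"
  for scale q e f K Ki where
  e: "j \<in> {0, 1} \<Longrightarrow> n \<ge> 1 \<Longrightarrow> divided_power scale q (e j) n \<in> integral_form scale q e f K Ki"
| f: "j \<in> {0, 1} \<Longrightarrow> n \<ge> 1 \<Longrightarrow> divided_power scale q (f j) n \<in> integral_form scale q e f K Ki"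
| K: "j \<in> {0, 1} \<Longrightarrow> K j \<in> integral_form scale q e f K Ki"
| Ki: "j \<in> {0, 1} \<Longrightarrow> Ki j \<in> integral_form scale q e f K Ki"
| one: "1 \<in> integral_form scale q e f K Ki"
| add: "x \<in> integral_form scale q e f K Ki \<Longrightarrow> y \<in> integral_form scale q e f K Ki \<Longrightarrow>
    x + y \<in> integral_form scale q e f K Ki"
| mult: "x \<in> integral_form scale q e f K Ki \<Longrightarrow> y \<in> integral_form scale q e f K Ki \<Longrightarrow>
    x * y \<in> integral_form scale q e f K Ki"
| scale: "c \<in> laurent_ring q \<Longrightarrow> x \<in> integral_form scale q e f K Ki \<Longrightarrow>
    scale c x \<in> integral_form scale q e f K Ki"

text \<open>
  Variables are numbered from 0.  The type is used both for \<open>Sym(a\<^sub>-\<^sub>n)\<close>, where the variable number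
  \<open>n - 1\<close> is \<open>a\<^sub>-\<^sub>n\<close> (\<open>n \<ge> 1\<close>), and for polynomials in the variables of symmetric functions.
\<close>

type_synonym 'k mpoly = "(nat \<Rightarrow>\<^sub>0 nat) \<Rightarrow>\<^sub>0 'k"

definition Const :: "'k::zero \<Rightarrow> 'k mpoly" where
  "Const c = Poly_Mapping.single 0 c"

definition Var :: "nat \<Rightarrow> 'k::zero_neq_one mpoly" where
  "Var j = Poly_Mapping.single (Poly_Mapping.single j 1) 1"

definition partial_deriv :: "nat \<Rightarrow> 'k::comm_semiring_1 mpoly \<Rightarrow> 'k mpoly" where
  "partial_deriv j p =
    (\<Sum>t\<in>Poly_Mapping.keys p.
      Poly_Mapping.single (t - Poly_Mapping.single j 1)
        (of_nat (Poly_Mapping.lookup t j) * Poly_Mapping.lookup p t))"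

definition is_partition :: "nat list \<Rightarrow> bool" where
  "is_partition \<mu> \<longleftrightarrow> sorted_wrt (\<ge>) \<mu> \<and> 0 \<notin> set \<mu>"

definition part :: "nat list \<Rightarrow> nat \<Rightarrow> nat" where
  "part \<mu> j = (if j < length \<mu> then \<mu> ! j else 0)"

definition power_sum :: "nat \<Rightarrow> nat \<Rightarrow> 'k::comm_semiring_1 mpoly" where
  "power_sum N n = (\<Sum>j<N. Var j ^ n)"

text \<open>
  Substitution of the power sums \<open>p\<^sub>n(x\<^sub>0, \<dots>, x\<^bsub>N-1\<^esub>)\<close> for \<open>a\<^sub>-\<^sub>n\<close>: the identification
  \<open>a\<^sub>-\<^sub>n \<mapsto> p\<^sub>n\<close> with symmetric functions, followed by restriction to \<open>N\<close> variables.
\<close>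

definition restrict_vars :: "nat \<Rightarrow> 'k::comm_semiring_1 mpoly \<Rightarrow> 'k mpoly" where
  "restrict_vars N p =
    (\<Sum>t\<in>Poly_Mapping.keys p. Const (Poly_Mapping.lookup p t) *
      (\<Prod>j\<in>Poly_Mapping.keys t. power_sum N (Suc j) ^ Poly_Mapping.lookup t j))"

definition alternant :: "nat \<Rightarrow> (nat \<Rightarrow> nat) \<Rightarrow> 'k::comm_ring_1 mpoly" where
  "alternant N \<alpha> = det (mat N N (\<lambda>(r, c). Var r ^ \<alpha> c))"

text \<open>
  The Schur function \<open>s\<^sub>\<mu>\<close>, written in the power sums: the symmetric function whose restriction
  to \<open>N\<close> variables is the Schur polynomial \<open>a\<^bsub>\<mu>+\<delta>\<^esub> / a\<^sub>\<delta>\<close> with \<open>\<delta> = (N-1, \<dots>, 1, 0)\<close>, for all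
  \<open>N\<close> not below the length of \<open>\<mu>\<close>.
\<close>

definition schur :: "nat list \<Rightarrow> 'k::field_char_0 mpoly" where
  "schur \<mu> = (THE s. \<forall>N \<ge> length \<mu>.
    restrict_vars N s * alternant N (\<lambda>c. N - 1 - c) = alternant N (\<lambda>c. part \<mu> c + (N - 1 - c)))"

text \<open>
  The Fock space is realised as the group algebra of \<open>\<int>\<alpha>\<close> over \<open>Sym(a\<^sub>-\<^sub>n)\<close>: the element
  \<open>Poly_Mapping.single m p\<close> stands for \<open>p e\<^bsup>m\<alpha>\<^esup> e\<^bsup>i\<alpha>/2\<^esup>\<close>.  The index \<open>i\<close> enters only through the
  eigenvalues of \<open>\<partial>\<close>.
\<close>

type_synonym 'k fock = "int \<Rightarrow>\<^sub>0 'k mpoly"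

definition fscale :: "'k::field \<Rightarrow> 'k fock \<Rightarrow> 'k fock" where
  "fscale c v = Poly_Mapping.single 0 (Const c) * v"

text \<open>
  The Heisenberg generators \<open>a\<^sub>n\<close>, \<open>n \<noteq> 0\<close> (with the value 0 at the unused index 0).  For \<open>n > 0\<close>,
  \<open>[a\<^sub>n, a\<^sub>-\<^sub>n] = n / (1 + q\<^bsup>2n\<^esup>)\<close> and \<open>a\<^sub>n 1 = 0\<close> make \<open>a\<^sub>n\<close> a multiple of the derivative by \<open>a\<^sub>-\<^sub>n\<close>.
\<close>

definition heis :: "'k::field \<Rightarrow> int \<Rightarrow> 'k fock \<Rightarrow> 'k fock" where
  "heis q n v =
    (if n < 0 then Poly_Mapping.single 0 (Var (nat (- n) - 1)) * v
     else if n > 0 then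
       fscale (of_int n / (1 + q ^ (2 * nat n))) (Poly_Mapping.map (partial_deriv (nat n - 1)) v)
     else 0)"

definition e_alpha :: "int \<Rightarrow> 'k::field fock \<Rightarrow> 'k fock" where
  "e_alpha n v = Poly_Mapping.single n 1 * v"

text \<open>
  The operator \<open>g(\<partial>)\<close> for a function \<open>g\<close> of the eigenvalue of \<open>\<partial>\<close>, which is \<open>2m + i\<close> on
  \<open>e\<^bsup>m\<alpha>\<^esup> e\<^bsup>i\<alpha>/2\<^esup>\<close>.
\<close>

definition fun_del :: "nat \<Rightarrow> (int \<Rightarrow> 'k::field) \<Rightarrow> 'k fock \<Rightarrow> 'k fock" where
  "fun_del i g v =
    (\<Sum>m\<in>Poly_Mapping.keys v.
      fscale (g (2 * m + int i)) (Poly_Mapping.single m (Poly_Mapping.lookup v m)))"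

text \<open>
  The coefficient of \<open>z\<^sup>k\<close> in \<open>exp (\<Sum>n\<ge>1. A\<^sub>n z\<^sup>n)\<close>, as a sum over the compositions of \<open>k\<close>.
\<close>

definition exp_coeff :: "(nat \<Rightarrow> 'k::field_char_0 fock \<Rightarrow> 'k fock) \<Rightarrow> nat \<Rightarrow> 'k fock \<Rightarrow> 'k fock" where
  "exp_coeff A k v =
    (\<Sum>ns | 0 \<notin> set ns \<and> sum_list ns = k. fscale (1 / fact (length ns)) (foldr A ns v))"

text \<open>
  The coefficient of \<open>z\<^bsup>-n-1\<^esup>\<close> in
  \<open>exp (\<Sum>r\<ge>1. c\<^sub>r a\<^sub>-\<^sub>r z\<^sup>r) exp (\<Sum>r\<ge>1. c'\<^sub>r a\<^sub>r z\<^bsup>-r\<^esup>) e\<^bsup>t\<alpha>\<^esup> z\<^bsup>t\<partial>\<^esup>\<close>.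
  On a fixed vector only finitely many \<open>(k, l, d)\<close> contribute; \<open>d\<close> runs over the eigenvalues of \<open>\<partial>\<close>,
  on whose eigenspaces \<open>z\<^bsup>t\<partial>\<^esup>\<close> is \<open>z\<^bsup>td\<^esup>\<close>.
\<close>

definition vertex_mode ::
  "'k::field_char_0 \<Rightarrow> nat \<Rightarrow> (nat \<Rightarrow> 'k) \<Rightarrow> (nat \<Rightarrow> 'k) \<Rightarrow> int \<Rightarrow> int \<Rightarrow> 'k fock \<Rightarrow> 'k fock" where
  "vertex_mode q i c c' t n v =
    Sum_any (\<lambda>(k :: nat, l :: nat, d :: int).
      if int k - int l + t * d = - n - 1 then
        exp_coeff (\<lambda>r w. fscale (c r) (heis q (- int r) w)) k
          (exp_coeff (\<lambda>r w. fscale (c' r) (heis q (int r) w)) l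
            (e_alpha t (fun_del i (\<lambda>d'. if d' = d then 1 else 0) v)))
      else 0)"

definition X_plus :: "'k::field_char_0 \<Rightarrow> nat \<Rightarrow> int \<Rightarrow> 'k fock \<Rightarrow> 'k fock" where
  "X_plus q i n =
    vertex_mode q i
      (\<lambda>r. (1 + q ^ (2 * r)) * inverse q ^ r / of_nat r)
      (\<lambda>r. - ((1 + q ^ (2 * r)) * inverse q ^ r / of_nat r)) 1 n"

definition X_minus :: "'k::field_char_0 \<Rightarrow> nat \<Rightarrow> int \<Rightarrow> 'k fock \<Rightarrow> 'k fock" where
  "X_minus q i n =
    vertex_mode q i
      (\<lambda>r. - ((1 + q ^ (2 * r)) / of_nat r))
      (\<lambda>r. (1 + q ^ (2 * r)) / of_nat r) (- 1) n"

definition fock_representation ::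
  "('k::field_char_0 \<Rightarrow> 'u::ring_1 \<Rightarrow> 'u) \<Rightarrow> ('u \<Rightarrow> 'k fock \<Rightarrow> 'k fock) \<Rightarrow> bool" where
  "fock_representation scale \<rho> \<longleftrightarrow>
    (\<forall>x. Vector_Spaces.linear fscale fscale (\<rho> x)) \<and>
    (\<forall>x y v. \<rho> (x + y) v = \<rho> x v + \<rho> y v) \<and>
    (\<forall>c x v. \<rho> (scale c x) v = fscale c (\<rho> x v)) \<and>
    \<rho> 1 = id \<and>
    (\<forall>x y. \<rho> (x * y) = \<rho> x \<circ> \<rho> y)"

definition chevalley_action ::
  "'k::field_char_0 \<Rightarrow> nat \<Rightarrow> (nat \<Rightarrow> 'u) \<Rightarrow> (nat \<Rightarrow> 'u) \<Rightarrow> (nat \<Rightarrow> 'u) \<Rightarrow>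
    ('u \<Rightarrow> 'k fock \<Rightarrow> 'k fock) \<Rightarrow> bool" where
  "chevalley_action q i e f K \<rho> \<longleftrightarrow>
    \<rho> (e 1) = X_plus q i 0 \<and>
    \<rho> (f 1) = X_minus q i 0 \<and>
    \<rho> (K 1) = fun_del i (\<lambda>d. q powi d) \<and>
    \<rho> (e 0) = X_minus q i 1 \<circ> fun_del i (\<lambda>d. q powi (- d)) \<and>
    \<rho> (f 0) = fun_del i (\<lambda>d. q powi d) \<circ> X_plus q i (- 1) \<and>
    \<rho> (K 0) = fun_del i (\<lambda>d. q powi (1 - d))"

definition schur_basis :: "'k::field_char_0 fock set" where
  "schur_basis = {Poly_Mapping.single m (schur \<mu>) | m \<mu>. is_partition \<mu>}"

definition schur_lattice :: "'k::field_char_0 \<Rightarrow> 'k fock set" where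
  "schur_lattice q =
    {(\<Sum>b\<in>B. fscale (c b) b) | B c. finite B \<and> B \<subseteq> schur_basis \<and> c ` B \<subseteq> laurent_ring q}"

end

theory Submission
  imports Defs "HOL-Computational_Algebra.Formal_Power_Series"
begin

text \<open>
  Both currents have the same shape: up to a rescaling of \<open>z\<close>, they are
  \<open>H(z) H(yz) \<cdot> exp (- \<epsilon> \<Sum>\<^sub>r \<partial>/\<partial>p\<^sub>r z\<^bsup>-r\<^esup>)\<close> with \<open>H(z) = exp (\<epsilon> \<Sum>\<^sub>r p\<^sub>r z\<^sup>r / r)\<close>, where \<open>\<epsilon> = \<plusminus>1\<close> and
  \<open>y = q\<^bsup>-2\<^esup>\<close> for \<open>X\<^sup>+\<close>, \<open>y = q\<^sup>2\<close> for \<open>X\<^sup>-\<close>.  The second factor is a translation of the power sums,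
  so the modes preserve the ring \<open>\<Lambda>\<close> generated over \<open>\<int>[q, q\<^bsup>-1\<^esup>]\<close> by the complete symmetric functions.

  A product of \<open>n\<close> currents is \<open>\<Prod>\<^bsub>i<j\<^esub> (z\<^sub>i - z\<^sub>j) (z\<^sub>i - y z\<^sub>j)\<close> times the normally ordered product, which is
  symmetric in the \<open>z\<^sub>i\<close>.  In the coefficient of \<open>(z\<^sub>1 \<cdots> z\<^sub>n)\<^sup>c\<close> the factor \<open>\<Prod>\<^bsub>i<j\<^esub> (z\<^sub>i - y z\<^sub>j)\<close> is
  antisymmetrised by the remaining factors to a unit times \<open>[n]!\<close> times the Vandermonde determinant; the
  \<open>[n]!\<close> cancels the denominator of the divided power, and what is left is integral.  This can be
  done one current at a time: \<open>X \<cdot> Y\<^sub>n = (1 + y + \<cdots> + y\<^sup>n) Y\<^bsub>n+1\<^esub>\<close>, where \<open>Y\<^sub>n\<close> is the coefficient in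
  question with \<open>\<Prod>\<^bsub>i<j\<^esub> (z\<^sub>i - y z\<^sub>j)\<close> replaced by \<open>z\<^sub>1\<^bsup>n-1\<^esup> \<cdots> z\<^bsub>n-1\<^esub>\<close>.

  The lattice of the Schur functions is \<open>\<Lambda>\<close>.  Bernstein's operators
  \<open>B\<^sub>r = \<Sum>\<^sub>k (-1)\<^sup>k h\<^bsub>r+k\<^esub> e\<^sub>k\<^sup>\<bottom>\<close> preserve \<open>\<Lambda>\<close> and add a first row to a Schur function (expand
  the alternant along its first column), so \<open>s\<^sub>\<mu> \<in> \<Lambda>\<close>.  Conversely \<open>h\<^sub>r f = \<Sum>\<^sub>k B\<^bsub>r+k\<^esub> h\<^sub>k\<^sup>\<bottom> f\<close> expands monomials in
  the \<open>h\<^sub>r\<close> into words in the \<open>B\<^sub>r\<close>, which the relation \<open>B\<^sub>r B\<^sub>s = - B\<^bsub>s-1\<^esub> B\<^bsub>r+1\<^esub>\<close> straightens to Schur functions.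
\<close>

subsection \<open>Polynomials in infinitely many variables\<close>

abbreviation (input) "lookup \<equiv> Poly_Mapping.lookup"
abbreviation (input) "keys \<equiv> Poly_Mapping.keys"
abbreviation (input) "single \<equiv> Poly_Mapping.single"

lemma sum_single_lookup:
  fixes p :: "'a \<Rightarrow>\<^sub>0 'b::comm_monoid_add"
  shows "(\<Sum>t\<in>keys p. single t (lookup p t)) = p"
proof (rule poly_mapping_eqI)
  fix k
  have "lookup (\<Sum>t\<in>keys p. single t (lookup p t)) k = (\<Sum>t\<in>keys p. if t = k then lookup p t else 0)"
    unfolding lookup_sum lookup_single when_def ..
  also have "\<dots> = lookup p k"
    by (simp add: in_keys_iff)
  finally show "lookup (\<Sum>t\<in>keys p. single t (lookup p t)) k = lookup p k" .
qed

lemma poly_mapping_additive_induct [case_names zero single add]: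
  fixes p :: "'a \<Rightarrow>\<^sub>0 'b::comm_monoid_add"
  assumes "P 0" and "\<And>t a. P (single t a)" and "\<And>p r. P p \<Longrightarrow> P r \<Longrightarrow> P (p + r)"
  shows "P p"
proof -
  have "P (\<Sum>t\<in>T. single t (lookup p t))" if "finite T" for T
    using that assms by (induction T) auto
  from this[of "keys p"] show ?thesis
    by (simp add: sum_single_lookup)
qed

lemma Const_0 [simp]: "Const 0 = 0" and Const_1 [simp]: "Const 1 = 1"
  by (simp_all add: Const_def)

lemma Const_add: "Const (a + b) = Const a + Const b"
  by (simp add: Const_def single_add)

lemma Const_mult: "Const (a * b) = Const a * Const b"
  by (simp add: Const_def mult_single)

lemma comm_ring_hom_Const: "comm_ring_hom (Const :: 'k::comm_ring_1 \<Rightarrow> 'k mpoly)"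
  by standard (auto simp: Const_add Const_mult)

interpretation Const_hom: comm_ring_hom "Const :: 'k::comm_ring_1 \<Rightarrow> 'k mpoly"
  by (rule comm_ring_hom_Const)

lemma Const_mult_single: "Const c * single t a = single t (c * a)"
  by (simp add: Const_def mult_single)

lemma Var_power: "Var j ^ n = single (single j n) (1::'k::comm_semiring_1)"
  by (induction n) (auto simp: Var_def mult_single simp flip: single_add)

lemma single_sum_eq_prod: "single (\<Sum>j\<in>J. s j) (1::'k::comm_semiring_1) = (\<Prod>j\<in>J. single (s j) 1)"
proof (induction J rule: infinite_finite_induct)
  case (insert j J)
  thus ?case by (simp add: insert.IH[symmetric] mult_single)
qed auto

lemma single_eq_monomial:
  "single t (a::'k::comm_semiring_1) = Const a * (\<Prod>j\<in>keys t. Var j ^ lookup t j)"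
proof -
  have "single t (1::'k) = (\<Prod>j\<in>keys t. Var j ^ lookup t j)"
    unfolding Var_power by (subst single_sum_eq_prod[symmetric], subst sum_single_lookup) simp
  thus ?thesis
    by (metis Const_mult_single mult.right_neutral)
qed

lemma mpoly_induct [case_names Const Var add mult]:
  fixes p :: "'k::comm_semiring_1 mpoly"
  assumes C: "\<And>c. P (Const c)" and V: "\<And>j. P (Var j)"
    and A: "\<And>p r. P p \<Longrightarrow> P r \<Longrightarrow> P (p + r)" and M: "\<And>p r. P p \<Longrightarrow> P r \<Longrightarrow> P (p * r)"
  shows "P p"
proof (induction p rule: poly_mapping_additive_induct)
  case zero
  show ?case using C[of 0] by simp
next
  case (single t a)
  have pow: "P (Var j ^ n)" for j n
    by (induction n) (use C[of 1] V M in auto)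
  have "P (\<Prod>j\<in>J. Var j ^ lookup t j)" if "finite J" for J
    using that by (induction J) (use C[of 1] pow M in auto)
  thus ?case
    unfolding single_eq_monomial[of t a] by (intro M C) simp
qed (rule A)

section \<open>Evaluation homomorphisms of the polynomial ring\<close>

definition poly_eval :: "('k \<Rightarrow> 'r) \<Rightarrow> (nat \<Rightarrow> 'r) \<Rightarrow> 'k::comm_ring_1 mpoly \<Rightarrow> 'r::comm_ring_1" where
  "poly_eval c \<phi> p = (\<Sum>t\<in>keys p. c (lookup p t) * (\<Prod>j\<in>keys t. \<phi> j ^ lookup t j))"

context comm_ring_hom
begin

lemma poly_eval_superset:
  assumes "finite T" "keys p \<subseteq> T"
  shows "poly_eval hom \<phi> p = (\<Sum>t\<in>T. hom (lookup p t) * (\<Prod>j\<in>keys t. \<phi> j ^ lookup t j))"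
  unfolding poly_eval_def by (rule sum.mono_neutral_left) (use assms in \<open>auto simp: in_keys_iff\<close>)

lemma poly_eval_single: "poly_eval hom \<phi> (single t a) = hom a * (\<Prod>j\<in>keys t. \<phi> j ^ lookup t j)"
  by (subst poly_eval_superset[of "{t}"]) auto

lemma poly_eval_add: "poly_eval hom \<phi> (p + r) = poly_eval hom \<phi> p + poly_eval hom \<phi> r"
proof -
  let ?T = "keys p \<union> keys r"
  have "keys (p + r) \<subseteq> ?T" by (rule Poly_Mapping.keys_add)
  thus ?thesis
    by (simp add: poly_eval_superset[of ?T] lookup_add hom_add algebra_simps sum.distrib)
qed

lemma poly_eval_Const: "poly_eval hom \<phi> (Const a) = hom a"
  by (simp add: Const_def poly_eval_single)

lemma poly_eval_0: "poly_eval hom \<phi> 0 = 0"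
  by (simp add: poly_eval_def)

lemma poly_eval_1: "poly_eval hom \<phi> 1 = 1"
  using poly_eval_Const[of \<phi> 1] by simp

lemma poly_eval_Var: "poly_eval hom \<phi> (Var j) = \<phi> j"
  by (simp add: Var_def poly_eval_single)

lemma monomial_add:
  "(\<Prod>j\<in>keys (s + t). \<phi> j ^ lookup (s + t) j :: 'b) =
    (\<Prod>j\<in>keys s. \<phi> j ^ lookup s j) * (\<Prod>j\<in>keys t. \<phi> j ^ lookup t j)"
proof -
  let ?J = "keys s \<union> keys t"
  have *: "(\<Prod>j\<in>keys u. \<phi> j ^ lookup u j) = (\<Prod>j\<in>?J. \<phi> j ^ lookup u j)" if "keys u \<subseteq> ?J" for u
    using that by (intro prod.mono_neutral_left) (auto simp: in_keys_iff)
  have "(\<Prod>j\<in>keys (s + t). \<phi> j ^ lookup (s + t) j) = (\<Prod>j\<in>?J. \<phi> j ^ lookup (s + t) j)"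
    by (rule *) (rule Poly_Mapping.keys_add)
  thus ?thesis
    by (simp add: *[of s] *[of t] lookup_add power_add prod.distrib)
qed

lemma poly_eval_mult: "poly_eval hom \<phi> (p * r) = poly_eval hom \<phi> p * poly_eval hom \<phi> r"
proof (induction p rule: poly_mapping_additive_induct)
  case (single s a)
  show ?case
  proof (induction r rule: poly_mapping_additive_induct)
    case (single t b)
    show ?case by (simp add: mult_single poly_eval_single hom_mult monomial_add algebra_simps)
  qed (auto simp: algebra_simps poly_eval_add poly_eval_0)
qed (auto simp: algebra_simps poly_eval_add poly_eval_0)

lemma comm_ring_hom_poly_eval: "comm_ring_hom (poly_eval hom \<phi>)"
  by standard (auto simp: poly_eval_add poly_eval_mult poly_eval_0 poly_eval_1)

text \<open>The universal property of the polynomial ring. It serves below to identify composite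
  homomorphisms, such as specialising the variables after substituting power sums.\<close>

lemma poly_eval_unique:
  assumes h: "comm_ring_hom h" and "\<And>a. h (Const a) = hom a" "\<And>j. h (Var j) = \<phi> j"
  shows "h p = poly_eval hom \<phi> p"
proof -
  interpret h: comm_ring_hom h by (rule h)
  show ?thesis
    by (induction p rule: mpoly_induct)
      (auto simp: assms poly_eval_Const poly_eval_Var h.hom_add h.hom_mult poly_eval_add poly_eval_mult)
qed

end

lemma comm_ring_hom_compose:
  assumes "comm_ring_hom f" "comm_ring_hom g"
  shows "comm_ring_hom (\<lambda>x. f (g x))"
proof -
  interpret f: comm_ring_hom f by fact
  interpret g: comm_ring_hom g by fact
  show ?thesis by standard (auto simp: f.hom_add g.hom_add f.hom_mult g.hom_mult)
qed

lemma poly_map_poly_pCons: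
  assumes "\<phi> 0 = 0"
  shows "poly (map_poly \<phi> (pCons a Q)) u = \<phi> a + u * poly (map_poly \<phi> Q) u"
  using assms by (simp add: map_poly_pCons)

lemma comm_ring_hom_poly_map_poly:
  assumes "comm_ring_hom \<phi>"
  shows "comm_ring_hom (\<lambda>Q. poly (map_poly \<phi> Q) u)"
proof -
  interpret \<phi>: comm_ring_hom \<phi> by fact
  let ?L = "\<lambda>Q. poly (map_poly \<phi> Q) u"
  note pC = poly_map_poly_pCons[of \<phi>, OF \<phi>.hom_zero]
  have add: "?L (P + Q) = ?L P + ?L Q" for P Q
    by (induction P Q rule: poly_induct2) (simp_all add: pC \<phi>.hom_add algebra_simps)
  have smult: "?L (smult a Q) = \<phi> a * ?L Q" for a Q
    by (induction Q) (simp_all add: pC \<phi>.hom_mult algebra_simps)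
  have mult: "?L (P * Q) = ?L P * ?L Q" for P Q
    by (induction P) (simp_all add: pC add smult algebra_simps)
  show ?thesis
    by standard (simp_all add: add mult pC one_pCons)
qed

section \<open>Partial derivatives and the chain rule\<close>

lemma partial_deriv_superset:
  assumes "finite T" "keys p \<subseteq> T"
  shows "partial_deriv j p = (\<Sum>t\<in>T. single (t - single j 1) (of_nat (lookup t j) * lookup p t))"
  unfolding partial_deriv_def
  by (rule sum.mono_neutral_left) (use assms in \<open>auto simp: in_keys_iff\<close>)

lemma partial_deriv_single:
  "partial_deriv j (single t a) = single (t - single j 1) (of_nat (lookup t j) * a)"
  by (subst partial_deriv_superset[of "{t}"]) auto

lemma partial_deriv_add: "partial_deriv j (p + r) = partial_deriv j p + partial_deriv j r"
proof -
  let ?T = "keys p \<union> keys r"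
  have "keys (p + r) \<subseteq> ?T" by (rule Poly_Mapping.keys_add)
  thus ?thesis
    by (simp add: partial_deriv_superset[of ?T] lookup_add algebra_simps sum.distrib single_add)
qed

lemma partial_deriv_0 [simp]: "partial_deriv j 0 = 0"
  by (simp add: partial_deriv_def)

lemma partial_deriv_Const [simp]: "partial_deriv j (Const a) = 0"
  by (simp add: Const_def partial_deriv_single)

lemma partial_deriv_Var: "partial_deriv j (Var i) = (if i = j then 1 else 0)"
  by (auto simp: Var_def partial_deriv_single lookup_single when_def)

lemma partial_deriv_mult:
  "partial_deriv j (p * r) = partial_deriv j p * r + p * partial_deriv j r"
proof (induction p rule: poly_mapping_additive_induct)
  case (single s a)
  show ?case
  proof (induction r rule: poly_mapping_additive_induct)
    case (single t b)
    \<comment> \<open>Subtraction of exponents is truncated, so this needs a positive exponent of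
      variable \<open>j\<close>. If that exponent is 0, the coefficient in front vanishes
      instead.\<close>
    have *: "s + t - single j 1 = (s - single j 1) + t" if "lookup s j \<noteq> 0" for s t :: "nat \<Rightarrow>\<^sub>0 nat"
      by (rule poly_mapping_eqI) (use that in \<open>auto simp: lookup_add lookup_minus lookup_single when_def\<close>)
    have "single (s + t - single j 1) (of_nat (lookup s j) * (a * b)) =
        single (s - single j 1 + t) (of_nat (lookup s j) * (a * b))"
      using *[of s t] by (cases "lookup s j = 0") auto
    moreover have "single (s + t - single j 1) (of_nat (lookup t j) * (a * b)) =
        single (s + (t - single j 1)) (of_nat (lookup t j) * (a * b))"
      using *[of t s] by (cases "lookup t j = 0") (auto simp: add.commute)
    ultimately show ?case
      by (simp add: mult_single partial_deriv_single lookup_add algebra_simps single_add)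
  qed (auto simp: algebra_simps partial_deriv_add)
qed (auto simp: algebra_simps partial_deriv_add)

lemma lookup_partial_deriv:
  "lookup (partial_deriv j p) t = of_nat (Suc (lookup t j)) * lookup p (t + single j 1)"
proof (induction p rule: poly_mapping_additive_induct)
  case (single s a)
  show ?case
  proof (cases "lookup s j = 0")
    case True
    hence "s \<noteq> t + single j 1"
      by (metis add_eq_0_iff_both_eq_0 lookup_add lookup_single_eq one_neq_zero)
    thus ?thesis using True by (simp add: partial_deriv_single lookup_single)
  next
    case False
    have "s - single j 1 = t \<longleftrightarrow> s = t + single j 1"
    proof
      assume "s - single j 1 = t"
      hence *: "lookup (s - single j 1) i = lookup t i" for i by simp
      have "lookup s i = lookup (t + single j 1) i" for i
        using False *[of i] by (cases "i = j") (auto simp: lookup_minus lookup_add lookup_single)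
      thus "s = t + single j 1" by (rule poly_mapping_eqI)
    qed auto
    thus ?thesis
      by (auto simp: partial_deriv_single lookup_single when_def lookup_add)
  qed
qed (auto simp: algebra_simps partial_deriv_add lookup_add)

lemma partial_deriv_commute: "partial_deriv i (partial_deriv j p) = partial_deriv j (partial_deriv i p)"
  by (cases "i = j")
    (auto intro!: poly_mapping_eqI simp: lookup_partial_deriv lookup_add lookup_single ac_simps)

text \<open>As functions of \<open>p\<close>, both sides obey the same sum and product rules, so the
  generators suffice. The bound \<open>J0\<close> depends on \<open>p\<close> alone, hence one
  \<open>J\<close> serves a whole family of evaluations \<open>\<phi>\<close>.\<close>

lemma chain_rule:
  fixes \<delta> :: "'r::comm_ring_1 \<Rightarrow> 'r" and c :: "'k::comm_ring_1 \<Rightarrow> 'r"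
  assumes "comm_ring_hom c"
    and \<delta>: "\<And>x y. \<delta> (x + y) = \<delta> x + \<delta> y" "\<And>x y. \<delta> (x * y) = \<delta> x * y + x * \<delta> y" "\<And>a. \<delta> (c a) = 0"
  shows "\<exists>J0. \<forall>J\<ge>J0. \<forall>\<phi>. \<delta> (poly_eval c \<phi> p) = (\<Sum>j<J. poly_eval c \<phi> (partial_deriv j p) * \<delta> (\<phi> j))"
proof -
  interpret c: comm_ring_hom c by fact
  show ?thesis
  proof (induction p rule: mpoly_induct)
    case (Var i)
    have "(\<Sum>j<J. poly_eval c \<phi> (partial_deriv j (Var i)) * \<delta> (\<phi> j)) = \<delta> (\<phi> i)" if "J \<ge> Suc i" for J \<phi>
    proof -
      have "(\<Sum>j<J. poly_eval c \<phi> (partial_deriv j (Var i)) * \<delta> (\<phi> j)) =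
          (\<Sum>j<J. if j = i then \<delta> (\<phi> i) else 0)"
        by (intro sum.cong) (auto simp: partial_deriv_Var c.poly_eval_0 c.poly_eval_1)
      thus ?thesis using that by simp
    qed
    thus ?case by (intro exI[of _ "Suc i"]) (simp add: c.poly_eval_Var)
  next
    case (add p r)
    then obtain J1 J2 where J:
      "\<forall>J\<ge>J1. \<forall>\<phi>. \<delta> (poly_eval c \<phi> p) = (\<Sum>j<J. poly_eval c \<phi> (partial_deriv j p) * \<delta> (\<phi> j))"
      "\<forall>J\<ge>J2. \<forall>\<phi>. \<delta> (poly_eval c \<phi> r) = (\<Sum>j<J. poly_eval c \<phi> (partial_deriv j r) * \<delta> (\<phi> j))" by blast
    have "\<delta> (poly_eval c \<phi> (p + r)) = (\<Sum>j<J. poly_eval c \<phi> (partial_deriv j (p + r)) * \<delta> (\<phi> j))"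
      if "J \<ge> max J1 J2" for J \<phi>
      using that J(1)[rule_format, of J \<phi>] J(2)[rule_format, of J \<phi>]
      by (simp only: c.poly_eval_add partial_deriv_add \<delta> distrib_right sum.distrib max.bounded_iff)
    thus ?case by blast
  next
    case (mult p r)
    then obtain J1 J2 where J:
      "\<forall>J\<ge>J1. \<forall>\<phi>. \<delta> (poly_eval c \<phi> p) = (\<Sum>j<J. poly_eval c \<phi> (partial_deriv j p) * \<delta> (\<phi> j))"
      "\<forall>J\<ge>J2. \<forall>\<phi>. \<delta> (poly_eval c \<phi> r) = (\<Sum>j<J. poly_eval c \<phi> (partial_deriv j r) * \<delta> (\<phi> j))" by blast
    have "\<delta> (poly_eval c \<phi> (p * r)) = (\<Sum>j<J. poly_eval c \<phi> (partial_deriv j (p * r)) * \<delta> (\<phi> j))"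
      if "J \<ge> max J1 J2" for J \<phi>
      using that J(1)[rule_format, of J \<phi>] J(2)[rule_format, of J \<phi>]
      by (simp only: c.poly_eval_add c.poly_eval_mult partial_deriv_mult \<delta> distrib_right sum.distrib
          max.bounded_iff sum_distrib_left sum_distrib_right mult.assoc)
        (simp only: ac_simps)
    thus ?case by blast
  qed (auto simp: c.poly_eval_Const \<delta> c.poly_eval_0)
qed

section \<open>Specialisation of symmetric functions to finitely many points\<close>

definition at_vars :: "('k \<Rightarrow> 'r) \<Rightarrow> nat \<Rightarrow> (nat \<Rightarrow> 'r) \<Rightarrow> 'k::comm_ring_1 mpoly \<Rightarrow> 'r::comm_ring_1" where
  "at_vars c N x = poly_eval c (\<lambda>j. \<Sum>i<N. x i ^ Suc j)"

lemma restrict_vars_eq_at_vars: "restrict_vars N = at_vars Const N Var"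
  by (simp add: fun_eq_iff restrict_vars_def at_vars_def poly_eval_def power_sum_def)

lemma poly_eval_restrict_vars:
  assumes "comm_ring_hom c"
  shows "poly_eval c x (restrict_vars N p) = at_vars c N x p"
proof -
  interpret c: comm_ring_hom c by fact
  interpret e: comm_ring_hom "poly_eval c x" by (rule c.comm_ring_hom_poly_eval)
  show ?thesis
    unfolding restrict_vars_eq_at_vars at_vars_def
  proof (rule c.poly_eval_unique)
    show "comm_ring_hom (\<lambda>p. poly_eval c x (poly_eval Const (\<lambda>j. \<Sum>i<N. Var i ^ Suc j) p))"
      by (rule comm_ring_hom_compose[OF c.comm_ring_hom_poly_eval Const_hom.comm_ring_hom_poly_eval])
  qed (simp_all add: Const_hom.poly_eval_Const Const_hom.poly_eval_Var c.poly_eval_Const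
      c.poly_eval_Var e.hom_sum e.hom_power e.hom_mult)
qed

lemma comm_ring_hom_ident: "comm_ring_hom (\<lambda>a::'k::comm_ring_1. a)"
  by standard auto

lemmas id_poly_eval =
  comm_ring_hom.poly_eval_add[OF comm_ring_hom_ident] comm_ring_hom.poly_eval_0[OF comm_ring_hom_ident]
  comm_ring_hom.poly_eval_single[OF comm_ring_hom_ident]

lemma comm_ring_hom_const_poly: "comm_ring_hom (\<lambda>a::'k::comm_ring_1. [:a:])"
  by standard (auto simp: one_pCons)

lemma pderiv_mult': "pderiv (p * r) = pderiv p * r + p * pderiv r"
  unfolding pderiv_mult by (simp add: ac_simps)

lemma pderiv_const: "pderiv [:a:] = 0"
  by (simp add: pderiv_pCons)

lemma poly_zero_if_zero_on_nat:
  fixes p :: "'k::field_char_0 poly"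
  assumes "\<And>m::nat. poly p (of_nat m) = 0"
  shows "p = 0"
proof (rule ccontr)
  assume "p \<noteq> 0"
  hence "finite {x. poly p x = 0}" by (rule poly_roots_finite)
  moreover have "range (of_nat :: nat \<Rightarrow> 'k) \<subseteq> {x. poly p x = 0}" using assms by auto
  ultimately have "finite (range (of_nat :: nat \<Rightarrow> 'k))" by (rule rev_finite_subset)
  moreover have "inj (of_nat :: nat \<Rightarrow> 'k)" by (rule injI) simp
  ultimately show False using range_inj_infinite by blast
qed

text \<open>
  Appending \<open>m\<close> copies of a new point \<open>w\<close> changes \<open>p\<^sub>r\<close> into \<open>p\<^sub>r + m w\<^sup>r\<close>, which is polynomial in
  \<open>m\<close>; the derivative at \<open>m = 0\<close> is a polynomial in \<open>w\<close> with coefficients \<open>\<partial>f/\<partial>p\<^sub>r\<close>.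
\<close>

lemma at_vars_partial_deriv_eq_0:
  fixes f :: "'k::field_char_0 mpoly"
  assumes V: "\<And>N x. at_vars (\<lambda>a. a) N x f = 0"
  shows "at_vars (\<lambda>a. a) N x (partial_deriv j f) = 0"
proof -
  define P where "P j = (\<Sum>i<N. x i ^ Suc j)" for j
  define \<phi> where "\<phi> w j = [:P j, w ^ Suc j:]" for w j
  interpret C: comm_ring_hom "\<lambda>a::'k. [:a:]" by (rule comm_ring_hom_const_poly)
  have ev: "poly (poly_eval (\<lambda>a. [:a:]) (\<phi> w) p) u = poly_eval (\<lambda>a. a) (\<lambda>j. P j + u * w ^ Suc j) p" for w u p
  proof (rule comm_ring_hom.poly_eval_unique[OF comm_ring_hom_ident])
    interpret e: comm_ring_hom "poly_eval (\<lambda>a. [:a:]) (\<phi> w)" by (rule C.comm_ring_hom_poly_eval)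
    show "comm_ring_hom (\<lambda>p. poly (poly_eval (\<lambda>a. [:a:]) (\<phi> w) p) u)"
      by standard (auto simp: e.hom_add e.hom_mult)
  qed (auto simp: C.poly_eval_Const C.poly_eval_Var \<phi>_def)
  have F0: "poly_eval (\<lambda>a. [:a:]) (\<phi> w) f = 0" for w
  proof (rule poly_zero_if_zero_on_nat)
    fix m :: nat
    define x' where "x' i = (if i < N then x i else w)" for i
    have "(\<Sum>i<N + m. x' i ^ Suc j) = P j + of_nat m * w ^ Suc j" for j
    proof -
      have "{..<N + m} = {..<N} \<union> {N..<N + m}" by auto
      hence "(\<Sum>i<N + m. x' i ^ Suc j) = (\<Sum>i<N. x' i ^ Suc j) + (\<Sum>i=N..<N + m. x' i ^ Suc j)"
        by (simp add: sum.union_disjoint ivl_disj_int)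
      also have "(\<Sum>i=N..<N + m. x' i ^ Suc j) = (\<Sum>i=N..<N + m. w ^ Suc j)"
        by (intro sum.cong) (auto simp: x'_def)
      finally show ?thesis by (simp add: x'_def P_def)
    qed
    hence "at_vars (\<lambda>a. a) (N + m) x' f = poly (poly_eval (\<lambda>a. [:a:]) (\<phi> w) f) (of_nat m)"
      unfolding ev at_vars_def by (simp only:)
    thus "poly (poly_eval (\<lambda>a. [:a:]) (\<phi> w) f) (of_nat m) = 0"
      using V by simp
  qed
  obtain J0 where J0: "\<forall>J\<ge>J0. \<forall>\<phi>. pderiv (poly_eval (\<lambda>a. [:a:]) \<phi> f) =
      (\<Sum>j<J. poly_eval (\<lambda>a. [:a:]) \<phi> (partial_deriv j f) * pderiv (\<phi> j))"
    using chain_rule[OF comm_ring_hom_const_poly, of pderiv f]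
    by (simp only: pderiv_add pderiv_const pderiv_mult') blast
  define J where "J = max J0 (Suc j)"
  define a where "a j = at_vars (\<lambda>a. a) N x (partial_deriv j f)" for j
  have "poly (\<Sum>j<J. monom (a j) (Suc j)) w = 0" for w
  proof -
    have "0 = poly (pderiv (poly_eval (\<lambda>a. [:a:]) (\<phi> w) f)) 0"
      by (simp add: F0)
    also have "\<dots> = (\<Sum>j<J. a j * w ^ Suc j)"
      unfolding J0[rule_format, of J, OF max.cobounded1[of J0 "Suc j", folded J_def]]
      unfolding poly_sum poly_mult ev by (simp add: a_def at_vars_def \<phi>_def pderiv_pCons P_def)
    finally show ?thesis by (simp add: poly_sum poly_monom)
  qed
  hence "(\<Sum>j<J. monom (a j) (Suc j)) = 0"
    unfolding poly_all_0_iff_0[symmetric] by (rule allI)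
  hence "0 = coeff (\<Sum>j<J. monom (a j) (Suc j)) (Suc j)" by simp
  also have "\<dots> = (\<Sum>i<J. if i = j then a i else 0)"
    by (simp add: coeff_sum)
  also have "\<dots> = a j" by (simp add: J_def)
  finally show ?thesis by (simp add: a_def)
qed

lemma poly_eval_zero_point:
  fixes f :: "'k::comm_ring_1 mpoly"
  shows "poly_eval (\<lambda>a. a) (\<lambda>_. 0) f = lookup f 0"
proof (induction f rule: poly_mapping_additive_induct)
  case (single t a)
  have "(\<Prod>j\<in>keys t. 0 ^ lookup t j) = (0::'k)" if "t \<noteq> 0"
  proof -
    from that obtain j where "j \<in> keys t" by (meson all_not_in_conv keys_eq_empty)
    thus ?thesis by (intro prod_zero) (auto intro!: bexI[of _ j] simp: in_keys_iff zero_power)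
  qed
  thus ?case by (cases "t = 0") (simp_all add: id_poly_eval lookup_single)
qed (auto simp: id_poly_eval lookup_add id_poly_eval)

text \<open>Vanishing at all points passes to every iterated derivative by
  \<open>at_vars_partial_deriv_eq_0\<close>. On the empty set of points all power sums are 0, so
  evaluation there yields the constant term; in characteristic 0 the constant terms of the
  derivatives control all coefficients.\<close>

theorem power_sums_algebraically_independent:
  fixes f :: "'k::field_char_0 mpoly"
  assumes "\<And>N x. at_vars (\<lambda>a. a) N x f = 0"
  shows "f = 0"
proof -
  define V where "V f \<longleftrightarrow> (\<forall>N x. at_vars (\<lambda>a. a) N x f = 0)" for f :: "'k mpoly"
  \<comment> \<open>The exponents at which every polynomial with vanishing specialisations has
    coefficient 0. This set contains 0 and is closed under adding unit vectors.\<close>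
  define Z where "Z = {s. \<forall>f. V f \<longrightarrow> lookup f s = 0}"
  have step: "s + single j 1 \<in> Z" if "s \<in> Z" for s j
    unfolding Z_def
  proof (intro CollectI allI impI)
    fix f assume "V f"
    hence "V (partial_deriv j f)"
      using at_vars_partial_deriv_eq_0 unfolding V_def by blast
    hence "lookup (partial_deriv j f) s = 0"
      using that unfolding Z_def by blast
    thus "lookup f (s + single j 1) = 0"
      unfolding lookup_partial_deriv using of_nat_neq_0[where 'a = 'k, of "lookup s j"]
      by (simp del: of_nat_Suc)
  qed
  have "\<forall>s\<in>Z. s + t \<in> Z" for t
  proof (induction t rule: poly_mapping_additive_induct)
    case (single j n)
    show ?case
    proof (induction n)
      case (Suc n)
      show ?case
      proof
        fix s assume "s \<in> Z"
        hence "s + single j n + single j 1 \<in> Z" using Suc step by blast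
        thus "s + single j (Suc n) \<in> Z"
          by (simp add: add.assoc flip: single_add)
      qed
    qed simp
  qed (auto simp flip: add.assoc)
  moreover have "0 \<in> Z"
  proof -
    have "lookup f 0 = 0" if "V f" for f
      using that[unfolded V_def, rule_format, of 0 undefined] by (simp add: at_vars_def poly_eval_zero_point)
    thus ?thesis by (simp add: Z_def)
  qed
  ultimately have "t \<in> Z" for t by force
  moreover have "V f" using assms by (simp add: V_def)
  ultimately show ?thesis
    by (intro poly_mapping_eqI) (simp add: Z_def)
qed

text \<open>Padding with points equal to 0 does not change the power sums, so a small number of
  points can be raised to at least \<open>n\<close>.\<close>

lemma restrict_vars_eq_0_imp_eq_0:
  fixes f :: "'k::field_char_0 mpoly"
  assumes "\<And>N. N \<ge> n \<Longrightarrow> restrict_vars N f = 0"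
  shows "f = 0"
proof (rule power_sums_algebraically_independent)
  fix N and x :: "nat \<Rightarrow> 'k"
  define x' where "x' i = (if i < N then x i else 0)" for i
  have "(\<Sum>i<N + n. x' i ^ Suc j) = (\<Sum>i<N. x i ^ Suc j)" for j
    by (rule sum.mono_neutral_cong_right) (auto simp: x'_def)
  hence "at_vars (\<lambda>a. a) N x f = at_vars (\<lambda>a. a) (N + n) x' f"
    by (simp add: at_vars_def)
  also have "\<dots> = poly_eval (\<lambda>a. a) x' (restrict_vars (N + n) f)"
    by (rule poly_eval_restrict_vars[symmetric, OF comm_ring_hom_ident])
  also have "\<dots> = 0"
    by (simp add: assms id_poly_eval)
  finally show "at_vars (\<lambda>a. a) N x f = 0" .
qed

subsection \<open>Complete symmetric functions and the translations of the power sums\<close>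

text \<open>
  \<open>hs \<epsilon> n\<close> is the coefficient of \<open>z\<^sup>n\<close> in \<open>exp (\<epsilon> \<Sum>r\<ge>1. p\<^sub>r z\<^sup>r / r)\<close>: for \<open>\<epsilon> = 1\<close> this is \<open>h\<^sub>n\<close>, for
  \<open>\<epsilon> = -1\<close> it is \<open>(-1)\<^sup>n e\<^sub>n\<close>.
\<close>

fun hs :: "'k::field_char_0 \<Rightarrow> nat \<Rightarrow> 'k mpoly" where
  "hs \<epsilon> 0 = 1"
| "hs \<epsilon> (Suc n) = Const (\<epsilon> / of_nat (Suc n)) * (\<Sum>k\<le>n. Var k * hs \<epsilon> (n - k))"

lemma hs_Suc: "of_nat (Suc n) * hs \<epsilon> (Suc n) = Const \<epsilon> * (\<Sum>k\<le>n. Var k * hs \<epsilon> (n - k))"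
proof -
  have "of_nat (Suc n) * Const (\<epsilon> / of_nat (Suc n)) = Const \<epsilon>"
    by (simp only: Const_hom.hom_of_nat[symmetric] Const_mult[symmetric])
      (simp del: of_nat_Suc)
  thus ?thesis by (simp only: hs.simps mult.assoc[symmetric])
qed

text \<open>The recursion of \<open>hs\<close> is the coefficient form of the differential equation
  \<open>A'\<close>, which together with A(0) = 1 determines A in characteristic 0. Images of
  \<open>hs\<close> under homomorphisms are thus found by computing a logarithmic
  derivative.\<close>

lemma hom_hs_eq_fps_nth:
  fixes \<phi> :: "'k::field_char_0 mpoly \<Rightarrow> 'r::{idom, ring_char_0}" and A :: "'r fps"
  assumes "comm_ring_hom \<phi>" and A0: "fps_nth A 0 = 1"
    and A': "fps_deriv A = fps_const (\<phi> (Const \<epsilon>)) * Abs_fps (\<lambda>k. \<phi> (Var k)) * A"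
  shows "\<phi> (hs \<epsilon> n) = fps_nth A n"
proof (induction n rule: less_induct)
  case (less n)
  interpret \<phi>: comm_ring_hom \<phi> by fact
  show ?case
  proof (cases n)
    case (Suc m)
    have "of_nat (Suc m) * \<phi> (hs \<epsilon> (Suc m)) = \<phi> (of_nat (Suc m) * hs \<epsilon> (Suc m))"
      by (simp only: \<phi>.hom_mult \<phi>.hom_of_nat)
    also have "\<dots> = \<phi> (Const \<epsilon>) * (\<Sum>k\<le>m. \<phi> (Var k) * fps_nth A (m - k))"
      unfolding hs_Suc \<phi>.hom_mult \<phi>.hom_sum using less Suc
      by (intro arg_cong2[of _ _ _ _ "(*)"] sum.cong refl) auto
    also have "\<dots> = fps_nth (fps_deriv A) m"
      unfolding A' mult.assoc
      by (subst fps_mult_left_const_nth) (simp add: fps_mult_nth atLeast0AtMost)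
    also have "\<dots> = of_nat (Suc m) * fps_nth A (Suc m)" by simp
    finally show ?thesis unfolding Suc using of_nat_neq_0[where 'a = 'r, of m] by (simp del: of_nat_Suc)
  qed (use A0 in simp)
qed

lemma hs_fps_deriv:
  assumes "comm_ring_hom (\<phi> :: 'k::field_char_0 mpoly \<Rightarrow> 'r::comm_ring_1)"
  shows "fps_deriv (Abs_fps (\<lambda>n. \<phi> (hs \<epsilon> n))) =
    fps_const (\<phi> (Const \<epsilon>)) * Abs_fps (\<lambda>k. \<phi> (Var k)) * Abs_fps (\<lambda>n. \<phi> (hs \<epsilon> n))"
proof (rule fps_ext)
  fix n
  interpret \<phi>: comm_ring_hom \<phi> by fact
  have "fps_nth (fps_deriv (Abs_fps (\<lambda>n. \<phi> (hs \<epsilon> n)))) n = \<phi> (of_nat (Suc n) * hs \<epsilon> (Suc n))"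
    unfolding \<phi>.hom_mult \<phi>.hom_of_nat by simp
  also have "\<dots> = fps_nth (fps_const (\<phi> (Const \<epsilon>)) * (Abs_fps (\<lambda>k. \<phi> (Var k)) * Abs_fps (\<lambda>n. \<phi> (hs \<epsilon> n)))) n"
    unfolding hs_Suc \<phi>.hom_mult \<phi>.hom_sum
    by (subst fps_mult_left_const_nth) (simp add: fps_mult_nth atLeast0AtMost)
  finally show "fps_nth (fps_deriv (Abs_fps (\<lambda>n. \<phi> (hs \<epsilon> n)))) n =
      fps_nth (fps_const (\<phi> (Const \<epsilon>)) * Abs_fps (\<lambda>k. \<phi> (Var k)) * Abs_fps (\<lambda>n. \<phi> (hs \<epsilon> n))) n"
    by (simp only: mult.assoc)
qed

definition geom :: "'r::comm_ring_1 \<Rightarrow> 'r fps" where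
  "geom a = Abs_fps (\<lambda>n. a ^ n)"

lemma geom_mult: "(1 - fps_const a * fps_X) * geom a = 1"
proof (rule fps_ext)
  fix n show "fps_nth ((1 - fps_const a * fps_X) * geom a) n = fps_nth (1 :: 'a fps) n"
    by (cases n) (auto simp: geom_def algebra_simps fps_mult_left_const_nth mult.assoc)
qed

lemma geom_deriv: "fps_deriv (geom (a::'r::idom)) = fps_const a * geom a * geom a"
proof -
  have "fps_deriv ((1 - fps_const a * fps_X) * geom a) = 0" by (simp add: geom_mult)
  hence "(1 - fps_const a * fps_X) * fps_deriv (geom a) = fps_const a * geom a"
    by (simp add: algebra_simps)
  hence "((1 - fps_const a * fps_X) * geom a) * fps_deriv (geom a) = fps_const a * geom a * geom a"
    by (simp only: mult_ac)
  thus ?thesis by (simp only: geom_mult mult_1)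
qed

lemma geom_shift: "Abs_fps (\<lambda>k. a ^ Suc k) = fps_const a * geom a"
  by (rule fps_ext) (simp add: geom_def)

text \<open>The logarithmic derivatives of the two factors are opposite, so the product is constant.
  This is the classical H(z) E(-z) = 1.\<close>

lemma hs_mult_hs_uminus:
  "Abs_fps (hs \<epsilon>) * Abs_fps (hs (- \<epsilon>)) = (1 :: 'k::field_char_0 mpoly fps)"
proof -
  let ?B = "Abs_fps (hs \<epsilon>) * Abs_fps (hs (- \<epsilon>)) :: 'k mpoly fps"
  have "fps_deriv ?B = 0"
    using hs_fps_deriv[OF comm_ring_hom_ident, of \<epsilon>] hs_fps_deriv[OF comm_ring_hom_ident, of "- \<epsilon>"]
    by (simp add: Const_hom.hom_uminus algebra_simps flip: fps_const_neg)
  hence "?B = fps_const (fps_nth ?B 0)" by (simp only: fps_deriv_eq_0_iff)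
  thus ?thesis by simp
qed

text \<open>The logarithmic derivative of the product of the series 1 / (1 - x_i z) is the sum of
  the x_i / (1 - x_i z), whose coefficients are the power sums.\<close>

lemma at_vars_hs:
  assumes "comm_ring_hom c"
  shows "at_vars c N x (hs 1 n) = fps_nth (\<Prod>i<N. geom (x i :: 'r::{idom, ring_char_0})) n"
proof (rule hom_hs_eq_fps_nth)
  interpret c: comm_ring_hom c by fact
  show "comm_ring_hom (at_vars c N x)"
    unfolding at_vars_def by (rule c.comm_ring_hom_poly_eval)
  have [simp]: "at_vars c N x (Var k) = (\<Sum>i<N. x i ^ Suc k)" for k
    unfolding at_vars_def by (rule c.poly_eval_Var)
  have [simp]: "at_vars c N x 1 = 1"
    by (simp add: at_vars_def c.poly_eval_1)
  show "fps_nth (\<Prod>i<N. geom (x i)) 0 = 1"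
    by (induction N) (auto simp: geom_def)
  have "Abs_fps (\<lambda>k. at_vars c N x (Var k)) = (\<Sum>i<N. fps_const (x i) * geom (x i))"
    unfolding geom_shift[symmetric] by (rule fps_ext) (simp add: fps_sum_nth)
  moreover have "fps_deriv (\<Prod>i<N. geom (x i)) = (\<Sum>i<N. fps_const (x i) * geom (x i)) * (\<Prod>i<N. geom (x i))"
    for N by (induction N) (auto simp: geom_deriv algebra_simps)
  ultimately show "fps_deriv (\<Prod>i<N. geom (x i)) =
      fps_const (at_vars c N x (Const 1)) * Abs_fps (\<lambda>k. at_vars c N x (Var k)) * (\<Prod>i<N. geom (x i))"
    by simp
qed

text \<open>
  The translation \<open>p\<^sub>r \<mapsto> p\<^sub>r - \<epsilon> u\<^sup>r\<close>, as a polynomial in \<open>u\<close>; its coefficients \<open>trans_coeff \<epsilon> l\<close>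
  are \<open>(-1)\<^sup>l e\<^sub>l\<^sup>\<bottom>\<close> for \<open>\<epsilon> = 1\<close> and \<open>h\<^sub>l\<^sup>\<bottom>\<close> for \<open>\<epsilon> = -1\<close>.
\<close>

definition translate :: "'k::field_char_0 \<Rightarrow> 'k mpoly \<Rightarrow> 'k mpoly poly" where
  "translate \<epsilon> = poly_eval (\<lambda>a. [:Const a:]) (\<lambda>j. [:Var j:] - monom (Const \<epsilon>) (Suc j))"

lemma comm_ring_hom_const_poly_Const: "comm_ring_hom (\<lambda>a::'k::comm_ring_1. [:Const a:])"
  by (rule comm_ring_hom_compose[OF comm_ring_hom_const_poly comm_ring_hom_Const])

lemma comm_ring_hom_translate: "comm_ring_hom (translate \<epsilon>)"
  unfolding translate_def
  by (rule comm_ring_hom.comm_ring_hom_poly_eval[OF comm_ring_hom_const_poly_Const])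

interpretation translate: comm_ring_hom "translate \<epsilon>"
  by (rule comm_ring_hom_translate)

lemma translate_Const [simp]: "translate \<epsilon> (Const a) = [:Const a:]"
  unfolding translate_def by (rule comm_ring_hom.poly_eval_Const[OF comm_ring_hom_const_poly_Const])

lemma translate_Var: "translate \<epsilon> (Var j) = [:Var j:] - monom (Const \<epsilon>) (Suc j)"
  unfolding translate_def by (rule comm_ring_hom.poly_eval_Var[OF comm_ring_hom_const_poly_Const])

lemma const_poly_fps_deriv:
  "fps_deriv (Abs_fps (\<lambda>n. [:hs \<epsilon> n:])) =
    fps_const [:Const \<epsilon>:] * Abs_fps (\<lambda>k. [:Var k:]) * Abs_fps (\<lambda>n. [:hs \<epsilon> n:])"
  by (rule hs_fps_deriv[OF comm_ring_hom_const_poly])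

lemma translate_Var_fps:
  "Abs_fps (\<lambda>k. translate \<epsilon> (Var k)) =
    Abs_fps (\<lambda>k. [:Var k:]) - fps_const [:Const \<epsilon>:] * (fps_const [:0, 1:] * geom [:0, 1:])"
proof -
  have "[:Const \<epsilon>:] * [:0, 1:] ^ Suc k = monom (Const \<epsilon>) (Suc k)" for k
    by (simp add: monom_altdef)
  thus ?thesis
    unfolding geom_shift[symmetric] by (intro fps_ext) (simp add: translate_Var del: power_Suc)
qed

text \<open>The translation multiplies the generating series of \<open>hs \<epsilon>\<close> by the
  exponential of minus the sum of the (u z)^r / r, since \<epsilon> squares to 1. That factor is 1 -
  u z.\<close>

lemma translate_hs_same:
  assumes "\<epsilon> * \<epsilon> = 1"
  shows "translate \<epsilon> (hs \<epsilon> n) = [:hs \<epsilon> n:] - (if n = 0 then 0 else [:0, hs \<epsilon> (n - 1):])"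
proof -
  let ?u = "[:0, 1 :: 'a mpoly:]"
  let ?H = "Abs_fps (\<lambda>n. [:hs \<epsilon> n:])"
  let ?P = "Abs_fps (\<lambda>k. [:Var k :: 'a mpoly:])"
  let ?e = "fps_const [:Const \<epsilon>:]"
  define A where "A = ?H * (1 - fps_const ?u * fps_X)"
  have ee: "?e * ?e = 1"
    by (simp add: fps_const_mult assms flip: Const_mult)
  have "translate \<epsilon> (hs \<epsilon> n) = fps_nth A n"
  proof (rule hom_hs_eq_fps_nth[OF comm_ring_hom_translate])
    show "fps_nth A 0 = 1" by (simp add: A_def one_pCons)
    have "fps_deriv A = ?e * ?P * A - fps_const ?u * ?H"
    proof -
      have *: "h * (- u) + e * p * h * w = e * p * (h * w) - u * h" for h u e p w :: "'a mpoly poly fps"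
        by (simp add: algebra_simps)
      have "fps_deriv (1 - fps_const ?u * fps_X) = - fps_const ?u"
        by (simp add: fps_deriv_mult)
      thus ?thesis unfolding A_def fps_deriv_mult const_poly_fps_deriv by (simp only: *)
    qed
    also have "fps_const ?u * ?H = (?e * ?e) * (fps_const ?u * geom ?u) * A"
    proof -
      have "(fps_const ?u * geom ?u) * A = fps_const ?u * (((1 - fps_const ?u * fps_X) * geom ?u) * ?H)"
        unfolding A_def by (simp only: mult_ac)
      thus ?thesis by (simp only: geom_mult ee mult_1)
    qed
    also have "?e * ?P * A - (?e * ?e) * (fps_const ?u * geom ?u) * A =
        ?e * (?P - ?e * (fps_const ?u * geom ?u)) * A"
      by (simp only: algebra_simps)
    finally show "fps_deriv A = fps_const (translate \<epsilon> (Const \<epsilon>)) * Abs_fps (\<lambda>k. translate \<epsilon> (Var k)) * A"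
      unfolding translate_Var_fps translate_Const .
  qed
  also have "\<dots> = [:hs \<epsilon> n:] - (if n = 0 then 0 else [:0, hs \<epsilon> (n - 1):])"
    by (cases n) (auto simp: A_def right_diff_distrib mult.assoc[symmetric] fps_mult_right_const_nth
        simp del: hs.simps(2))
  finally show ?thesis .
qed

text \<open>With the opposite sign the extra factor is the geometric series 1 / (1 - u z).\<close>

lemma translate_hs_opposite:
  assumes "\<epsilon> * \<epsilon> = 1"
  shows "translate (- \<epsilon>) (hs \<epsilon> n) = (\<Sum>k\<le>n. monom (hs \<epsilon> (n - k)) k)"
proof -
  let ?u = "[:0, 1 :: 'a mpoly:]"
  let ?H = "Abs_fps (\<lambda>n. [:hs \<epsilon> n:])"
  let ?P = "Abs_fps (\<lambda>k. [:Var k :: 'a mpoly:])"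
  let ?e = "fps_const [:Const \<epsilon>:]"
  have ee: "?e * ?e = 1"
    by (simp add: fps_const_mult assms flip: Const_mult)
  have "translate (- \<epsilon>) (hs \<epsilon> n) = fps_nth (geom ?u * ?H) n"
  proof (rule hom_hs_eq_fps_nth[OF comm_ring_hom_translate])
    show "fps_nth (geom ?u * ?H) 0 = 1" by (simp add: geom_def one_pCons)
    have "fps_deriv (geom ?u * ?H) = ?e * ?P * (geom ?u * ?H) + (?e * ?e) * (fps_const ?u * geom ?u) * (geom ?u * ?H)"
      unfolding fps_deriv_mult const_poly_fps_deriv geom_deriv ee by (simp only: algebra_simps mult_1)
    also have "\<dots> = ?e * (?P - (- ?e) * (fps_const ?u * geom ?u)) * (geom ?u * ?H)"
      by (simp only: algebra_simps minus_mult_left[symmetric] minus_mult_right[symmetric] minus_minus diff_minus_eq_add)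
    also have "- ?e = fps_const [:Const (- \<epsilon>):]"
      by (simp add: Const_hom.hom_uminus)
    finally show "fps_deriv (geom ?u * ?H) =
        fps_const (translate (- \<epsilon>) (Const \<epsilon>)) * Abs_fps (\<lambda>k. translate (- \<epsilon>) (Var k)) * (geom ?u * ?H)"
      unfolding translate_Var_fps translate_Const .
  qed
  also have "\<dots> = (\<Sum>k\<le>n. monom (hs \<epsilon> (n - k)) k)"
    unfolding fps_mult_nth atLeast0AtMost
    by (intro sum.cong refl) (simp add: geom_def monom_altdef mult.commute)
  finally show ?thesis .
qed

definition trans_coeff :: "'k::field_char_0 \<Rightarrow> nat \<Rightarrow> 'k mpoly \<Rightarrow> 'k mpoly" where
  "trans_coeff \<epsilon> l f = coeff (translate \<epsilon> f) l"

lemma trans_coeff_add: "trans_coeff \<epsilon> l (f + g) = trans_coeff \<epsilon> l f + trans_coeff \<epsilon> l g"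
  by (simp add: trans_coeff_def translate.hom_add)

lemma trans_coeff_0 [simp]: "trans_coeff \<epsilon> l 0 = 0"
  by (simp add: trans_coeff_def)

lemma trans_coeff_sum: "trans_coeff \<epsilon> l (\<Sum>i\<in>I. f i) = (\<Sum>i\<in>I. trans_coeff \<epsilon> l (f i))"
  by (induction I rule: infinite_finite_induct) (auto simp: trans_coeff_add)

lemma trans_coeff_Const: "trans_coeff \<epsilon> l (Const c) = (if l = 0 then Const c else 0)"
  by (simp add: trans_coeff_def coeff_pCons split: nat.splits)

lemma trans_coeff_Const_mult: "trans_coeff \<epsilon> l (Const c * f) = Const c * trans_coeff \<epsilon> l f"
  by (simp add: trans_coeff_def translate.hom_mult)

lemma trans_coeff_1: "trans_coeff \<epsilon> l 1 = (if l = 0 then 1 else 0)"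
  using trans_coeff_Const[of \<epsilon> l 1] by simp

lemma trans_coeff_eventually_0: "\<exists>M. \<forall>l\<ge>M. trans_coeff \<epsilon> l f = 0"
  unfolding trans_coeff_def by (rule exI[of _ "Suc (degree (translate \<epsilon> f))"]) (auto intro: coeff_eq_0)

lemma trans_coeff_zeroth [simp]: "trans_coeff \<epsilon> 0 f = f"
  by (induction f rule: mpoly_induct)
    (auto simp: trans_coeff_add trans_coeff_Const trans_coeff_def translate_Var translate.hom_mult
      translate.hom_add coeff_mult)

lemma partial_deriv_Const_mult: "partial_deriv j (Const c * f) = Const c * partial_deriv j f"
  by (simp add: partial_deriv_mult)

lemma partial_deriv_sum: "partial_deriv j (\<Sum>i\<in>I. f i) = (\<Sum>i\<in>I. partial_deriv j (f i))"
  by (induction I rule: infinite_finite_induct) (auto simp: partial_deriv_add)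

text \<open>Differentiate the translate with respect to u by the chain rule and compare coefficients
  of u^l. The recursion builds \<open>trans_coeff\<close> from the commuting operators
  \<open>partial_deriv\<close>, so commutation properties follow by induction on
  \<open>l\<close>.\<close>

lemma Suc_mult_trans_coeff:
  "Const (of_nat (Suc l)) * trans_coeff \<epsilon> (Suc l) f =
    (\<Sum>j\<le>l. Const (- \<epsilon> * of_nat (Suc j)) * trans_coeff \<epsilon> (l - j) (partial_deriv j f))"
proof -
  let ?\<phi> = "\<lambda>j. [:Var j:] - monom (Const \<epsilon>) (Suc j)"
  have "\<exists>J0. \<forall>J\<ge>J0. \<forall>\<phi>. pderiv (poly_eval (\<lambda>a. [:Const a:]) \<phi> f) =
      (\<Sum>j<J. poly_eval (\<lambda>a. [:Const a:]) \<phi> (partial_deriv j f) * pderiv (\<phi> j))"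
    by (rule chain_rule[OF comm_ring_hom_const_poly_Const])
      (simp_all add: pderiv_add pderiv_mult' pderiv_const del: mult_pCons_left mult_pCons_right)
  then obtain J0 where J0: "\<And>J. J \<ge> J0 \<Longrightarrow>
      pderiv (translate \<epsilon> f) = (\<Sum>j<J. translate \<epsilon> (partial_deriv j f) * pderiv (?\<phi> j))"
    unfolding translate_def by blast
  define J where "J = max J0 (Suc l)"
  have d: "pderiv (?\<phi> j) = monom (Const (- \<epsilon> * of_nat (Suc j))) j" for j
    by (simp add: pderiv_diff pderiv_const pderiv_monom Const_mult Const_hom.hom_uminus
        Const_hom.hom_of_nat Const_hom.hom_add mult.commute minus_monom del: of_nat_Suc)
  have "Const (of_nat (Suc l)) * trans_coeff \<epsilon> (Suc l) f = coeff (pderiv (translate \<epsilon> f)) l"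
    unfolding coeff_pderiv Const_hom.hom_of_nat trans_coeff_def by simp
  also have "\<dots> = (\<Sum>j<J. coeff (translate \<epsilon> (partial_deriv j f) * monom (Const (- \<epsilon> * of_nat (Suc j))) j) l)"
    by (subst J0[of J]) (simp_all only: J_def max.cobounded1 d coeff_sum)
  also have "\<dots> = (\<Sum>j<J. if j \<le> l then Const (- \<epsilon> * of_nat (Suc j)) * trans_coeff \<epsilon> (l - j) (partial_deriv j f) else 0)"
    by (intro sum.cong refl) (simp add: coeff_monom_mult mult.commute[of _ "monom _ _"] trans_coeff_def)
  also have "\<dots> = (\<Sum>j\<le>l. Const (- \<epsilon> * of_nat (Suc j)) * trans_coeff \<epsilon> (l - j) (partial_deriv j f))"
    by (rule sum.mono_neutral_cong_right) (auto simp: J_def)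
  finally show ?thesis .
qed

lemma Const_of_nat_Suc_cancel:
  "Const (of_nat (Suc l)) * f = Const (of_nat (Suc l)) * g \<longleftrightarrow> f = (g :: 'k::field_char_0 mpoly)"
  unfolding Const_hom.hom_of_nat using of_nat_neq_0[where 'a = "'k mpoly", of l]
  by (simp del: of_nat_Suc)

lemma trans_coeff_partial_deriv:
  "trans_coeff \<epsilon> l (partial_deriv i f) = partial_deriv i (trans_coeff \<epsilon> l f)"
proof (induction l arbitrary: f rule: less_induct)
  case (less l)
  show ?case
  proof (cases l)
    case (Suc m)
    have "Const (of_nat l) * trans_coeff \<epsilon> l (partial_deriv i f) =
        Const (of_nat l) * partial_deriv i (trans_coeff \<epsilon> l f)"
      unfolding partial_deriv_Const_mult[symmetric] Suc Suc_mult_trans_coeff partial_deriv_sum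
      by (intro sum.cong refl)
        (auto simp: partial_deriv_Const_mult partial_deriv_commute[of _ i] less Suc)
    thus ?thesis unfolding Suc Const_of_nat_Suc_cancel .
  qed simp
qed

lemma trans_coeff_commute:
  "trans_coeff \<epsilon> l (trans_coeff \<delta> m f) = trans_coeff \<delta> m (trans_coeff \<epsilon> l f)"
proof (induction l arbitrary: f rule: less_induct)
  case (less l)
  show ?case
  proof (cases l)
    case (Suc n)
    have "Const (of_nat l) * trans_coeff \<epsilon> l (trans_coeff \<delta> m f) =
        Const (of_nat l) * trans_coeff \<delta> m (trans_coeff \<epsilon> l f)"
      unfolding trans_coeff_Const_mult[symmetric, where \<epsilon> = \<delta>] Suc Suc_mult_trans_coeff trans_coeff_sum
      by (intro sum.cong refl)
        (auto simp: trans_coeff_Const_mult trans_coeff_partial_deriv[symmetric] less Suc)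
    thus ?thesis unfolding Suc Const_of_nat_Suc_cancel .
  qed simp
qed

lemma trans_coeff_mult:
  "trans_coeff \<epsilon> l (f * g) = (\<Sum>i\<le>l. trans_coeff \<epsilon> i f * trans_coeff \<epsilon> (l - i) g)"
  by (simp add: trans_coeff_def translate.hom_mult coeff_mult)

lemma trans_coeff_hs_mult_same:
  assumes "\<epsilon> * \<epsilon> = 1"
  shows "trans_coeff \<epsilon> l (hs \<epsilon> n * f) =
    hs \<epsilon> n * trans_coeff \<epsilon> l f - (if n = 0 \<or> l = 0 then 0 else hs \<epsilon> (n - 1) * trans_coeff \<epsilon> (l - 1) f)"
  by (cases l) (auto simp: trans_coeff_def translate.hom_mult translate_hs_same[OF assms] algebra_simps
      simp del: hs.simps(2))

lemma trans_coeff_hs_opposite: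
  assumes "\<epsilon> * \<epsilon> = 1"
  shows "trans_coeff (- \<epsilon>) l (hs \<epsilon> n) = (if l \<le> n then hs \<epsilon> (n - l) else 0)"
  by (auto simp: trans_coeff_def translate_hs_opposite[OF assms] coeff_sum simp del: hs.simps(2))

text \<open>The translations for \<epsilon> and -\<epsilon> by the same u undo each other; the sum
  is the coefficient of u^n in their composite.\<close>

lemma trans_coeff_inverse:
  "(\<Sum>k\<le>n. trans_coeff \<epsilon> (n - k) (trans_coeff (- \<epsilon>) k f)) = (if n = 0 then f else 0)"
proof -
  \<comment> \<open>Translates the coefficients of a polynomial in u and multiplies out with the
    same u, so that \<open>L\<close> after a translation is a composite of translations.\<close>
  define L where "L Q = poly (map_poly (translate \<epsilon>) Q) [:0, 1:]" for Q
  have "comm_ring_hom L"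
    unfolding L_def by (rule comm_ring_hom_poly_map_poly[OF comm_ring_hom_translate])
  then interpret L: comm_ring_hom L .
  have L_pCons: "L (pCons a Q) = translate \<epsilon> a + [:0, 1:] * L Q" for a Q
    unfolding L_def by (rule poly_map_poly_pCons) simp
  have coeff_L: "coeff (L Q) n = (\<Sum>k\<le>n. trans_coeff \<epsilon> (n - k) (coeff Q k))" for Q n
  proof (induction Q arbitrary: n)
    case (pCons a Q)
    show ?case
      by (cases n) (simp_all add: L_pCons pCons.IH sum.atMost_Suc_shift trans_coeff_def
          del: sum.atMost_Suc)
  qed simp
  have L1: "L [:a:] = translate \<epsilon> a" for a by (simp add: L_pCons)
  have "L (translate (- \<epsilon>) f) = [:f:]"
  proof (induction f rule: mpoly_induct)
    case (Var j)
    have m: "L (monom a n) = translate \<epsilon> a * monom 1 n" for a n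
      by (induction n) (auto simp: monom_0 L1 monom_Suc L_pCons)
    have t: "translate (- \<epsilon>) (Var j) = [:Var j:] + monom (Const \<epsilon>) (Suc j)"
      by (simp add: translate_Var Const_hom.hom_uminus flip: minus_monom)
    show ?case
      unfolding t L.hom_add m L1 by (simp add: translate_Var smult_monom)
  qed (simp_all add: translate.hom_add translate.hom_mult L.hom_add L.hom_mult L1)
  thus ?thesis
    using coeff_L[of "translate (- \<epsilon>) f" n]
    by (simp add: trans_coeff_def coeff_pCons split: nat.splits)
qed

subsection \<open>Vertex operators\<close>

text \<open>Stands for the sum over all \<open>l\<close>: the coefficients vanish beyond the degree.
  \<open>trans_sum_eq\<close> replaces the degree by any convenient bound.\<close>

definition trans_sum :: "'k::field_char_0 \<Rightarrow> (nat \<Rightarrow> 'k mpoly \<Rightarrow> 'b::comm_monoid_add) \<Rightarrow> 'k mpoly \<Rightarrow> 'b" where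
  "trans_sum \<epsilon> \<phi> f = (\<Sum>l\<le>degree (translate \<epsilon> f). \<phi> l (trans_coeff \<epsilon> l f))"

lemma trans_sum_eq:
  assumes "\<And>l. \<phi> l 0 = 0" and "\<forall>l\<ge>M. trans_coeff \<epsilon> l f = 0"
  shows "trans_sum \<epsilon> \<phi> f = (\<Sum>l<M. \<phi> l (trans_coeff \<epsilon> l f))"
proof -
  let ?d = "degree (translate \<epsilon> f)"
  have "trans_coeff \<epsilon> l f = 0" if "l > ?d" for l
    using that by (simp add: trans_coeff_def coeff_eq_0)
  hence "trans_sum \<epsilon> \<phi> f = (\<Sum>l\<in>{..?d} \<union> {..<M}. \<phi> l (trans_coeff \<epsilon> l f))"
    unfolding trans_sum_def by (intro sum.mono_neutral_left) (auto simp: assms)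
  also have "\<dots> = (\<Sum>l<M. \<phi> l (trans_coeff \<epsilon> l f))"
    by (intro sum.mono_neutral_right) (auto simp: assms)
  finally show ?thesis .
qed

text \<open>If \<open>g n\<close> is the coefficient of z^n in a series G(z), this is the
  coefficient of z^a in G(z) times the translation of each p_r by -\<epsilon> z^(-r). Bernstein's
  operators and both currents have this form.\<close>

definition vertex_op :: "'k::field_char_0 \<Rightarrow> (int \<Rightarrow> 'k mpoly) \<Rightarrow> int \<Rightarrow> 'k mpoly \<Rightarrow> 'k mpoly" where
  "vertex_op \<epsilon> g a = trans_sum \<epsilon> (\<lambda>l x. g (a + int l) * x)"

lemma vertex_op_eq:
  assumes "\<forall>l\<ge>M. trans_coeff \<epsilon> l f = 0"
  shows "vertex_op \<epsilon> g a f = (\<Sum>l<M. g (a + int l) * trans_coeff \<epsilon> l f)"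
  unfolding vertex_op_def by (rule trans_sum_eq) (auto simp: assms)

lemma vertex_op_add: "vertex_op \<epsilon> g a (f1 + f2) = vertex_op \<epsilon> g a f1 + vertex_op \<epsilon> g a f2"
proof -
  obtain M1 M2 where "\<forall>l\<ge>M1. trans_coeff \<epsilon> l f1 = 0" "\<forall>l\<ge>M2. trans_coeff \<epsilon> l f2 = 0"
    using trans_coeff_eventually_0 by blast
  thus ?thesis
    by (simp add: vertex_op_eq[of "max M1 M2"] trans_coeff_add algebra_simps sum.distrib)
qed

lemma vertex_op_Const_mult: "vertex_op \<epsilon> g a (Const c * f) = Const c * vertex_op \<epsilon> g a f"
proof -
  obtain M where M: "\<forall>l\<ge>M. trans_coeff \<epsilon> l f = 0"
    using trans_coeff_eventually_0 by blast
  have "vertex_op \<epsilon> g a (Const c * f) = (\<Sum>l<M. g (a + int l) * trans_coeff \<epsilon> l (Const c * f))"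
    by (rule vertex_op_eq) (simp add: trans_coeff_Const_mult M)
  thus ?thesis
    unfolding vertex_op_eq[OF M] trans_coeff_Const_mult sum_distrib_left by (simp add: mult_ac)
qed

definition hz :: "'k::field_char_0 \<Rightarrow> int \<Rightarrow> 'k mpoly" where
  "hz \<epsilon> n = (if n < 0 then 0 else hs \<epsilon> (nat n))"

subsection \<open>Alternants and Schur functions\<close>

definition alt :: "(nat \<Rightarrow> 'r) \<Rightarrow> nat \<Rightarrow> (nat \<Rightarrow> nat) \<Rightarrow> 'r::comm_ring_1" where
  "alt x N \<alpha> = det (mat N N (\<lambda>(r, c). x r ^ \<alpha> c))"

lemma alternant_eq_alt: "alternant N = alt Var N"
  by (simp add: fun_eq_iff alternant_def alt_def)

definition skip :: "nat \<Rightarrow> (nat \<Rightarrow> 'r) \<Rightarrow> nat \<Rightarrow> 'r" where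
  "skip j x i = (if i < j then x i else x (Suc i))"

lemma alt_laplace:
  "alt x (Suc n) \<alpha> = (\<Sum>j<Suc n. x j ^ \<alpha> 0 * ((- 1) ^ j * alt (skip j x) n (\<lambda>c. \<alpha> (Suc c))))"
proof -
  let ?A = "mat (Suc n) (Suc n) (\<lambda>(r, c). x r ^ \<alpha> c)"
  have "det ?A = (\<Sum>j<Suc n. ?A $$ (j, 0) * cofactor ?A j 0)"
    by (rule laplace_expansion_column) auto
  also have "\<dots> = (\<Sum>j<Suc n. x j ^ \<alpha> 0 * ((- 1) ^ j * alt (skip j x) n (\<lambda>c. \<alpha> (Suc c))))"
  proof (intro sum.cong refl)
    fix j assume "j \<in> {..<Suc n}"
    hence "mat_delete ?A j 0 = mat n n (\<lambda>(r, c). skip j x r ^ \<alpha> (Suc c))"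
      by (intro eq_matI) (auto simp: mat_delete_def skip_def)
    thus "?A $$ (j, 0) * cofactor ?A j 0 = x j ^ \<alpha> 0 * ((- 1) ^ j * alt (skip j x) n (\<lambda>c. \<alpha> (Suc c)))"
      using \<open>j \<in> {..<Suc n}\<close> by (simp add: cofactor_def alt_def)
  qed
  finally show ?thesis by (simp add: alt_def)
qed

lemma alt_equal_exponents:
  assumes "i < N" "j < N" "i \<noteq> j" "\<alpha> i = \<alpha> j"
  shows "alt x N \<alpha> = 0"
  unfolding alt_def by (rule det_identical_columns[of _ N i j]) (use assms in \<open>auto intro!: eq_vecI\<close>)

lemma linear_factors_fps_nth_eq_0:
  assumes "finite S" "card S < m"
  shows "fps_nth (\<Prod>k\<in>S. 1 - fps_const (x k) * fps_X :: 'r::comm_ring_1 fps) m = 0"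
  using assms
proof (induction S arbitrary: m rule: finite_induct)
  case (insert k S)
  then obtain m' where "m = Suc m'" "card S < m'" by (cases m) auto
  thus ?case
    using insert by (simp add: left_diff_distrib mult.assoc fps_mult_left_const_nth)
qed auto

text \<open>
  The alternants with exponents \<open>(m, n - 1, \<dots>, 0)\<close> have a generating function in \<open>m\<close> which
  becomes a polynomial after multiplication by \<open>\<Prod>(1 - x\<^sub>k z)\<close>; its only coefficient is the Vandermonde
  determinant in degree \<open>n\<close>.
\<close>

lemma alt_complete_symmetric:
  fixes x :: "nat \<Rightarrow> 'r::{idom, ring_char_0}"
  assumes "comm_ring_hom c"
  shows "(\<Sum>j<Suc n. x j ^ (m + n) * ((- 1) ^ j * alt (skip j x) n (\<lambda>c. n - 1 - c))) =
    at_vars c (Suc n) x (hs 1 m) * alt x (Suc n) (\<lambda>c. n - c)"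
proof -
  define cf where "cf j = (- 1) ^ j * alt (skip j x) n (\<lambda>c. n - 1 - c)" for j
  define b where "b m = (\<Sum>j<Suc n. x j ^ m * cf j)" for m
  have minus_pred: "(-) (n - Suc 0) = (\<lambda>c. n - Suc c)" by (rule ext) simp
  have b: "b m = alt x (Suc n) (\<lambda>c. if c = 0 then m else n - c)" for m
    unfolding alt_laplace b_def cf_def by (simp add: minus_pred)
  have b0: "b m = 0" if "m < n" for m
    unfolding b by (rule alt_equal_exponents[of 0 _ "n - m"]) (use that in auto)
  have bn: "b n = alt x (Suc n) (\<lambda>c. n - c)"
    unfolding b by (rule arg_cong[of _ _ "alt x (Suc n)"]) auto
  define B where "B = Abs_fps b"
  define P where "P = (\<Prod>k<Suc n. 1 - fps_const (x k) * fps_X)"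
  define H where "H = (\<Prod>k<Suc n. geom (x k))"
  have PH: "P * H = 1"
    unfolding P_def H_def prod.distrib[symmetric] geom_mult by simp
  \<comment> \<open>The partial fraction expansion of the generating function.\<close>
  have B_geom: "B = (\<Sum>j<Suc n. fps_const (cf j) * geom (x j))"
    unfolding B_def b_def by (rule fps_ext) (simp add: fps_sum_nth geom_def mult.commute)
  have PB: "P * B = fps_const (b n) * fps_X ^ n"
  proof (rule fps_ext)
    fix m
    consider "m < n" | "m = n" | "m > n" by linarith
    thus "fps_nth (P * B) m = fps_nth (fps_const (b n) * fps_X ^ n) m"
    proof cases
      case 1
      hence "fps_nth (P * B) m = 0"
        unfolding fps_mult_nth by (intro sum.neutral) (auto simp: B_def b0)
      thus ?thesis using 1 by simp
    next
      case 2
      have "fps_nth P 0 = 1" unfolding P_def by (induction n) auto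
      moreover have "fps_nth (P * B) n = (\<Sum>i=0..n. if i = 0 then fps_nth P 0 * b n else 0)"
        unfolding fps_mult_nth by (intro sum.cong refl) (auto simp: B_def b0)
      ultimately show ?thesis using 2 by simp
    next
      case 3
      \<comment> \<open>In each summand one factor of \<open>P\<close> cancels the geometric series,
        leaving \<open>n\<close> linear factors and hence degree at most \<open>n\<close>.\<close>
      have "P * B = (\<Sum>j<Suc n. fps_const (cf j) * (P * geom (x j)))"
        unfolding B_geom sum_distrib_left by (simp add: mult_ac)
      also have "\<dots> = (\<Sum>j<Suc n. fps_const (cf j) * (\<Prod>k\<in>{..<Suc n} - {j}. 1 - fps_const (x k) * fps_X))"
      proof (intro sum.cong refl arg_cong2[of _ _ _ _ "(*)"])
        fix j assume "j \<in> {..<Suc n}"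
        hence "P * geom (x j) = ((1 - fps_const (x j) * fps_X) * geom (x j)) *
            (\<Prod>k\<in>{..<Suc n} - {j}. 1 - fps_const (x k) * fps_X)"
          unfolding P_def by (subst prod.remove[of _ j]) (auto simp: mult_ac)
        thus "P * geom (x j) = (\<Prod>k\<in>{..<Suc n} - {j}. 1 - fps_const (x k) * fps_X)"
          by (simp add: geom_mult)
      qed
      also have "fps_nth \<dots> m = 0"
        unfolding fps_sum_nth using 3
        by (intro sum.neutral ballI, subst fps_mult_left_const_nth)
          (simp add: linear_factors_fps_nth_eq_0)
      finally show ?thesis using 3 by simp
    qed
  qed
  have "B = (P * H) * B" by (simp add: PH)
  also have "\<dots> = (P * B) * H" by (simp only: mult_ac)
  also have "\<dots> = fps_const (b n) * (fps_X ^ n * H)" by (simp only: PB mult.assoc)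
  finally have "fps_nth B (m + n) = fps_nth (fps_const (b n) * (fps_X ^ n * H)) (m + n)"
    by (rule arg_cong)
  also have "\<dots> = b n * fps_nth H m"
    by (subst fps_mult_left_const_nth) (simp add: fps_X_power_mult_nth)
  finally have "b (m + n) = b n * fps_nth H m" by (simp add: B_def)
  thus ?thesis
    unfolding at_vars_hs[OF assms] H_def[symmetric] bn[symmetric] by (simp add: b_def cf_def mult.commute)
qed

text \<open>Omitting the point x_j replaces p_r by p_r - x_j^r, which is the translation for
  \<epsilon> = 1 at u = x_j.\<close>

lemma at_vars_skip:
  fixes x :: "nat \<Rightarrow> 'r::{idom, ring_char_0}" and c :: "'k::field_char_0 \<Rightarrow> 'r"
  assumes "comm_ring_hom c" and "j \<le> n" and M: "\<forall>l\<ge>M. trans_coeff 1 l f = 0"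
  shows "at_vars c n (skip j x) f = (\<Sum>l<M. at_vars c (Suc n) x (trans_coeff 1 l f) * x j ^ l)"
proof -
  interpret c: comm_ring_hom c by fact
  define \<phi> where "\<phi> = at_vars c (Suc n) x"
  have "comm_ring_hom \<phi>"
    unfolding \<phi>_def at_vars_def by (rule c.comm_ring_hom_poly_eval)
  then interpret \<phi>: comm_ring_hom \<phi> .
  define L where "L Q = poly (map_poly \<phi> Q) (x j)" for Q
  have "comm_ring_hom L"
    unfolding L_def by (rule comm_ring_hom_poly_map_poly) (rule \<open>comm_ring_hom \<phi>\<close>)
  then interpret L: comm_ring_hom L .
  have L_pCons: "L (pCons a Q) = \<phi> a + x j * L Q" for a Q
    unfolding L_def by (rule poly_map_poly_pCons) simp
  have LC: "L [:a:] = \<phi> a" for a by (simp add: L_pCons)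
  have "L (translate 1 f) = at_vars c n (skip j x) f"
    unfolding at_vars_def
  proof (rule c.poly_eval_unique)
    show "comm_ring_hom (\<lambda>f. L (translate 1 f))"
      by (rule comm_ring_hom_compose) (rule \<open>comm_ring_hom L\<close> comm_ring_hom_translate)+
    show "L (translate 1 (Const a)) = c a" for a
      by (simp add: LC \<phi>_def at_vars_def c.poly_eval_Const)
    show "L (translate 1 (Var i)) = (\<Sum>k<n. skip j x k ^ Suc i)" for i
    proof -
      have m: "L (monom 1 k) = x j ^ k" for k
        by (induction k) (auto simp: monom_0 LC monom_Suc L_pCons)
      have "L (translate 1 (Var i)) = (\<Sum>k<Suc n. x k ^ Suc i) - x j ^ Suc i"
        unfolding translate_Var L.hom_minus LC Const_1 m \<phi>_def at_vars_def c.poly_eval_Var ..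
      also have "(\<Sum>k<Suc n. x k ^ Suc i) = x j ^ Suc i + (\<Sum>k\<in>{..<Suc n} - {j}. x k ^ Suc i)"
        by (rule sum.remove) (use \<open>j \<le> n\<close> in auto)
      also have "(\<Sum>k\<in>{..<Suc n} - {j}. x k ^ Suc i) = (\<Sum>k<n. skip j x k ^ Suc i)"
        by (rule sum.reindex_bij_witness[of _ "\<lambda>k. if k < j then k else Suc k" "\<lambda>k. if k < j then k else k - 1"])
          (use \<open>j \<le> n\<close> in \<open>auto simp: skip_def\<close>)
      finally show ?thesis by simp
    qed
  qed
  moreover have "L Q = (\<Sum>l<M. \<phi> (coeff Q l) * x j ^ l)" if "\<And>l. l \<ge> M \<Longrightarrow> coeff Q l = 0" for Q M
    using that
  proof (induction Q arbitrary: M)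
    case (pCons a Q)
    show ?case
    proof (cases M)
      case 0
      hence "coeff (pCons a Q) l = 0" for l using pCons.prems by simp
      hence "pCons a Q = 0" by (intro poly_eqI) simp
      thus ?thesis using 0 by simp
    next
      case (Suc M')
      have "coeff Q l = 0" if "l \<ge> M'" for l
        using pCons.prems[of "Suc l"] that Suc by simp
      from pCons.IH[OF this] show ?thesis
        unfolding Suc L_pCons sum.lessThan_Suc_shift by (simp add: sum_distrib_left mult_ac)
    qed
  qed simp
  from this[of M "translate 1 f"] have "L (translate 1 f) = (\<Sum>l<M. \<phi> (coeff (translate 1 f) l) * x j ^ l)"
    using M by (simp add: trans_coeff_def)
  ultimately show ?thesis
    by (simp add: trans_coeff_def \<phi>_def)
qed

text \<open>
  The evaluation points \<open>x\<close> are arbitrary, not just the variables, so that the induction on \<open>\<alpha>\<close> can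
  drop one of them.
\<close>

definition schur_like :: "nat list \<Rightarrow> 'k::field_char_0 mpoly \<Rightarrow> bool" where
  "schur_like \<alpha> f \<longleftrightarrow> (\<forall>(x :: nat \<Rightarrow> 'k mpoly) N. length \<alpha> \<le> N \<longrightarrow>
    at_vars Const N x f * alt x N (\<lambda>c. N - 1 - c) = alt x N (\<lambda>c. part \<alpha> c + (N - 1 - c)))"

lemma part_Cons: "part (r # \<alpha>) 0 = r" "part (r # \<alpha>) (Suc c) = part \<alpha> c"
  by (simp_all add: part_def)

lemma schur_like_Nil: "schur_like [] 1"
  by (simp add: schur_like_def part_def at_vars_def Const_hom.poly_eval_1)

text \<open>In the expansion along the first column, the hypothesis turns each minor into a value of
  \<open>f\<close> times a smaller Vandermonde determinant. \<open>at_vars_skip\<close> rewrites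
  that value through all points and a power of x_j, and \<open>alt_complete_symmetric\<close> then
  sums over \<open>j\<close>.\<close>

lemma schur_like_Cons:
  assumes f: "schur_like \<alpha> f"
  shows "schur_like (r # \<alpha>) (vertex_op 1 (hz 1) (int r) f)"
  unfolding schur_like_def
proof (intro allI impI)
  fix x :: "nat \<Rightarrow> 'a mpoly" and N
  assume "length (r # \<alpha>) \<le> N"
  then obtain n where N: "N = Suc n" and n: "length \<alpha> \<le> n" by (cases N) auto
  let ?ev = "at_vars Const N x"
  interpret ev: comm_ring_hom ?ev
    unfolding at_vars_def by (rule Const_hom.comm_ring_hom_poly_eval)
  obtain M where M: "\<forall>l\<ge>M. trans_coeff 1 l f = 0"
    using trans_coeff_eventually_0 by blast
  define cf where "cf j = (- 1) ^ j * alt (skip j x) n (\<lambda>c. n - 1 - c)" for j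
  have v: "vertex_op 1 (hz 1) (int r) f = (\<Sum>l<M. hs 1 (r + l) * trans_coeff 1 l f)"
    unfolding vertex_op_eq[OF M] by (simp add: hz_def nat_add_distrib)
  have "alt x N (\<lambda>c. part (r # \<alpha>) c + (N - 1 - c)) =
      (\<Sum>j<Suc n. x j ^ (r + n) * ((- 1) ^ j * alt (skip j x) n (\<lambda>c. part \<alpha> c + (n - 1 - c))))"
    unfolding N alt_laplace by (simp add: part_Cons)
  also have "\<dots> = (\<Sum>j<Suc n. x j ^ (r + n) * (at_vars Const n (skip j x) f * cf j))"
    using f n unfolding schur_like_def cf_def by (intro sum.cong refl) (simp add: mult_ac)
  also have "\<dots> = (\<Sum>j<Suc n. \<Sum>l<M. ?ev (trans_coeff 1 l f) * (x j ^ (r + l + n) * cf j))"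
    by (intro sum.cong refl, subst at_vars_skip[OF comm_ring_hom_Const _ M])
      (auto simp: N sum_distrib_left sum_distrib_right power_add mult_ac)
  also have "\<dots> = (\<Sum>l<M. ?ev (trans_coeff 1 l f) * (\<Sum>j<Suc n. x j ^ (r + l + n) * cf j))"
    by (subst sum.swap) (simp only: sum_distrib_left)
  also have "\<dots> = (\<Sum>l<M. ?ev (trans_coeff 1 l f) * (?ev (hs 1 (r + l)) * alt x N (\<lambda>c. n - c)))"
    unfolding cf_def alt_complete_symmetric[OF comm_ring_hom_Const] N ..
  also have "\<dots> = ?ev (vertex_op 1 (hz 1) (int r) f) * alt x N (\<lambda>c. N - 1 - c)"
    unfolding v ev.hom_sum ev.hom_mult sum_distrib_right by (simp add: N mult_ac)
  finally show "?ev (vertex_op 1 (hz 1) (int r) f) * alt x N (\<lambda>c. N - 1 - c) =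
      alt x N (\<lambda>c. part (r # \<alpha>) c + (N - 1 - c))" ..
qed

text \<open>A vector in the kernel would be the coefficient vector of a nonzero polynomial of degree
  below \<open>N\<close> with \<open>N\<close> distinct roots.\<close>

lemma vandermonde_neq_0:
  fixes x :: "nat \<Rightarrow> 'r::idom"
  assumes "inj_on x {..<N}"
  shows "alt x N (\<lambda>c. N - 1 - c) \<noteq> 0"
proof
  let ?A = "mat N N (\<lambda>(r, c). x r ^ (N - 1 - c))"
  assume "alt x N (\<lambda>c. N - 1 - c) = 0"
  then obtain v where v: "v \<in> carrier_vec N" "v \<noteq> 0\<^sub>v N" "?A *\<^sub>v v = 0\<^sub>v N"
    using det_0_iff_vec_prod_zero[of ?A N] by (auto simp: alt_def)
  define p where "p = (\<Sum>c<N. monom (v $ c) (N - 1 - c))"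
  have coeff_p: "coeff p (N - 1 - c) = v $ c" if "c < N" for c
  proof -
    have "coeff p (N - 1 - c) = (\<Sum>c'<N. if c' = c then v $ c' else 0)"
      unfolding p_def coeff_sum by (intro sum.cong refl) (use that in auto)
    thus ?thesis using that by simp
  qed
  have "p \<noteq> 0"
  proof
    assume "p = 0"
    hence "v = 0\<^sub>v N" using v(1) coeff_p by (intro eq_vecI) auto
    thus False using v(2) by simp
  qed
  have "poly p (x r) = 0" if "r < N" for r
  proof -
    have "poly p (x r) = (?A *\<^sub>v v) $ r"
      using that v(1) by (simp add: p_def poly_sum poly_monom scalar_prod_def atLeast0LessThan mult.commute)
    thus ?thesis unfolding v(3) using that by simp
  qed
  hence "x ` {..<N} \<subseteq> {z. poly p z = 0}" by auto
  hence "N \<le> card {z. poly p z = 0}"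
    using card_mono[OF poly_roots_finite[OF \<open>p \<noteq> 0\<close>], of "x ` {..<N}"] assms by (simp add: card_image)
  also have "\<dots> \<le> degree p" by (rule card_poly_roots_bound) fact
  finally have "N \<le> degree p" .
  moreover have "N \<noteq> 0" using \<open>p \<noteq> 0\<close> unfolding p_def by (rule contrapos_nn) simp
  moreover have "degree p \<le> N - 1"
    unfolding p_def by (intro degree_sum_le) (auto intro: order.trans[OF degree_monom_le])
  ultimately show False by linarith
qed

text \<open>The definite description is unique: the Vandermonde determinant cancels, and the
  restrictions to all large numbers of variables determine a symmetric function.\<close>

lemma schur_eqI:
  fixes f :: "'k::field_char_0 mpoly"
  assumes f: "schur_like \<mu> f"
  shows "schur \<mu> = f"
  unfolding schur_def
proof (rule the_equality)
  have f': "restrict_vars N f * alternant N (\<lambda>c. N - 1 - c) = alternant N (\<lambda>c. part \<mu> c + (N - 1 - c))"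
    if "length \<mu> \<le> N" for N
    using f that unfolding schur_like_def restrict_vars_eq_at_vars alternant_eq_alt by blast
  thus "\<forall>N\<ge>length \<mu>. restrict_vars N f * alternant N (\<lambda>c. N - 1 - c) =
      alternant N (\<lambda>c. part \<mu> c + (N - 1 - c))" by blast
  fix s :: "'k mpoly"
  assume s: "\<forall>N\<ge>length \<mu>. restrict_vars N s * alternant N (\<lambda>c. N - 1 - c) =
      alternant N (\<lambda>c. part \<mu> c + (N - 1 - c))"
  have "s - f = 0"
  proof (rule restrict_vars_eq_0_imp_eq_0)
    fix N assume N: "length \<mu> \<le> N"
    interpret r: comm_ring_hom "restrict_vars N :: 'k mpoly \<Rightarrow> 'k mpoly"
      unfolding restrict_vars_eq_at_vars at_vars_def by (rule Const_hom.comm_ring_hom_poly_eval)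
    have "inj_on (Var :: nat \<Rightarrow> 'k mpoly) {..<N}"
      by (auto simp: inj_on_def Var_def dest!: arg_cong[of _ _ Poly_Mapping.keys])
    hence "alternant N (\<lambda>c. N - 1 - c) \<noteq> (0 :: 'k mpoly)"
      unfolding alternant_eq_alt by (rule vandermonde_neq_0)
    moreover have "restrict_vars N (s - f) * alternant N (\<lambda>c. N - 1 - c) = 0"
      unfolding r.hom_minus using s f' N by (simp add: left_diff_distrib)
    ultimately show "restrict_vars N (s - f) = 0" by simp
  qed
  thus "s = f" by simp
qed

section \<open>Bernstein operators and their relations\<close>

abbreviation bernstein :: "int \<Rightarrow> 'k::field_char_0 mpoly \<Rightarrow> 'k mpoly" where
  "bernstein \<equiv> vertex_op 1 (hz 1)"

definition bern_list :: "nat list \<Rightarrow> 'k::field_char_0 mpoly" where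
  "bern_list \<alpha> = foldr (\<lambda>r. bernstein (int r)) \<alpha> 1"

lemma schur_eq_bern_list: "schur \<mu> = bern_list \<mu>"
proof (rule schur_eqI)
  show "schur_like \<mu> (bern_list \<mu>)"
    by (induction \<mu>) (auto simp: bern_list_def schur_like_Nil schur_like_Cons)
qed

lemma vertex_op_0 [simp]: "vertex_op \<epsilon> g a 0 = 0"
  using vertex_op_Const_mult[of \<epsilon> g a 0 0] by simp

lemma vertex_op_uminus: "vertex_op \<epsilon> g a (- f) = - vertex_op \<epsilon> g a f"
  using vertex_op_Const_mult[of \<epsilon> g a "- 1" f] by (simp add: Const_hom.hom_uminus)

lemma vertex_op_sum: "vertex_op \<epsilon> g a (\<Sum>i\<in>I. f i) = (\<Sum>i\<in>I. vertex_op \<epsilon> g a (f i))"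
  by (induction I rule: infinite_finite_induct) (auto simp: vertex_op_add)

lemma trans_coeff_hz_mult:
  assumes "\<epsilon> * \<epsilon> = 1"
  shows "trans_coeff \<epsilon> l (hz \<epsilon> n * f) =
    hz \<epsilon> n * trans_coeff \<epsilon> l f - hz \<epsilon> (n - 1) * (if l = 0 then 0 else trans_coeff \<epsilon> (l - 1) f)"
  using trans_coeff_hs_mult_same[OF assms, of l "nat n" f]
  by (auto simp: hz_def nat_diff_distrib)

text \<open>Moving the series with coefficients \<open>hz \<epsilon> n\<close> (variable w) to the
  left of the operator (variable z) costs the factor 1 - w/z.\<close>

lemma vertex_op_hz_mult:
  assumes "\<epsilon> * \<epsilon> = 1"
  shows "vertex_op \<epsilon> g a (hz \<epsilon> n * f) = hz \<epsilon> n * vertex_op \<epsilon> g a f - hz \<epsilon> (n - 1) * vertex_op \<epsilon> g (a + 1) f"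
proof -
  obtain M where M: "\<forall>l\<ge>M. trans_coeff \<epsilon> l f = 0"
    using trans_coeff_eventually_0 by blast
  hence "\<forall>l\<ge>Suc M. trans_coeff \<epsilon> l (hz \<epsilon> n * f) = 0"
    by (simp add: trans_coeff_hz_mult[OF assms])
  note eq = vertex_op_eq[OF this] vertex_op_eq[OF M, of g "a + 1"]
  have "vertex_op \<epsilon> g a f = (\<Sum>l<Suc M. g (a + int l) * trans_coeff \<epsilon> l f)"
    by (rule vertex_op_eq) (use M in auto)
  note eq = eq this
  show ?thesis
    unfolding eq trans_coeff_hz_mult[OF assms] right_diff_distrib sum_subtractf
    by (rule arg_cong2[of _ _ _ _ "(-)"])
      (simp_all add: sum_distrib_left algebra_simps sum.lessThan_Suc_shift del: sum.lessThan_Suc)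
qed

text \<open>The product of two generating series is 1 - w/z times their normally ordered product,
  whose coefficients \<open>G a b\<close> are symmetric because the translations commute.\<close>

lemma bernstein_swap: "bernstein a (bernstein b f) = - bernstein (b - 1) (bernstein (a + 1) f)"
proof -
  obtain M where M: "\<forall>l\<ge>M. trans_coeff 1 l f = 0"
    using trans_coeff_eventually_0 by blast
  define G where "G a b = (\<Sum>m<M. hz 1 (b + int m) * bernstein a (trans_coeff 1 m f))" for a b
  have "\<forall>l\<ge>M. trans_coeff 1 l (trans_coeff 1 m f) = 0" for m
    using M by (subst trans_coeff_commute) simp
  note M' = this
  have G: "G a b = (\<Sum>m<M. \<Sum>l<M. hz 1 (b + int m) * (hz 1 (a + int l) * trans_coeff 1 l (trans_coeff 1 m f)))" for a b
    unfolding G_def vertex_op_eq[OF M'] sum_distrib_left ..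
  have sym: "G a b = G b a" for a b
    unfolding G by (subst sum.swap) (simp add: trans_coeff_commute[of 1 _ 1] mult_ac)
  have BB: "bernstein a (bernstein b f) = G a b - G (a + 1) (b - 1)" for a b
    unfolding vertex_op_eq[OF M, of "hz 1" b] vertex_op_sum
    by (subst vertex_op_hz_mult) (simp_all add: G_def sum_subtractf algebra_simps)
  show ?thesis
    unfolding BB using sym[of b a] sym[of "b - 1" "a + 1"] by simp
qed

lemma bernstein_0_1: "bernstein 0 1 = 1"
proof -
  have "bernstein 0 1 = (\<Sum>l<1. hz 1 (0 + int l) * trans_coeff 1 l 1)"
    by (rule vertex_op_eq) (auto simp: trans_coeff_1)
  thus ?thesis by (simp add: hz_def)
qed

text \<open>Expand the operators and collect the terms by the total degree \<open>n\<close> of the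
  two opposite translations. By \<open>trans_coeff_inverse\<close> only \<open>n = 0\<close>
  survives.\<close>

lemma hs_mult_eq_bernstein:
  "hs 1 r * f = (\<Sum>k\<le>degree (translate (- 1) f). bernstein (int (r + k)) (trans_coeff (- 1) k f))"
proof -
  obtain M1 M2 where M1: "\<forall>l\<ge>M1. trans_coeff 1 l f = 0" and M2: "\<forall>l\<ge>M2. trans_coeff (- 1) l f = 0"
    using trans_coeff_eventually_0 by blast
  define M where "M = max M1 M2"
  let ?F = "\<lambda>k j. hs 1 (r + k + j) * trans_coeff 1 j (trans_coeff (- 1) k f)"
  have 1: "trans_coeff 1 j (trans_coeff (- 1) k f) = 0" if "j \<ge> M \<or> k \<ge> M" for j k
    using that M1 M2 by (auto simp: M_def) (subst trans_coeff_commute, simp)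
  hence bnd: "j < M \<and> k < M" if "trans_coeff 1 j (trans_coeff (- 1) k f) \<noteq> 0" for j k
    using that by (meson not_le)
  have 2: "bernstein (int (r + k)) (trans_coeff (- 1) k f) = (\<Sum>j<M. ?F k j)" for k
    by (subst vertex_op_eq[of M]) (auto simp: 1 hz_def nat_add_distrib intro!: sum.cong arg_cong[of _ _ "hs 1"])
  have "(\<Sum>k\<le>degree (translate (- 1) f). bernstein (int (r + k)) (trans_coeff (- 1) k f)) =
      trans_sum (- 1) (\<lambda>k. bernstein (int (r + k))) f"
    by (simp add: trans_sum_def)
  also have "\<dots> = (\<Sum>k<M. \<Sum>j<M. ?F k j)"
    unfolding 2[symmetric] by (rule trans_sum_eq) (use M2 in \<open>auto simp: M_def\<close>)
  also have "\<dots> = (\<Sum>(k, j)\<in>{..<M} \<times> {..<M}. ?F k j)"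
    by (rule sum.cartesian_product)
  \<comment> \<open>The square is enlarged by zero terms to a triangle, so that it can be summed
    along antidiagonals.\<close>
  also have "\<dots> = (\<Sum>(k, j)\<in>{(k, j). k + j < 2 * M}. ?F k j)"
  proof (rule sum.mono_neutral_left)
    show "finite {(k, j). k + j < 2 * M}"
      by (rule finite_subset[of _ "{..<2 * M} \<times> {..<2 * M}"]) auto
    show "\<forall>x\<in>{(k, j). k + j < 2 * M} - {..<M} \<times> {..<M}. (case x of (k, j) \<Rightarrow> ?F k j) = 0"
      using bnd by auto
  qed auto
  finally have "(\<Sum>k\<le>degree (translate (- 1) f). bernstein (int (r + k)) (trans_coeff (- 1) k f)) =
      (\<Sum>(k, j)\<in>{(k, j). k + j < 2 * M}. ?F k j)" .
  also have "\<dots> = (\<Sum>n<2 * M. \<Sum>k\<le>n. ?F k (n - k))"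
    by (rule sum.triangle_reindex)
  also have "\<dots> = (\<Sum>n<2 * M. hs 1 (r + n) * (\<Sum>k\<le>n. trans_coeff 1 (n - k) (trans_coeff (- 1) k f)))"
    by (intro sum.cong refl) (simp add: sum_distrib_left)
  also have "\<dots> = (\<Sum>n<2 * M. if n = 0 then hs 1 r * f else 0)"
    unfolding trans_coeff_inverse by (intro sum.cong refl) auto
  also have "\<dots> = hs 1 r * f"
  \<comment> \<open>For \<open>M = 0\<close> the range is empty, so the term \<open>n = 0\<close> is
    missing; but then \<open>f\<close> itself is 0.\<close>
  proof (cases "M = 0")
    case True
    hence "f = 0" using 1[of 0 0] by simp
    thus ?thesis by simp
  qed simp
  finally show ?thesis ..
qed

subsection \<open>The integral form of the ring of symmetric functions\<close>

lemma comm_ring_hom_int_poly_eval: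
  "comm_ring_hom (\<lambda>p :: int poly. poly (map_poly of_int p) (q :: 'k::comm_ring_1))"
  by (rule comm_ring_hom_poly_map_poly) (standard, auto)

lemma laurent_ringI: "poly (map_poly of_int p) q * inverse q ^ n \<in> laurent_ring q"
  unfolding laurent_ring_def by blast

lemma laurent_ring_int: "of_int c \<in> laurent_ring q"
  using laurent_ringI[of "[:c:]" q 0] by (simp add: map_poly_pCons)

lemma laurent_ring_q: "q \<in> laurent_ring q"
  using laurent_ringI[of "[:0, 1:]" q 0] by (simp add: map_poly_pCons)

lemma laurent_ring_inverse_q: "inverse q \<in> laurent_ring q"
  using laurent_ringI[of "[:1:]" q 1] by (simp add: map_poly_pCons)

lemma laurent_ring_mult:
  assumes "a \<in> laurent_ring q" "b \<in> laurent_ring q"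
  shows "a * b \<in> laurent_ring q"
proof -
  interpret ev: comm_ring_hom "\<lambda>p :: int poly. poly (map_poly of_int p) q"
    by (rule comm_ring_hom_int_poly_eval)
  obtain p m r n where "a = poly (map_poly of_int p) q * inverse q ^ m"
    "b = poly (map_poly of_int r) q * inverse q ^ n"
    using assms unfolding laurent_ring_def by blast
  hence "a * b = poly (map_poly of_int (p * r)) q * inverse q ^ (m + n)"
    by (simp add: ev.hom_mult power_add mult_ac del: power_inverse)
  thus ?thesis by (simp only: laurent_ringI)
qed

lemma laurent_ring_add:
  assumes "q \<noteq> 0" "a \<in> laurent_ring q" "b \<in> laurent_ring q"
  shows "a + b \<in> laurent_ring q"
proof -
  interpret ev: comm_ring_hom "\<lambda>p :: int poly. poly (map_poly of_int p) q"
    by (rule comm_ring_hom_int_poly_eval)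
  obtain p m r n where *: "a = poly (map_poly of_int p) q * inverse q ^ m"
    "b = poly (map_poly of_int r) q * inverse q ^ n"
    using assms unfolding laurent_ring_def by blast
  have "poly (map_poly of_int [:0, 1:]) q = q"
    by (simp add: map_poly_pCons)
  hence "poly (map_poly of_int (p * [:0, 1:] ^ n + r * [:0, 1:] ^ m)) q * inverse q ^ (m + n) =
      (poly (map_poly of_int p) q * q ^ n + poly (map_poly of_int r) q * q ^ m) * (inverse q ^ m * inverse q ^ n)"
    by (simp only: ev.hom_mult ev.hom_add ev.hom_power power_add)
  also have "\<dots> = a + b"
    using \<open>q \<noteq> 0\<close> by (simp add: * field_simps)
  finally show ?thesis by (metis laurent_ringI)
qed

lemma laurent_ring_0: "0 \<in> laurent_ring q" and laurent_ring_1: "1 \<in> laurent_ring q"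
  using laurent_ring_int[of 0 q] laurent_ring_int[of 1 q] by simp_all

lemma laurent_ring_uminus: "a \<in> laurent_ring q \<Longrightarrow> - a \<in> laurent_ring q"
  using laurent_ring_mult[OF laurent_ring_int[of "- 1" q], of a] by simp

lemma laurent_ring_power: "a \<in> laurent_ring q \<Longrightarrow> a ^ n \<in> laurent_ring q"
  by (induction n) (auto intro: laurent_ring_1 laurent_ring_mult)

inductive_set int_sym :: "'k::field_char_0 \<Rightarrow> 'k mpoly set" for q where
  Const: "c \<in> laurent_ring q \<Longrightarrow> Const c \<in> int_sym q"
| hs: "hs 1 n \<in> int_sym q"
| add: "f \<in> int_sym q \<Longrightarrow> g \<in> int_sym q \<Longrightarrow> f + g \<in> int_sym q"
| mult: "f \<in> int_sym q \<Longrightarrow> g \<in> int_sym q \<Longrightarrow> f * g \<in> int_sym q"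

lemma int_sym_0 [simp]: "0 \<in> int_sym q" and int_sym_1 [simp]: "1 \<in> int_sym q"
  using int_sym.Const[OF laurent_ring_0] int_sym.Const[OF laurent_ring_1] by simp_all

lemma int_sym_uminus: "f \<in> int_sym q \<Longrightarrow> - f \<in> int_sym q"
  using int_sym.mult[OF int_sym.Const[OF laurent_ring_uminus[OF laurent_ring_1]], of f q]
  by (simp add: Const_hom.hom_uminus)

lemma int_sym_diff: "f \<in> int_sym q \<Longrightarrow> g \<in> int_sym q \<Longrightarrow> f - g \<in> int_sym q"
  using int_sym.add[of f q "- g"] int_sym_uminus by auto

lemma int_sym_sum: "(\<And>i. i \<in> I \<Longrightarrow> f i \<in> int_sym q) \<Longrightarrow> (\<Sum>i\<in>I. f i) \<in> int_sym q"
  by (induction I rule: infinite_finite_induct) (auto intro: int_sym.add)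

text \<open>The product of the two generating series is 1, which solves recursively for
  \<open>hs (- 1) n\<close> with integer coefficients.\<close>

lemma hs_uminus_in_int_sym: "hs (- 1) n \<in> int_sym q"
proof (induction n rule: less_induct)
  case (less n)
  show ?case
  proof (cases "n = 0")
    case False
    have "fps_nth (Abs_fps (hs 1) * Abs_fps (hs (- 1))) n = fps_nth (1 :: 'a mpoly fps) n"
      by (simp only: hs_mult_hs_uminus)
    hence "(\<Sum>i\<le>n. hs 1 i * hs (- 1) (n - i)) = (0 :: 'a mpoly)"
      using False by (simp add: fps_mult_nth atLeast0AtMost)
    hence "hs (- 1) n = - (\<Sum>i<n. hs 1 (Suc i) * hs (- 1) (n - Suc i) :: 'a mpoly)"
      using False
      by (cases n) (simp_all add: sum.atMost_Suc_shift lessThan_Suc_atMost eq_neg_iff_add_eq_0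
          del: sum.atMost_Suc hs.simps(2))
    also have "\<dots> \<in> int_sym q"
      using less by (intro int_sym_uminus int_sym_sum int_sym.mult int_sym.hs) auto
    finally show ?thesis .
  qed simp
qed

lemma hz_in_int_sym:
  assumes "\<epsilon> = 1 \<or> \<epsilon> = - 1"
  shows "hz \<epsilon> n \<in> int_sym q"
  using assms by (auto simp: hz_def int_sym.hs hs_uminus_in_int_sym)

text \<open>Translation is a homomorphism, so generators suffice, and the translate of h_n has
  complete symmetric functions, up to sign, as coefficients.\<close>

lemma trans_coeff_in_int_sym:
  fixes f :: "'k::field_char_0 mpoly"
  assumes "\<epsilon> = 1 \<or> \<epsilon> = - 1" "f \<in> int_sym q"
  shows "trans_coeff \<epsilon> l f \<in> int_sym q"
  using assms(2)
proof (induction arbitrary: l rule: int_sym.induct)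
  case (Const c)
  thus ?case by (auto simp: trans_coeff_Const intro: int_sym.Const)
next
  case (hs n)
  from assms(1) show ?case
  proof
    assume "\<epsilon> = 1"
    thus ?thesis
      using trans_coeff_hs_mult_same[of "1 :: 'k" l n 1]
      by (auto simp: trans_coeff_1 intro!: int_sym.hs int_sym_diff int_sym_uminus)
  next
    assume "\<epsilon> = - 1"
    thus ?thesis
      using trans_coeff_hs_opposite[of "1 :: 'k" l n] by (auto intro: int_sym.hs)
  qed
next
  case (add f g)
  thus ?case by (simp add: trans_coeff_add int_sym.add)
next
  case (mult f g)
  thus ?case by (simp add: trans_coeff_mult int_sym_sum int_sym.mult)
qed

lemma vertex_op_in_int_sym:
  assumes "\<epsilon> = 1 \<or> \<epsilon> = - 1" "\<And>n. g n \<in> int_sym q" "f \<in> int_sym q"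
  shows "vertex_op \<epsilon> g a f \<in> int_sym q"
  unfolding vertex_op_def trans_sum_def
  by (intro int_sym_sum int_sym.mult trans_coeff_in_int_sym assms)

lemma schur_in_int_sym: "schur \<mu> \<in> int_sym q"
  unfolding schur_eq_bern_list bern_list_def
  by (induction \<mu>) (auto intro: vertex_op_in_int_sym hz_in_int_sym)

section \<open>Integral expansion into Schur functions\<close>

inductive_set laurent_span :: "'k::field_char_0 \<Rightarrow> 'k mpoly set \<Rightarrow> 'k mpoly set" for q S where
  zero: "0 \<in> laurent_span q S"
| step: "c \<in> laurent_ring q \<Longrightarrow> s \<in> S \<Longrightarrow> f \<in> laurent_span q S \<Longrightarrow> Const c * s + f \<in> laurent_span q S"

lemma laurent_span_base: "s \<in> S \<Longrightarrow> s \<in> laurent_span q S"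
  using laurent_span.step[OF laurent_ring_1 _ laurent_span.zero, of s S q] by simp

lemma laurent_span_add:
  "f \<in> laurent_span q S \<Longrightarrow> g \<in> laurent_span q S \<Longrightarrow> f + g \<in> laurent_span q S"
  by (induction rule: laurent_span.induct) (auto simp: add.assoc intro: laurent_span.step)

lemma laurent_span_scale:
  assumes "c \<in> laurent_ring q" "f \<in> laurent_span q S"
  shows "Const c * f \<in> laurent_span q S"
  using assms(2)
  by (induction rule: laurent_span.induct)
    (auto simp: distrib_left mult.assoc[symmetric] Const_mult[symmetric]
      intro: laurent_span.zero laurent_span.step laurent_ring_mult assms(1))

lemma laurent_span_sum: "(\<And>i. i \<in> I \<Longrightarrow> f i \<in> laurent_span q S) \<Longrightarrow> (\<Sum>i\<in>I. f i) \<in> laurent_span q S"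
  by (induction I rule: infinite_finite_induct) (auto intro: laurent_span.zero laurent_span_add)

lemma laurent_span_linear:
  assumes add: "\<And>f g. L (f + g) = L f + L g" and scale: "\<And>c f. L (Const c * f) = Const c * L f"
    and S: "\<And>s. s \<in> S \<Longrightarrow> L s \<in> laurent_span q S'" and f: "f \<in> laurent_span q S"
  shows "L f \<in> laurent_span q S'"
  using f
proof (induction rule: laurent_span.induct)
  case zero
  show ?case using scale[of 0 0] laurent_span.zero by simp
qed (auto simp: add scale intro: laurent_span_add laurent_span_scale S)

lemma laurent_span_mono_span:
  "f \<in> laurent_span q S \<Longrightarrow> S \<subseteq> laurent_span q S' \<Longrightarrow> f \<in> laurent_span q S'"
  by (rule laurent_span_linear[of "\<lambda>f. f" S]) auto

text \<open>Monomials are sorted by the number of factors, with h_0 = 1 allowed as a factor.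
  \<open>trans_coeff (- 1)\<close> preserves this number, since it sends one h_r to another or to 0;
  the induction over it can therefore proceed.\<close>

definition h_monomials :: "nat \<Rightarrow> 'k::field_char_0 mpoly set" where
  "h_monomials n = {prod_list (map (hs 1) ns) | ns. length ns = n}"

lemma h_monomials_0: "h_monomials 0 = {1}"
  by (auto simp: h_monomials_def)

lemma h_monomials_Suc: "h_monomials (Suc n) = {hs 1 r * f | r f. f \<in> h_monomials n}"
proof (intro Set.set_eqI iffI)
  fix f :: "'a mpoly" assume "f \<in> h_monomials (Suc n)"
  then obtain r ns where "f = hs 1 r * prod_list (map (hs 1) ns)" "length ns = n"
    by (auto simp: h_monomials_def length_Suc_conv)
  thus "f \<in> {hs 1 r * f | r f. f \<in> h_monomials n}"
    unfolding h_monomials_def by blast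
next
  fix f :: "'a mpoly" assume "f \<in> {hs 1 r * f | r f. f \<in> h_monomials n}"
  then obtain r ns where "f = prod_list (map (hs 1) (r # ns))" "length ns = n"
    by (auto simp: h_monomials_def)
  thus "f \<in> h_monomials (Suc n)"
    unfolding h_monomials_def by (intro CollectI exI[of _ "r # ns"]) simp
qed

lemma trans_coeff_h_monomial:
  "f \<in> h_monomials n \<Longrightarrow> trans_coeff (- 1) k f \<in> laurent_span q (h_monomials n)"
proof (induction n arbitrary: f k)
  case 0
  thus ?case
    by (auto simp: h_monomials_0 trans_coeff_1 intro: laurent_span_base laurent_span.zero)
next
  case (Suc n)
  then obtain r g where f: "f = hs 1 r * g" "g \<in> h_monomials n"
    by (auto simp: h_monomials_Suc)
  have "hs 1 m * x \<in> laurent_span q (h_monomials (Suc n))" if "x \<in> laurent_span q (h_monomials n)" for m x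
    using that
    by (rule laurent_span_linear[rotated -1])
      (auto simp: algebra_simps h_monomials_Suc intro!: laurent_span_base)
  thus ?case
    unfolding f(1) trans_coeff_mult
    using Suc.IH[OF f(2)] trans_coeff_hs_opposite[of "1 :: 'a"]
    by (intro laurent_span_sum) (auto intro: laurent_span.zero)
qed

lemma bernstein_bern_list: "bernstein (int r) (bern_list \<alpha>) = bern_list (r # \<alpha>)"
  by (simp add: bern_list_def)

text \<open>Split off one factor by \<open>hs_mult_eq_bernstein\<close>. The translation
  coefficients of the rest have one factor fewer than the monomial, hence are combinations of words,
  and a Bernstein operator prepends a letter.\<close>

lemma h_monomial_in_span_bern_list:
  "f \<in> h_monomials n \<Longrightarrow> f \<in> laurent_span q (range bern_list)"
proof (induction n arbitrary: f)
  case 0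
  hence "f = bern_list []" by (simp add: h_monomials_0 bern_list_def)
  thus ?case by (auto intro: laurent_span_base)
next
  case (Suc n)
  then obtain r g where f: "f = hs 1 r * g" "g \<in> h_monomials n"
    by (auto simp: h_monomials_Suc)
  show ?case
    unfolding f(1) hs_mult_eq_bernstein
  proof (rule laurent_span_sum)
    fix k
    have "trans_coeff (- 1) k g \<in> laurent_span q (range bern_list)"
      by (rule laurent_span_mono_span[OF trans_coeff_h_monomial[OF f(2)]]) (use Suc.IH in auto)
    thus "bernstein (int (r + k)) (trans_coeff (- 1) k g) \<in> laurent_span q (range bern_list)"
      by (rule laurent_span_linear[rotated -1])
        (auto simp: vertex_op_add vertex_op_Const_mult bernstein_bern_list
          simp del: of_nat_add intro!: laurent_span_base)
  qed
qed

text \<open>The monomials in the h_r span a ring containing all generators of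
  \<open>int_sym\<close>; each monomial expands into words.\<close>

lemma int_sym_subset_span_bern_list:
  fixes f :: "'k::field_char_0 mpoly"
  assumes "q \<noteq> 0" "f \<in> int_sym q"
  shows "f \<in> laurent_span q (range bern_list)"
proof (rule laurent_span_mono_span)
  let ?H = "\<Union>n. h_monomials n :: 'k mpoly set"
  show "f \<in> laurent_span q ?H"
    using assms(2)
  proof (induction rule: int_sym.induct)
    case (Const c)
    show ?case
      using laurent_span_scale[OF Const laurent_span_base, of 1 ?H] h_monomials_0 by fastforce
  next
    case (hs n)
    have "hs 1 n \<in> h_monomials 1"
      unfolding h_monomials_def by (auto intro!: exI[of _ "[n]"])
    thus ?case by (blast intro: laurent_span_base)
  next
    case (mult f g)
    have prods: "f * s \<in> laurent_span q ?H" if "s \<in> ?H" for s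
      using mult.IH(1)
    proof (rule laurent_span_linear[rotated -1])
      fix t assume "t \<in> ?H"
      then obtain ns ms where "t = prod_list (map (hs 1) ns)" "s = prod_list (map (hs 1) ms)"
        using \<open>s \<in> ?H\<close> by (auto simp: h_monomials_def)
      hence "t * s = prod_list (map (hs 1) (ns @ ms))" by simp
      hence "t * s \<in> ?H" unfolding h_monomials_def by blast
      thus "t * s \<in> laurent_span q ?H" by (rule laurent_span_base)
    qed (auto simp: algebra_simps)
    from mult.IH(2) show ?case
      by (rule laurent_span_linear[rotated -1]) (auto simp: distrib_left mult.left_commute intro: prods)
  qed (auto intro: laurent_span_add)
  show "?H \<subseteq> laurent_span q (range bern_list)"
    using h_monomial_in_span_bern_list by blast
qed

text \<open>
  This decreases when a letter pair \<open>r < s - 1\<close> is straightened to \<open>s - 1, r + 1\<close>.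
\<close>

fun weight :: "nat list \<Rightarrow> nat" where
  "weight [] = 0"
| "weight (a # as) = weight as + sum_list as"

lemma weight_append: "weight (xs @ ys) = weight xs + weight ys + length xs * sum_list ys"
  by (induction xs) auto

lemma bern_list_append: "bern_list (xs @ ys) = foldr (\<lambda>r. bernstein (int r)) xs (bern_list ys)"
  by (simp add: bern_list_def)

text \<open>The relation \<open>bernstein_swap\<close> inside a word; \<open>s \<ge> 1\<close> keeps
  the new letter a natural number.\<close>

lemma bern_list_swap:
  assumes "s \<ge> 1"
  shows "bern_list (xs @ r # s # ys) = - bern_list (xs @ (s - 1) # (r + 1) # ys)"
proof -
  have swap: "bern_list (r # s # ys) = - bern_list ((s - 1) # (r + 1) # ys)"
    using assms bernstein_swap[of "int r" "int s" "bern_list ys"]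
    by (simp add: bern_list_def of_nat_diff add.commute[of 1])
  have neg: "foldr (\<lambda>r. bernstein (int r)) xs (- f) = - foldr (\<lambda>r. bernstein (int r)) xs f" for f :: "'a mpoly"
    by (induction xs) (auto simp: vertex_op_uminus)
  show ?thesis unfolding bern_list_append swap neg ..
qed

lemma bern_list_trailing_zeros:
  "bern_list (xs @ replicate n 0) = (bern_list xs :: 'k::field_char_0 mpoly)"
proof -
  have "bern_list (replicate n 0) = (1 :: 'k mpoly)"
    by (induction n) (simp_all add: bern_list_def bernstein_0_1)
  thus ?thesis unfolding bern_list_append by (simp add: bern_list_def)
qed

lemma decreasing_eq_partition_append_zeros:
  "sorted_wrt (\<ge>) \<alpha> \<Longrightarrow> \<exists>\<mu> n. is_partition \<mu> \<and> \<alpha> = \<mu> @ replicate n (0::nat)"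
proof (induction \<alpha>)
  case Nil
  show ?case by (intro exI[of _ "[]"] exI[of _ 0]) (simp add: is_partition_def)
next
  case (Cons a \<alpha>)
  hence "sorted_wrt (\<ge>) \<alpha>" by simp
  from Cons.IH[OF this] obtain \<mu> n where \<mu>: "is_partition \<mu>" "\<alpha> = \<mu> @ replicate n 0"
    by blast
  have a: "\<forall>x\<in>set \<alpha>. x \<le> a" using Cons.prems by simp
  show ?case
  proof (cases "a = 0")
    case True
    have "\<mu> = []"
    proof (cases \<mu>)
      case (Cons b \<mu>')
      hence b: "b \<in> set \<mu>" by simp
      hence "b \<in> set \<alpha>" unfolding \<mu>(2) by simp
      with a True have "b = 0" by blast
      thus ?thesis using \<mu>(1) b unfolding is_partition_def by blast
    qed
    hence "a # \<alpha> = [] @ replicate (Suc n) 0" unfolding \<mu>(2) True by simp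
    thus ?thesis using \<mu>(1) \<open>\<mu> = []\<close> by blast
  next
    case False
    hence "is_partition (a # \<mu>)"
      using a \<mu>(1) unfolding \<mu>(2) is_partition_def by simp
    moreover have "a # \<alpha> = (a # \<mu>) @ replicate n 0" unfolding \<mu>(2) by simp
    ultimately show ?thesis by blast
  qed
qed

text \<open>Straightening: a decreasing word is a partition followed by zeros, which act trivially
  on 1. At an ascent r < s the swap either reproduces the word with a sign, which forces 0, or
  lowers the weight.\<close>

lemma bern_list_in_span_schur:
  fixes q :: "'k::field_char_0"
  shows "bern_list \<alpha> \<in> laurent_span q (schur ` {\<mu>. is_partition \<mu>})"
proof (induction "weight \<alpha>" arbitrary: \<alpha> rule: less_induct)
  case less
  show ?case
  proof (cases "sorted_wrt (\<ge>) \<alpha>")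
    case True
    then obtain \<mu> n where "is_partition \<mu>" "\<alpha> = \<mu> @ replicate n 0"
      using decreasing_eq_partition_append_zeros by blast
    hence "bern_list \<alpha> = (schur \<mu> :: 'k mpoly)"
      by (simp only: bern_list_trailing_zeros schur_eq_bern_list)
    thus ?thesis using \<open>is_partition \<mu>\<close> by (auto intro: laurent_span_base)
  next
    case False
    then obtain i where i: "Suc i < length \<alpha>" "\<alpha> ! i < \<alpha> ! Suc i"
      using sorted_wrt_iff_nth_Suc_transp[of "(\<ge>)" \<alpha>] by (auto simp: not_le)
    define xs r s ys where "xs = take i \<alpha>" and "r = \<alpha> ! i" and "s = \<alpha> ! Suc i" and "ys = drop (Suc (Suc i)) \<alpha>"
    have \<alpha>: "\<alpha> = xs @ r # s # ys"
      using i unfolding xs_def r_def s_def ys_def by (simp add: Cons_nth_drop_Suc)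
    have "r < s" using i by (simp add: r_def s_def)
    show ?thesis
    proof (cases "s = Suc r")
      case True
      hence "bern_list \<alpha> = (- bern_list \<alpha> :: 'k mpoly)"
        using bern_list_swap[of s xs r ys] \<open>r < s\<close> unfolding \<alpha> by simp
      hence "2 * bern_list \<alpha> = (0 :: 'k mpoly)" by (metis add.right_inverse mult_2)
      hence "bern_list \<alpha> = (0 :: 'k mpoly)" by simp
      thus ?thesis by (simp add: laurent_span.zero)
    next
      case False
      let ?\<beta> = "xs @ (s - 1) # (r + 1) # ys"
      \<comment> \<open>The weight is the sum of each letter times its position counted from 0, and
        the swap lowers it by s - r - 1.\<close>
      have "weight ?\<beta> < weight \<alpha>"
        using False \<open>r < s\<close> unfolding \<alpha> weight_append by (simp add: algebra_simps)
      hence "bern_list ?\<beta> \<in> laurent_span q (schur ` {\<mu>. is_partition \<mu>})"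
        by (rule less)
      hence "Const (- 1) * bern_list ?\<beta> \<in> laurent_span q (schur ` {\<mu>. is_partition \<mu>})"
        by (rule laurent_span_scale[OF laurent_ring_uminus[OF laurent_ring_1]])
      thus ?thesis
        using bern_list_swap[of s xs r ys, where 'a = 'k] \<open>r < s\<close> unfolding \<alpha>
        by (simp add: Const_hom.hom_uminus)
    qed
  qed
qed

theorem int_sym_subset_span_schur:
  assumes "q \<noteq> 0" "f \<in> int_sym q"
  shows "f \<in> laurent_span q (schur ` {\<mu>. is_partition \<mu>})"
  using int_sym_subset_span_bern_list[OF assms]
  by (rule laurent_span_mono_span) (use bern_list_in_span_schur in blast)

subsection \<open>Divided powers of vertex operators\<close>

text \<open>
  The coefficient of \<open>z\<^sup>n\<close> in \<open>H(z) H(yz)\<close>; it vanishes for \<open>n < 0\<close>.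
\<close>

definition hh :: "'k::field_char_0 \<Rightarrow> 'k \<Rightarrow> int \<Rightarrow> 'k mpoly" where
  "hh \<epsilon> y n = (\<Sum>j\<le>nat n. Const (y ^ j) * hz \<epsilon> (int j) * hz \<epsilon> (n - int j))"

lemma hh_eq:
  assumes "nat n \<le> N"
  shows "hh \<epsilon> y n = (\<Sum>j\<le>N. Const (y ^ j) * hz \<epsilon> (int j) * hz \<epsilon> (n - int j))"
  unfolding hh_def by (rule sum.mono_neutral_left) (use assms in \<open>auto simp: hz_def\<close>)

lemma hh_shift:
  assumes "nat n \<le> N"
  shows "(\<Sum>j\<le>Suc N. Const (y ^ j) * hz \<epsilon> (int j - 1) * hz \<epsilon> (n + 1 - int j)) = Const y * hh \<epsilon> y n"
proof -
  have "hz \<epsilon> (- 1) = 0" by (simp add: hz_def)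
  thus ?thesis
    unfolding hh_eq[OF assms] sum.atMost_Suc_shift
    by (simp add: sum_distrib_left Const_mult mult_ac)
qed

lemma hh_in_int_sym:
  assumes "\<epsilon> = 1 \<or> \<epsilon> = - 1" "y \<in> laurent_ring q"
  shows "hh \<epsilon> y n \<in> int_sym q"
  unfolding hh_def
  by (intro int_sym_sum int_sym.mult int_sym.Const laurent_ring_power hz_in_int_sym assms)

text \<open>Moving both H(w) and H(yw) to the left costs (1 - w/z)(1 - y w/z) = 1 - (1 + y) w/z + y
  w^2/z^2.\<close>

lemma vertex_op_hh_mult:
  assumes "\<epsilon> * \<epsilon> = 1"
  shows "vertex_op \<epsilon> \<phi> c (hh \<epsilon> y n * x) =
    hh \<epsilon> y n * vertex_op \<epsilon> \<phi> c x - Const (1 + y) * (hh \<epsilon> y (n - 1) * vertex_op \<epsilon> \<phi> (c + 1) x)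
    + Const y * (hh \<epsilon> y (n - 2) * vertex_op \<epsilon> \<phi> (c + 2) x)"
proof -
  define N where "N = nat n"
  let ?V = "\<lambda>d. vertex_op \<epsilon> \<phi> (c + d) x"
  let ?h = "hz \<epsilon>"
  \<comment> \<open>The range up to \<open>Suc N\<close> is large enough for the coefficients of
    index n, n - 1 and n - 2, also after shifting \<open>j\<close> by one.\<close>
  have "vertex_op \<epsilon> \<phi> c (hh \<epsilon> y n * x) =
      (\<Sum>j\<le>Suc N. vertex_op \<epsilon> \<phi> c (Const (y ^ j) * (?h (int j) * (?h (n - int j) * x))))"
    by (subst hh_eq[of n "Suc N"]) (simp_all add: N_def sum_distrib_right vertex_op_sum mult.assoc
        del: sum.atMost_Suc)
  also have "\<dots> = (\<Sum>j\<le>Suc N. Const (y ^ j) * ?h (int j) * ?h (n - int j) * ?V 0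
      - Const (y ^ j) * ?h (int j) * ?h (n - 1 - int j) * ?V 1
      - Const (y ^ j) * ?h (int j - 1) * ?h ((n - 1) + 1 - int j) * ?V 1
      + Const (y ^ j) * ?h (int j - 1) * ?h ((n - 2) + 1 - int j) * ?V 2)"
    unfolding vertex_op_Const_mult vertex_op_hz_mult[OF assms]
    by (intro sum.cong refl) (simp add: algebra_simps)
  also have "\<dots> = hh \<epsilon> y n * ?V 0 - hh \<epsilon> y (n - 1) * ?V 1 - Const y * hh \<epsilon> y (n - 1) * ?V 1
      + Const y * hh \<epsilon> y (n - 2) * ?V 2"
    unfolding sum.distrib sum_subtractf sum_distrib_right[symmetric]
    by (subst (1 2) hh_eq[of _ "Suc N", symmetric], simp add: N_def, simp add: N_def,
        subst (1 2) hh_shift, auto simp: N_def)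
  finally show ?thesis by (simp add: Const_add algebra_simps)
qed

text \<open>
  \<open>esum z \<Phi> c as\<close> is the sum of \<open>z\<^bsup>|K|\<^esup> \<Phi> (c + |K|) (as - 1\<^sub>K)\<close> over all sets \<open>K\<close> of positions of \<open>as\<close>:
  on the coefficients of a series, this is multiplication by \<open>\<Prod>\<^sub>j (1 + z w\<^sub>j / w)\<close>, where \<open>w\<close>
  belongs to \<open>c\<close> and \<open>w\<^sub>j\<close> to the \<open>j\<close>-th entry of \<open>as\<close>.
\<close>

primrec esum :: "'k::comm_ring_1 \<Rightarrow> (int \<Rightarrow> int list \<Rightarrow> 'k mpoly) \<Rightarrow> int \<Rightarrow> int list \<Rightarrow> 'k mpoly" where
  "esum z \<Phi> c [] = \<Phi> c []"
| "esum z \<Phi> c (a # as) = esum z (\<lambda>c as. \<Phi> c (a # as)) c as +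
    Const z * esum z (\<lambda>c as. \<Phi> c ((a - 1) # as)) (c + 1) as"

declare esum.simps(2) [simp del]
lemmas esum_Cons = esum.simps(2)

lemma esum_cong:
  assumes "\<And>c as'. length as' = length as \<Longrightarrow> \<Phi> c as' = \<Phi>' c as'"
  shows "esum z \<Phi> c as = esum z \<Phi>' c as"
  using assms
proof (induction as arbitrary: \<Phi> \<Phi>' c)
  case (Cons a as)
  show ?case unfolding esum_Cons
    by (intro arg_cong2[of _ _ _ _ "(+)"] arg_cong2[of _ _ _ _ "(*)"] refl Cons.IH) (auto intro: Cons.prems)
qed simp

lemma esum_linear:
  assumes "\<And>f g. L (f + g) = L f + L g" and "\<And>c f. L (Const c * f) = Const c * L f"
  shows "L (esum z \<Phi> c as) = esum z (\<lambda>c as. L (\<Phi> c as)) c as"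
  by (induction as arbitrary: \<Phi> c) (simp_all add: esum_Cons assms)

lemma esum_add: "esum z (\<lambda>c as. \<Phi> c as + \<Phi>' c as) c as = esum z \<Phi> c as + esum z \<Phi>' c as"
  by (induction as arbitrary: \<Phi> \<Phi>' c) (simp_all add: esum_Cons algebra_simps)

lemma esum_mult_left: "esum z (\<lambda>c as. x * \<Phi> c as) c as = x * esum z \<Phi> c as"
  by (rule esum_linear[symmetric, of "(*) x"]) (simp_all add: algebra_simps)

lemma esum_uminus: "esum z (\<lambda>c as. - \<Phi> c as) c as = - esum z \<Phi> c as"
  by (rule esum_linear[symmetric, of uminus]) simp_all

lemma esum_diff: "esum z (\<lambda>c as. \<Phi> c as - \<Phi>' c as) c as = esum z \<Phi> c as - esum z \<Phi>' c as"
  unfolding diff_conv_add_uminus esum_add esum_uminus ..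

lemma esum_zero: "esum z (\<lambda>c as. 0) c as = 0"
  by (induction as arbitrary: c) (simp_all add: esum_Cons)

lemma esum_sum: "esum z (\<lambda>c as. \<Sum>i\<in>I. \<Phi> i c as) c as = (\<Sum>i\<in>I. esum z (\<Phi> i) c as)"
  by (induction I rule: infinite_finite_induct) (simp_all add: esum_add esum_zero)

lemma esum_shift: "esum z (\<lambda>c. \<Phi> (c + d)) c as = esum z \<Phi> (c + d) as"
proof (induction as arbitrary: \<Phi> c)
  case (Cons a as)
  show ?case
    using Cons.IH[of "\<lambda>c as. \<Phi> c (a # as)" c] Cons.IH[of "\<lambda>c as. \<Phi> c ((a - 1) # as)" "c + 1"]
    by (simp add: esum_Cons add_ac)
qed simp

text \<open>Both sides multiply the same series by the same two products of linear factors.\<close>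

lemma esum_commute:
  "esum z (\<lambda>c as. esum w (\<lambda>k as. R c k as) b as) c bs = esum w (\<lambda>k as. esum z (\<lambda>c as. R c k as) c as) b bs"
proof (induction bs arbitrary: R c b)
  case (Cons a bs)
  show ?case
    by (simp add: esum_Cons esum_add esum_mult_left Cons.IH algebra_simps)
qed simp

lemma esum_in_int_sym:
  assumes "z \<in> laurent_ring q" "\<And>c as. \<Phi> c as \<in> int_sym q"
  shows "esum z \<Phi> c as \<in> int_sym q"
  using assms(2)
  by (induction as arbitrary: \<Phi> c) (auto simp: esum_Cons intro!: int_sym.add int_sym.mult int_sym.Const assms(1))

text \<open>
  The antisymmetry of the coefficients of \<open>\<Prod>\<^bsub>i<j\<^esub> (1 - z\<^sub>j / z\<^sub>i)\<close> times a symmetric series.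
\<close>

definition alternating :: "nat \<Rightarrow> (int list \<Rightarrow> 'b::uminus) \<Rightarrow> bool" where
  "alternating n \<Phi> \<longleftrightarrow> (\<forall>us u v vs. length us + length vs + 2 = n \<longrightarrow>
    \<Phi> (us @ u # v # vs) = - \<Phi> (us @ (v - 1) # (u + 1) # vs))"

lemma alternatingD:
  "alternating n \<Phi> \<Longrightarrow> length us + length vs + 2 = n \<Longrightarrow>
    \<Phi> (us @ u # v # vs) = - \<Phi> (us @ (v - 1) # (u + 1) # vs)"
  unfolding alternating_def by blast

lemma alternating_eq_0:
  fixes \<Phi> :: "int list \<Rightarrow> 'r::{idom, ring_char_0}"
  assumes "alternating n \<Phi>" "length us + length vs + 2 = n"
  shows "\<Phi> (us @ u # (u + 1) # vs) = 0"
proof -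
  have "\<Phi> (us @ u # (u + 1) # vs) = - \<Phi> (us @ u # (u + 1) # vs)"
    using alternatingD[OF assms, of u "u + 1"] by simp
  thus ?thesis by simp
qed

lemma alternating_Cons: "alternating (Suc n) \<Phi> \<Longrightarrow> alternating n (\<lambda>as. \<Phi> (a # as))"
  unfolding alternating_def using append_Cons by (metis add_Suc length_Cons)

text \<open>The product by which \<open>esum\<close> multiplies is symmetric in the variables of the
  list, so antisymmetry survives.\<close>

lemma alternating_esum:
  assumes "\<And>c. alternating n (\<Phi> c)"
  shows "alternating n (esum z \<Phi> c)"
  unfolding alternating_def
proof (intro allI impI)
  fix us vs :: "int list" and u v :: int
  assume "length us + length vs + 2 = n"
  thus "esum z \<Phi> c (us @ u # v # vs) = - esum z \<Phi> c (us @ (v - 1) # (u + 1) # vs)"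
    using assms
  proof (induction us arbitrary: n \<Phi> c)
    case Nil
    have sw: "esum z (\<lambda>c as. \<Phi> c (x # y # as)) c vs = - esum z (\<lambda>c as. \<Phi> c ((y - 1) # (x + 1) # as)) c vs" for x y c
      unfolding esum_uminus[symmetric]
    proof (rule esum_cong)
      fix c and as' :: "int list" assume "length as' = length vs"
      thus "\<Phi> c (x # y # as') = - \<Phi> c ((y - 1) # (x + 1) # as')"
        using alternatingD[OF Nil(2)[of c], of "[]" as' x y] Nil(1) by simp
    qed
    show ?case
      \<comment> \<open>The four cases are the subsets of the two swapped positions that get
        decremented.\<close>
      using sw[of u v c] sw[of "u - 1" v "c + 1"] sw[of u "v - 1" "c + 1"] sw[of "u - 1" "v - 1" "c + 1 + 1"]
      by (simp add: esum_Cons algebra_simps)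
  next
    case (Cons a us)
    obtain m where n: "n = Suc m" "length us + length vs + 2 = m"
      using Cons.prems(1) by auto
    have "alternating m (\<lambda>as. \<Phi> c (a # as))" for a c
      by (rule alternating_Cons) (use Cons.prems(2) n(1) in simp)
    from Cons.IH[OF n(2) this] show ?case
      by (simp add: esum_Cons)
  qed
qed

text \<open>
  The exponents met by iterating a current: applying \<open>e\<^bsup>t\<alpha>\<^esup> z\<^bsup>t\<partial>\<^esup>\<close> shifts the next exponent by \<open>2\<close>.
\<close>

fun chain :: "nat \<Rightarrow> int \<Rightarrow> int list" where
  "chain 0 u = []"
| "chain (Suc n) u = u # chain n (u + 2)"

lemma length_chain [simp]: "length (chain n u) = n"
  by (induction n arbitrary: u) auto

text \<open>Lowering the entry just after \<open>u\<close> creates the adjacent pair u, u + 1, on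
  which an alternating function vanishes. The same argument then applies to each later entry, so
  only the empty set of positions contributes.\<close>

lemma esum_chain_trivial:
  fixes \<Phi> :: "int list \<Rightarrow> 'k::field_char_0 mpoly"
  assumes "alternating m \<Phi>" "length us + length vs + n + 2 = m"
  shows "esum z (\<lambda>c as. \<Phi> (us @ c # vs @ u # as)) c (chain n (u + 2)) = \<Phi> (us @ c # vs @ u # chain n (u + 2))"
  using assms(2)
proof (induction n arbitrary: u vs c)
  case (Suc n)
  have "esum z (\<lambda>c as. \<Phi> (us @ c # vs @ u # (u + 2 - 1) # as)) (c + 1) (chain n (u + 2 + 2)) =
      esum z (\<lambda>c as. 0) (c + 1) (chain n (u + 2 + 2))"
  proof (rule esum_cong)
    fix c and as' :: "int list" assume "length as' = length (chain n (u + 2 + 2))"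
    thus "\<Phi> (us @ c # vs @ u # (u + 2 - 1) # as') = 0"
      using alternating_eq_0[OF assms(1), of "us @ c # vs" as' u] Suc.prems
      by (simp add: add.commute)
  qed
  moreover have "esum z (\<lambda>c as. \<Phi> (us @ c # (vs @ [u]) @ (u + 2) # as)) c (chain n (u + 2 + 2)) =
      \<Phi> (us @ c # (vs @ [u]) @ (u + 2) # chain n (u + 2 + 2))"
    by (rule Suc.IH) (use Suc.prems in simp)
  ultimately show ?case by (simp add: esum_Cons esum_zero)
qed simp

text \<open>Only initial segments of positions contribute. If the first entry is kept,
  \<open>esum_chain_trivial\<close> leaves one term; if it is lowered, antisymmetry turns the sum
  into the same one for the next entry, its sign cancelling that of -y. The segment of length j
  contributes y^j.\<close>

lemma esum_chain:
  fixes \<Phi> :: "int list \<Rightarrow> 'k::field_char_0 mpoly"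
  assumes "alternating m \<Phi>" "length us + n + 1 = m"
  shows "esum (- y) (\<lambda>c as. \<Phi> (us @ c # as)) u (chain n (u + 2)) =
    Const (\<Sum>j\<le>n. y ^ j) * \<Phi> (us @ chain (Suc n) u)"
  using assms(2)
proof (induction n arbitrary: u us)
  case (Suc n)
  have "esum (- y) (\<lambda>c as. \<Phi> (us @ c # (u + 2) # as)) u (chain n (u + 2 + 2)) =
      \<Phi> (us @ u # (u + 2) # chain n (u + 2 + 2))"
    using esum_chain_trivial[OF assms(1), of us "[]" n "- y" "u + 2" u] Suc.prems by simp
  moreover have "esum (- y) (\<lambda>c as. \<Phi> (us @ c # (u + 2 - 1) # as)) (u + 1) (chain n (u + 2 + 2)) =
      - (Const (\<Sum>j\<le>n. y ^ j) * \<Phi> (us @ u # chain (Suc n) (u + 2)))"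
  proof -
    have "esum (- y) (\<lambda>c as. \<Phi> (us @ c # (u + 2 - 1) # as)) (u + 1) (chain n (u + 2 + 2)) =
      esum (- y) (\<lambda>c as. - \<Phi> ((us @ [u]) @ (c + 1) # as)) (u + 1) (chain n (u + 2 + 2))"
    proof (rule esum_cong)
      fix c and as' :: "int list" assume "length as' = length (chain n (u + 2 + 2))"
      thus "\<Phi> (us @ c # (u + 2 - 1) # as') = - \<Phi> ((us @ [u]) @ (c + 1) # as')"
        using alternatingD[OF assms(1), of us as' c "u + 1"] Suc.prems
        by (simp add: add.commute)
    qed
    also have "\<dots> = - esum (- y) (\<lambda>c as. \<Phi> ((us @ [u]) @ c # as)) (u + 2) (chain n (u + 2 + 2))"
      unfolding esum_uminus
      using esum_shift[of "- y" "\<lambda>c as. \<Phi> ((us @ [u]) @ c # as)" 1 "u + 1"]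
      by (simp add: add.commute)
    also have "\<dots> = - (Const (\<Sum>j\<le>n. y ^ j) * \<Phi> ((us @ [u]) @ chain (Suc n) (u + 2)))"
      by (subst Suc.IH) (use Suc.prems in auto)
    finally show ?thesis by simp
  qed
  moreover have "(\<Sum>j\<le>Suc n. y ^ j) = 1 + y * (\<Sum>j\<le>n. y ^ j)"
    by (simp add: sum.atMost_Suc_shift sum_distrib_left del: sum.atMost_Suc)
  ultimately show ?case
    by (simp add: esum_Cons Const_add Const_mult Const_hom.hom_uminus algebra_simps del: sum.atMost_Suc)
qed simp

text \<open>
  \<open>vand_op n bs f\<close> is the coefficient with exponents \<open>bs\<close> of
  \<open>\<Prod>\<^bsub>i<j\<^esub> (1 - z\<^sub>j / z\<^sub>i)\<close> times the normally ordered product of \<open>n\<close> vertex operators applied to \<open>f\<close>.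
\<close>

primrec vand_op :: "'k::field_char_0 \<Rightarrow> (int \<Rightarrow> 'k mpoly) \<Rightarrow> nat \<Rightarrow> int list \<Rightarrow> 'k mpoly \<Rightarrow> 'k mpoly" where
  "vand_op \<epsilon> g 0 bs f = f"
| "vand_op \<epsilon> g (Suc n) bs f =
    esum (- 1) (\<lambda>c as. trans_sum \<epsilon> (\<lambda>l x. g (c + int l) * vand_op \<epsilon> g n as x) f) (hd bs) (tl bs)"

lemma vand_op_0 [simp]: "vand_op \<epsilon> g n bs 0 = 0"
  by (induction n arbitrary: bs) (simp_all add: trans_sum_def esum_zero)

text \<open>Two outer operators with exponents \<open>c\<close> and \<open>k\<close> in normal order
  in front of \<open>vand_op\<close>, before any factor 1 - z_j/z_i involving them. \<open>M\<close>
  is meant to bound the nonzero translation coefficients of \<open>f\<close>.\<close>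

definition vand_pair :: "'k::field_char_0 \<Rightarrow> (int \<Rightarrow> 'k mpoly) \<Rightarrow> nat \<Rightarrow> nat \<Rightarrow> (int \<Rightarrow> 'k mpoly) \<Rightarrow>
    'k mpoly \<Rightarrow> int \<Rightarrow> int \<Rightarrow> int list \<Rightarrow> 'k mpoly" where
  "vand_pair \<epsilon> g n M \<phi> f c k as = (\<Sum>m<M. \<Sum>l<M. g (k + int m) * (\<phi> (c + int l) *
    vand_op \<epsilon> g n as (trans_coeff \<epsilon> l (trans_coeff \<epsilon> m f))))"

context
  fixes \<epsilon> y :: "'k::field_char_0" and g :: "int \<Rightarrow> 'k mpoly"
  assumes eps: "\<epsilon> * \<epsilon> = 1" and g_def: "g = hh \<epsilon> y"
begin

text \<open>Exposes the outermost operator of \<open>vand_op\<close> next to a further one, so that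
  the two can be exchanged.\<close>

lemma trans_sum_vand_op_Suc:
  assumes M: "\<forall>l\<ge>M. trans_coeff \<epsilon> l f = 0"
  shows "trans_sum \<epsilon> (\<lambda>l x. \<phi> (c + int l) * vand_op \<epsilon> g (Suc n) (a # as) x) f =
    esum (- 1) (\<lambda>k as. vand_pair \<epsilon> g n M \<phi> f c k as) a as"
proof -
  have M': "\<forall>l\<ge>M. trans_coeff \<epsilon> l (trans_coeff \<epsilon> m f) = 0" for m
    using M by (subst trans_coeff_commute) simp
  have "trans_sum \<epsilon> (\<lambda>l x. \<phi> (c + int l) * vand_op \<epsilon> g (Suc n) (a # as) x) f =
      (\<Sum>l<M. \<phi> (c + int l) * vand_op \<epsilon> g (Suc n) (a # as) (trans_coeff \<epsilon> l f))"
    by (rule trans_sum_eq[OF _ M]) (simp del: vand_op.simps)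
  also have "\<dots> = (\<Sum>l<M. \<phi> (c + int l) * esum (- 1) (\<lambda>k as. \<Sum>m<M. g (k + int m) *
      vand_op \<epsilon> g n as (trans_coeff \<epsilon> m (trans_coeff \<epsilon> l f))) a as)"
  proof -
    have "trans_sum \<epsilon> (\<lambda>m x. g (k + int m) * vand_op \<epsilon> g n as x) (trans_coeff \<epsilon> l f) =
        (\<Sum>m<M. g (k + int m) * vand_op \<epsilon> g n as (trans_coeff \<epsilon> m (trans_coeff \<epsilon> l f)))" for k l as
      by (rule trans_sum_eq[OF _ M']) simp
    thus ?thesis by simp
  qed
  also have "\<dots> = esum (- 1) (\<lambda>k as. \<Sum>l<M. \<phi> (c + int l) * (\<Sum>m<M. g (k + int m) *
      vand_op \<epsilon> g n as (trans_coeff \<epsilon> m (trans_coeff \<epsilon> l f)))) a as"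
    by (simp only: esum_sum esum_mult_left)
  also have "\<dots> = esum (- 1) (\<lambda>k as. vand_pair \<epsilon> g n M \<phi> f c k as) a as"
  proof (rule esum_cong)
    fix k :: int and as :: "int list"
    show "(\<Sum>l<M. \<phi> (c + int l) * (\<Sum>m<M. g (k + int m) *
        vand_op \<epsilon> g n as (trans_coeff \<epsilon> m (trans_coeff \<epsilon> l f)))) = vand_pair \<epsilon> g n M \<phi> f c k as"
      unfolding vand_pair_def sum_distrib_left
      by (subst sum.swap) (simp add: trans_coeff_commute[of \<epsilon> _ \<epsilon>] mult_ac)
  qed
  finally show ?thesis .
qed

text \<open>As for \<open>bernstein_swap\<close>: \<open>G\<close> collects all factors except the
  one between the first two variables and is symmetric in them; the missing 1 - w/z
  antisymmetrises.\<close>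

lemma vand_op_swap_head:
  "vand_op \<epsilon> g (Suc (Suc n)) (a # b # bs) f = - vand_op \<epsilon> g (Suc (Suc n)) ((b - 1) # (a + 1) # bs) f"
proof -
  obtain M where M: "\<forall>l\<ge>M. trans_coeff \<epsilon> l f = 0"
    using trans_coeff_eventually_0 by blast
  define G where "G a b = esum (- 1) (\<lambda>c as. esum (- 1) (\<lambda>k as. vand_pair \<epsilon> g n M g f c k as) b as) a bs" for a b
  have sym0: "vand_pair \<epsilon> g n M g f c k as = vand_pair \<epsilon> g n M g f k c as" for c k as
    unfolding vand_pair_def by (subst sum.swap) (simp add: trans_coeff_commute[of \<epsilon> _ \<epsilon>] mult_ac)
  have sym: "G a b = G b a" for a b
    unfolding G_def by (subst esum_commute) (intro esum_cong, rule sym0)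
  have "vand_op \<epsilon> g (Suc (Suc n)) (a # b # bs) f = G a b - G (a + 1) (b - 1)" for a b
    unfolding vand_op.simps(2)[of _ _ "Suc n"] G_def
    by (simp add: esum_Cons trans_sum_vand_op_Suc[OF M] Const_hom.hom_uminus del: vand_op.simps)
  thus ?thesis using sym[of b a] sym[of "b - 1" "a + 1"] by (simp del: vand_op.simps)
qed

text \<open>A swap at the head is \<open>vand_op_swap_head\<close>. Further inside, the head
  variable enters symmetrically through \<open>esum\<close>.\<close>

lemma alternating_vand_op: "alternating n (\<lambda>bs. vand_op \<epsilon> g n bs f)"
proof (induction n arbitrary: f)
  case 0
  show ?case by (simp add: alternating_def)
next
  case (Suc n)
  have 1: "alternating n (\<lambda>as. trans_sum \<epsilon> (\<lambda>l x. g (c + int l) * vand_op \<epsilon> g n as x) f)" for c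
    unfolding alternating_def
  proof (intro allI impI)
    fix us vs :: "int list" and u v :: int
    assume "length us + length vs + 2 = n"
    hence "vand_op \<epsilon> g n (us @ u # v # vs) f = - vand_op \<epsilon> g n (us @ (v - 1) # (u + 1) # vs) f" for f
      using alternatingD[OF Suc] by blast
    thus "trans_sum \<epsilon> (\<lambda>l x. g (c + int l) * vand_op \<epsilon> g n (us @ u # v # vs) x) f =
        - trans_sum \<epsilon> (\<lambda>l x. g (c + int l) * vand_op \<epsilon> g n (us @ (v - 1) # (u + 1) # vs) x) f"
      by (simp add: trans_sum_def sum_negf)
  qed
  show ?case
    unfolding alternating_def
  proof (intro allI impI)
    fix us vs :: "int list" and u v :: int
    assume len: "length us + length vs + 2 = Suc n"
    show "vand_op \<epsilon> g (Suc n) (us @ u # v # vs) f = - vand_op \<epsilon> g (Suc n) (us @ (v - 1) # (u + 1) # vs) f"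
    proof (cases us)
      case Nil
      then obtain m where "n = Suc m" using len by (cases n) auto
      thus ?thesis using Nil vand_op_swap_head[of m u v vs f] by (simp del: vand_op.simps)
    next
      case (Cons a us')
      have "alternating n (esum (- 1) (\<lambda>c as. trans_sum \<epsilon> (\<lambda>l x. g (c + int l) * vand_op \<epsilon> g n as x) f) a)"
        by (rule alternating_esum) (rule 1)
      from alternatingD[OF this, of us' vs u v] show ?thesis
        using Cons len by simp
    qed
  qed
qed

text \<open>Induction on \<open>n\<close>. Passing the new operator to the right of the first factor
  gives the three terms of \<open>vertex_op_hh_mult\<close>, which are what that position
  contributes to the two products with parameters -y and -1; the induction hypothesis handles the
  rest.\<close>

lemma vertex_op_vand_op_general:
  assumes "length bs = n"
  shows "vertex_op \<epsilon> \<phi> c (vand_op \<epsilon> g n bs f) =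
    esum (- y) (\<lambda>c as. esum (- 1) (\<lambda>c as. trans_sum \<epsilon> (\<lambda>l x. \<phi> (c + int l) * vand_op \<epsilon> g n as x) f) c as) c bs"
  using assms
proof (induction n arbitrary: bs c f)
  case 0
  thus ?case by (simp add: vertex_op_def)
next
  case (Suc n)
  obtain b bs' where bs: "bs = b # bs'" and len: "length bs' = n"
    using Suc.prems by (cases bs) auto
  obtain M where M: "\<forall>l\<ge>M. trans_coeff \<epsilon> l f = 0"
    using trans_coeff_eventually_0 by blast
  have M': "\<forall>l\<ge>M. trans_coeff \<epsilon> l (trans_coeff \<epsilon> m f) = 0" for m
    using M by (subst trans_coeff_commute) simp
  let ?Q = "vand_pair \<epsilon> g n M \<phi> f"
  define T where "T c b = esum (- y) (\<lambda>c as. esum (- 1) (\<lambda>c as. esum (- 1) (\<lambda>k as. ?Q c k as) b as) c as) c bs'" for c b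
  define H where "H c k as = esum (- y) (\<lambda>c as. esum (- 1) (\<lambda>c as. ?Q c k as) c as) c as" for c k as
  \<comment> \<open>\<open>T\<close> also contains the factors between the first old variable and
    the later ones. As multiplications commute, these can be applied last.\<close>
  have TH: "T c b = esum (- 1) (\<lambda>k as. H c k as) b bs'" for c b
  proof -
    have "T c b = esum (- y) (\<lambda>c as. esum (- 1) (\<lambda>k as. esum (- 1) (\<lambda>c as. ?Q c k as) c as) b as) c bs'"
      unfolding T_def by (rule esum_cong, rule esum_commute)
    also have "\<dots> = esum (- 1) (\<lambda>k as. H c k as) b bs'"
      unfolding H_def by (rule esum_commute)
    finally show ?thesis .
  qed
  have H: "(\<Sum>m<M. g (k + int m) * vertex_op \<epsilon> \<phi> c (vand_op \<epsilon> g n as (trans_coeff \<epsilon> m f))) = H c k as"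
    if "length as = n" for c k as
  proof -
    have ts: "trans_sum \<epsilon> (\<lambda>l x. \<phi> (c + int l) * vand_op \<epsilon> g n as x) (trans_coeff \<epsilon> m f) =
        (\<Sum>l<M. \<phi> (c + int l) * vand_op \<epsilon> g n as (trans_coeff \<epsilon> l (trans_coeff \<epsilon> m f)))" for c as m
      by (rule trans_sum_eq[OF _ M']) simp
    show ?thesis
    proof -
      have "H c k as = esum (- y) (\<lambda>c as. \<Sum>m<M. g (k + int m) * esum (- 1) (\<lambda>c as.
          \<Sum>l<M. \<phi> (c + int l) * vand_op \<epsilon> g n as (trans_coeff \<epsilon> l (trans_coeff \<epsilon> m f))) c as) c as"
        unfolding H_def vand_pair_def
        by (rule esum_cong) (simp only: sum_distrib_left[symmetric] esum_sum esum_mult_left)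
      also have "\<dots> = (\<Sum>m<M. g (k + int m) * vertex_op \<epsilon> \<phi> c (vand_op \<epsilon> g n as (trans_coeff \<epsilon> m f)))"
        unfolding Suc.IH[OF that] ts by (simp only: esum_sum[of "- y"] esum_mult_left[of "- y"])
      finally show ?thesis ..
    qed
  qed
  have step: "vertex_op \<epsilon> \<phi> c (trans_sum \<epsilon> (\<lambda>m x. g (k + int m) * vand_op \<epsilon> g n as x) f) =
      H c k as - Const (1 + y) * H (c + 1) (k - 1) as + Const y * H (c + 2) (k - 2) as"
    if "length as = n" for k as
  proof -
    have "trans_sum \<epsilon> (\<lambda>m x. g (k + int m) * vand_op \<epsilon> g n as x) f =
        (\<Sum>m<M. g (k + int m) * vand_op \<epsilon> g n as (trans_coeff \<epsilon> m f))"
      by (rule trans_sum_eq[OF _ M]) simp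
    hence "vertex_op \<epsilon> \<phi> c (trans_sum \<epsilon> (\<lambda>m x. g (k + int m) * vand_op \<epsilon> g n as x) f) =
        (\<Sum>m<M. g (k + int m) * vertex_op \<epsilon> \<phi> c (vand_op \<epsilon> g n as (trans_coeff \<epsilon> m f))
          - Const (1 + y) * (g ((k - 1) + int m) * vertex_op \<epsilon> \<phi> (c + 1) (vand_op \<epsilon> g n as (trans_coeff \<epsilon> m f)))
          + Const y * (g ((k - 2) + int m) * vertex_op \<epsilon> \<phi> (c + 2) (vand_op \<epsilon> g n as (trans_coeff \<epsilon> m f))))"
      by (simp only: vertex_op_sum) (simp add: g_def vertex_op_hh_mult[OF eps] algebra_simps)
    thus ?thesis
      unfolding sum.distrib sum_subtractf sum_distrib_left[symmetric] H[OF that] .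
  qed
  have "vertex_op \<epsilon> \<phi> c (vand_op \<epsilon> g (Suc n) bs f) =
      esum (- 1) (\<lambda>k as. vertex_op \<epsilon> \<phi> c (trans_sum \<epsilon> (\<lambda>m x. g (k + int m) * vand_op \<epsilon> g n as x) f)) b bs'"
    unfolding bs vand_op.simps list.sel
    by (rule esum_linear) (simp_all add: vertex_op_add vertex_op_Const_mult)
  also have "\<dots> = esum (- 1) (\<lambda>k as. H c k as - Const (1 + y) * H (c + 1) (k - 1) as + Const y * H (c + 2) (k - 2) as) b bs'"
    by (rule esum_cong) (simp add: step len)
  also have "\<dots> = T c b - Const (1 + y) * T (c + 1) (b - 1) + Const y * T (c + 2) (b - 2)"
    unfolding TH esum_add esum_diff esum_mult_left
    using esum_shift[of "- 1" "H (c + 1)" "- 1" b bs'] esum_shift[of "- 1" "H (c + 2)" "- 2" b bs'] by simp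
  also have "\<dots> = esum (- y) (\<lambda>c as. esum (- 1) (\<lambda>c as.
      trans_sum \<epsilon> (\<lambda>l x. \<phi> (c + int l) * vand_op \<epsilon> g (Suc n) as x) f) c as) c bs"
    unfolding bs T_def
    by (simp add: esum_Cons trans_sum_vand_op_Suc[OF M] esum_add esum_mult_left Const_hom.hom_uminus
        Const_add esum_shift[of _ _ 1] algebra_simps esum_diff del: vand_op.simps)
  finally show ?case .
qed

lemma vertex_op_vand_op:
  assumes "length bs = n"
  shows "vertex_op \<epsilon> g c (vand_op \<epsilon> g n bs f) = esum (- y) (\<lambda>c as. vand_op \<epsilon> g (Suc n) (c # as) f) c bs"
  unfolding vertex_op_vand_op_general[OF assms] by simp

text \<open>\<open>vertex_op_vand_op\<close> leaves the product with parameter -y over a chain, and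
  \<open>esum_chain\<close> evaluates it to the scalar 1 + y + ... + y^n.\<close>

lemma foldr_vertex_op_chain:
  "foldr (vertex_op \<epsilon> g) (chain n u) f = Const (\<Prod>k<n. \<Sum>j\<le>k. y ^ j) * vand_op \<epsilon> g n (chain n u) f"
proof (induction n arbitrary: u)
  case (Suc n)
  have "foldr (vertex_op \<epsilon> g) (chain (Suc n) u) f =
      Const (\<Prod>k<n. \<Sum>j\<le>k. y ^ j) * vertex_op \<epsilon> g u (vand_op \<epsilon> g n (chain n (u + 2)) f)"
    by (simp add: Suc vertex_op_Const_mult)
  also have "vertex_op \<epsilon> g u (vand_op \<epsilon> g n (chain n (u + 2)) f) =
      Const (\<Sum>j\<le>n. y ^ j) * vand_op \<epsilon> g (Suc n) (chain (Suc n) u) f"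
    unfolding vertex_op_vand_op[OF length_chain]
    using esum_chain[OF alternating_vand_op[of "Suc n" f], of "[]" n y u] by simp
  finally show ?case
    by (simp add: Const_mult mult_ac del: vand_op.simps chain.simps)
qed simp

lemma vand_op_in_int_sym:
  assumes "\<epsilon> = 1 \<or> \<epsilon> = - 1" "y \<in> laurent_ring q" "f \<in> int_sym q"
  shows "vand_op \<epsilon> g n bs f \<in> int_sym q"
  using assms(3)
proof (induction n arbitrary: bs f)
  case (Suc n)
  thus ?case
    unfolding vand_op.simps trans_sum_def g_def
    by (intro esum_in_int_sym laurent_ring_uminus laurent_ring_1 int_sym_sum int_sym.mult
        hh_in_int_sym[OF assms(1,2)] Suc.IH[unfolded g_def] trans_coeff_in_int_sym[OF assms(1)])
qed simp

end

subsection \<open>Exponentials as sums over compositions\<close>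

definition compositions :: "nat \<Rightarrow> nat list set" where
  "compositions k = {ns. 0 \<notin> set ns \<and> sum_list ns = k}"

lemma length_le_sum_list: "0 \<notin> set ns \<Longrightarrow> length ns \<le> sum_list (ns :: nat list)"
  by (induction ns) auto

lemma finite_compositions: "finite (compositions k)"
proof (rule finite_subset)
  show "compositions k \<subseteq> {ns. set ns \<subseteq> {..k} \<and> length ns \<le> k}"
    by (auto simp: compositions_def length_le_sum_list dest: member_le_sum_list)
qed (rule finite_lists_length_le, simp)

text \<open>The counterpart of \<open>exp_coeff\<close> on the symmetric function attached to one
  basis vector of the lattice part.\<close>

definition comp_exp :: "(nat \<Rightarrow> 'k::field_char_0 mpoly \<Rightarrow> 'k mpoly) \<Rightarrow> nat \<Rightarrow> 'k mpoly \<Rightarrow> 'k mpoly" where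
  "comp_exp a k x = (\<Sum>ns\<in>compositions k. Const (1 / fact (length ns)) * foldr a ns x)"

lemma comp_exp_0: "comp_exp a 0 x = x"
proof -
  have "ns \<in> compositions 0 \<longleftrightarrow> ns = []" for ns
    by (cases ns) (auto simp: compositions_def)
  hence "compositions 0 = {[]}" by blast
  thus ?thesis by (simp add: comp_exp_def)
qed

lemma foldr_commute_right:
  assumes "\<And>r s x. a r (a s x) = a s (a r x)"
  shows "foldr a ns (a r x) = a r (foldr a ns x)"
  by (induction ns) (simp_all add: assms[of _ r])

lemma foldr_rotate:
  assumes "\<And>r s x. a r (a s x) = a s (a r x)"
  shows "foldr a (rotate i ns) x = foldr a ns x"
proof (induction i)
  case (Suc i)
  have "foldr a (rotate1 ms) x = foldr a ms x" for ms
    by (cases ms) (simp_all add: foldr_commute_right[where a = a, OF assms])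
  thus ?case using Suc by simp
qed simp

text \<open>
  By cyclic symmetry, weighting a composition of \<open>k\<close> by \<open>k\<close>, the sum of its parts, has the same
  effect as weighting it by its length times its first part.
\<close>

lemma comp_exp_rec:
  fixes a :: "nat \<Rightarrow> 'k::field_char_0 mpoly \<Rightarrow> 'k mpoly"
  assumes comm: "\<And>r s x. a r (a s x) = a s (a r x)"
  shows "Const (of_nat (Suc k)) * comp_exp a (Suc k) x =
    (\<Sum>j\<le>k. Const (of_nat (Suc j)) * comp_exp a (k - j) (a (Suc j) x))"
proof -
  define w where "w ns = Const (1 / fact (length ns)) * foldr a ns x" for ns
  define S where "S = Sigma (compositions (Suc k)) (\<lambda>ns. {..<length ns})"
  have "Const (of_nat (Suc k)) * comp_exp a (Suc k) x =
      (\<Sum>ns\<in>compositions (Suc k). Const (of_nat (sum_list ns)) * w ns)"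
    unfolding comp_exp_def w_def sum_distrib_left by (intro sum.cong refl) (simp add: compositions_def)
  also have "\<dots> = (\<Sum>ns\<in>compositions (Suc k). \<Sum>i<length ns. Const (of_nat (ns ! i)) * w ns)"
    by (intro sum.cong refl)
      (simp add: sum_list_sum_nth atLeast0LessThan Const_hom.hom_sum Const_hom.hom_of_nat sum_distrib_right)
  also have "\<dots> = (\<Sum>(ns, i)\<in>S. Const (of_nat (ns ! i)) * w ns)"
    unfolding S_def by (rule sum.Sigma) (auto intro: finite_compositions)
  also have "\<dots> = (\<Sum>(ns, i)\<in>S. Const (of_nat (hd ns)) * w ns)"
  \<comment> \<open>Rotation by \<open>i\<close> brings the \<open>i\<close>-th part to the front
    and leaves \<open>w\<close> unchanged, since the operators commute.\<close>
  proof (rule sum.reindex_bij_witness[of _ "\<lambda>(ns, i). (rotate (length ns - i) ns, i)" "\<lambda>(ns, i). (rotate i ns, i)"])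
    fix p assume "p \<in> S"
    then obtain ns i where p: "p = (ns, i)" "ns \<in> compositions (Suc k)" "i < length ns"
      by (auto simp: S_def)
    have "rotate (length ns - i) (rotate i ns) = ns" "rotate i (rotate (length ns - i) ns) = ns"
      using p(3) by (simp_all add: rotate_rotate)
    thus "(case case p of (ns, i) \<Rightarrow> (rotate i ns, i) of (ns, i) \<Rightarrow> (rotate (length ns - i) ns, i)) = p"
      "(case case p of (ns, i) \<Rightarrow> (rotate (length ns - i) ns, i) of (ns, i) \<Rightarrow> (rotate i ns, i)) = p"
      by (simp_all add: p)
    have "rotate j ns \<in> compositions (Suc k)" for j
      using p(2) foldr_rotate[of "(+)" j ns 0] by (simp add: compositions_def sum_list.eq_foldr add.left_commute)
    thus "(case p of (ns, i) \<Rightarrow> (rotate i ns, i)) \<in> S" "(case p of (ns, i) \<Rightarrow> (rotate (length ns - i) ns, i)) \<in> S"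
      using p(3) by (auto simp: p(1) S_def)
    have "hd (rotate i ns) = ns ! i"
      using p(3) by (subst hd_rotate_conv_nth) auto
    moreover have "w (rotate i ns) = w ns"
      by (simp add: w_def foldr_rotate[where a = a, OF comm])
    ultimately show "(case case p of (ns, i) \<Rightarrow> (rotate i ns, i) of (ns, i) \<Rightarrow> Const (of_nat (hd ns)) * w ns) =
        (case p of (ns, i) \<Rightarrow> Const (of_nat (ns ! i)) * w ns)"
      by (simp add: p)
  qed
  also have "\<dots> = (\<Sum>ns\<in>compositions (Suc k). \<Sum>i<length ns. Const (of_nat (hd ns)) * w ns)"
    unfolding S_def by (rule sum.Sigma[symmetric]) (auto intro: finite_compositions)
  \<comment> \<open>Split off the first part \<open>Suc j\<close>; the number of positions lowers
    the factorial in the denominator by one.\<close>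
  also have "\<dots> = (\<Sum>(j, ns)\<in>Sigma {..k} (\<lambda>j. compositions (k - j)).
      Const (of_nat (Suc j)) * (Const (1 / fact (length ns)) * foldr a ns (a (Suc j) x)))"
  proof (rule sum.reindex_bij_witness[of _ "\<lambda>(j, ns). Suc j # ns" "\<lambda>ns. (hd ns - 1, tl ns)"])
    fix ns assume ns: "ns \<in> compositions (Suc k)"
    then obtain j ms where j: "ns = Suc j # ms"
      by (cases ns; cases "hd ns") (auto simp: compositions_def)
    have ms: "ms \<in> compositions (k - j)" and jk: "j \<le> k"
      using ns by (auto simp: compositions_def j)
    show "(case (hd ns - 1, tl ns) of (j, ns) \<Rightarrow> Suc j # ns) = ns" by (simp add: j)
    show "(hd ns - 1, tl ns) \<in> Sigma {..k} (\<lambda>j. compositions (k - j))" using ms jk by (simp add: j)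
    have "of_nat (length ns) * w ns = Const (1 / fact (length ms)) * foldr a ms (a (Suc j) x)"
    proof -
      have "of_nat (length ns) * Const (1 / fact (length ns)) = Const (1 / fact (length ms) :: 'k)"
        unfolding Const_hom.hom_of_nat[symmetric] Const_mult[symmetric] j
        by (simp add: field_simps del: of_nat_Suc)
      thus ?thesis
        unfolding w_def mult.assoc[symmetric] by (simp add: j foldr_commute_right[where a = a, OF comm])
    qed
    thus "(case (hd ns - 1, tl ns) of (j, ns) \<Rightarrow>
        Const (of_nat (Suc j)) * (Const (1 / fact (length ns)) * foldr a ns (a (Suc j) x))) =
        (\<Sum>i<length ns. Const (of_nat (hd ns)) * w ns)"
      by (simp add: j mult.left_commute[of "1 + of_nat (length ms)"] del: foldr.simps)
  qed (auto simp: compositions_def)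
  also have "\<dots> = (\<Sum>j\<le>k. Const (of_nat (Suc j)) * comp_exp a (k - j) (a (Suc j) x))"
    unfolding comp_exp_def sum_distrib_left
    by (rule sum.Sigma[symmetric]) (auto intro: finite_compositions)
  finally show ?thesis .
qed

text \<open>The hypothesis on \<open>G\<close> is the recursion \<open>comp_exp_rec\<close> for
  multiplication operators, so both sides agree by induction.\<close>

lemma comp_exp_creation:
  assumes G: "G 0 = 1" "\<And>k. Const (of_nat (Suc k)) * G (Suc k) =
    (\<Sum>j\<le>k. Const (of_nat (Suc j) * c (Suc j)) * Var j * G (k - j))"
  shows "comp_exp (\<lambda>r x. Const (c r) * (Var (r - 1) * x)) k x = G k * x"
proof (induction k arbitrary: x rule: less_induct)
  case (less k)
  show ?case
  proof (cases k)
    case (Suc n)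
    let ?a = "\<lambda>r x. Const (c r) * (Var (r - 1) * x)"
    have comm: "?a r (?a s x) = ?a s (?a r x)" for r s x
      by (simp only: mult_ac)
    have IH: "comp_exp ?a (n - j) x = G (n - j) * x" for j x
      using less[of "n - j"] Suc by simp
    have "Const (of_nat (Suc n)) * comp_exp ?a (Suc n) x =
        (\<Sum>j\<le>n. Const (of_nat (Suc j)) * (G (n - j) * (Const (c (Suc j)) * (Var j * x))))"
      unfolding comp_exp_rec[where a = ?a, OF comm] IH by simp
    also have "\<dots> = Const (of_nat (Suc n)) * (G (Suc n) * x)"
      unfolding mult.assoc[symmetric] G(2) sum_distrib_right by (simp add: Const_mult mult_ac)
    finally show ?thesis unfolding Suc Const_of_nat_Suc_cancel .
  qed (simp add: comp_exp_0 G)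
qed

text \<open>Here \<open>comp_exp_rec\<close> matches the recursion
  \<open>Suc_mult_trans_coeff\<close>, with z rescaled by s.\<close>

lemma comp_exp_annihilation:
  "comp_exp (\<lambda>r x. Const (- \<epsilon> * s ^ r) * partial_deriv (r - 1) x) l x = Const (s ^ l) * trans_coeff \<epsilon> l x"
proof (induction l arbitrary: x rule: less_induct)
  case (less l)
  show ?case
  proof (cases l)
    case (Suc n)
    let ?a = "\<lambda>r x. Const (- \<epsilon> * s ^ r) * partial_deriv (r - 1) x"
    have comm: "?a r (?a t x) = ?a t (?a r x)" for r t x
      by (simp only: partial_deriv_Const_mult partial_deriv_commute[of "t - 1" "r - 1"] mult.left_commute)
    have IH: "comp_exp ?a (n - j) x = Const (s ^ (n - j)) * trans_coeff \<epsilon> (n - j) x" for j x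
      using less[of "n - j"] Suc by simp
    have "Const (of_nat (Suc n)) * comp_exp ?a (Suc n) x =
        (\<Sum>j\<le>n. Const (of_nat (Suc j)) * (Const (s ^ (n - j)) *
          trans_coeff \<epsilon> (n - j) (Const (- \<epsilon> * s ^ Suc j) * partial_deriv j x)))"
      unfolding comp_exp_rec[where a = ?a, OF comm] IH by simp
    also have "\<dots> = (\<Sum>j\<le>n. Const (s ^ Suc n) * (Const (- \<epsilon> * of_nat (Suc j)) * trans_coeff \<epsilon> (n - j) (partial_deriv j x)))"
    proof (intro sum.cong refl)
      fix j assume "j \<in> {..n}"
      hence "s ^ Suc n = s ^ (n - j) * s ^ Suc j" by (simp add: power_add[symmetric])
      thus "Const (of_nat (Suc j)) * (Const (s ^ (n - j)) *
          trans_coeff \<epsilon> (n - j) (Const (- \<epsilon> * s ^ Suc j) * partial_deriv j x)) =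
        Const (s ^ Suc n) * (Const (- \<epsilon> * of_nat (Suc j)) * trans_coeff \<epsilon> (n - j) (partial_deriv j x))"
        unfolding trans_coeff_Const_mult mult.assoc[symmetric] Const_mult[symmetric]
        by (simp only: mult_ac mult_minus_left mult_minus_right)
    qed
    also have "\<dots> = Const (of_nat (Suc n)) * (Const (s ^ Suc n) * trans_coeff \<epsilon> (Suc n) x)"
      unfolding mult.left_commute[of "Const (of_nat (Suc n))"] Suc_mult_trans_coeff sum_distrib_left ..
    finally show ?thesis unfolding Suc Const_of_nat_Suc_cancel .
  qed (simp add: comp_exp_0)
qed

lemma hh_of_nat: "hh \<epsilon> y (int n) = (\<Sum>j\<le>n. Const (y ^ j) * hs \<epsilon> j * hs \<epsilon> (n - j))"
  unfolding hh_def by (intro sum.cong) (auto simp: hz_def nat_diff_distrib)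

text \<open>Coefficient form of the logarithmic derivative of H(z) H(yz); \<open>B\<close> is the
  series H(yz).\<close>

lemma hh_rec:
  "Const (of_nat (Suc n)) * hh \<epsilon> y (int (Suc n)) =
    (\<Sum>j\<le>n. Const (\<epsilon> * (1 + y ^ Suc j)) * Var j * hh \<epsilon> y (int (n - j)))"
proof -
  define A where "A = Abs_fps (hs \<epsilon>)"
  define B where "B = Abs_fps (\<lambda>n. Const (y ^ n) * hs \<epsilon> n)"
  define P where "P = Abs_fps (\<lambda>k. Var k :: 'a mpoly)"
  define P' where "P' = Abs_fps (\<lambda>k. Const (y ^ Suc k) * Var k)"
  have BA: "fps_nth (B * A) n = hh \<epsilon> y (int n)" for n
    by (simp add: A_def B_def fps_mult_nth hh_of_nat atLeast0AtMost)
  have A': "fps_deriv A = fps_const (Const \<epsilon>) * P * A"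
    using hs_fps_deriv[OF comm_ring_hom_ident, of \<epsilon>] by (simp add: A_def P_def)
  have B': "fps_deriv B = fps_const (Const \<epsilon>) * P' * B"
  proof (rule fps_ext)
    fix n
    have "fps_nth (fps_deriv B) n = Const (y ^ Suc n) * (of_nat (Suc n) * hs \<epsilon> (Suc n))"
      by (simp add: B_def mult_ac del: hs.simps)
    also have "\<dots> = Const \<epsilon> * (\<Sum>k\<le>n. (Const (y ^ Suc k) * Var k) * (Const (y ^ (n - k)) * hs \<epsilon> (n - k)))"
    proof -
      have "Const (y ^ Suc n) = Const (y ^ Suc k) * Const (y ^ (n - k))" if "k \<le> n" for k
        using that by (simp add: Const_mult[symmetric] power_add[symmetric] mult.assoc)
      hence "Const (y ^ Suc n) * (\<Sum>k\<le>n. Var k * hs \<epsilon> (n - k)) =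
          (\<Sum>k\<le>n. (Const (y ^ Suc k) * Var k) * (Const (y ^ (n - k)) * hs \<epsilon> (n - k)))"
        unfolding sum_distrib_left by (intro sum.cong refl) (simp add: mult_ac)
      thus ?thesis unfolding hs_Suc mult.left_commute[of _ "Const \<epsilon>"] by (simp only:)
    qed
    also have "\<dots> = fps_nth (fps_const (Const \<epsilon>) * P' * B) n"
      unfolding mult.assoc by (subst fps_mult_left_const_nth) (simp add: fps_mult_nth P'_def B_def atLeast0AtMost mult.assoc)
    finally show "fps_nth (fps_deriv B) n = fps_nth (fps_const (Const \<epsilon>) * P' * B) n" .
  qed
  have "Const (of_nat (Suc n)) * hh \<epsilon> y (int (Suc n)) = fps_nth (fps_deriv (B * A)) n"
    unfolding fps_deriv_nth BA[symmetric] Const_hom.hom_of_nat by simp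
  also have "fps_deriv (B * A) = fps_const (Const \<epsilon>) * (P + P') * (B * A)"
    by (simp add: fps_deriv_mult A' B' algebra_simps)
  also have "fps_nth \<dots> n = Const \<epsilon> * (\<Sum>j\<le>n. (Var j + Const (y ^ Suc j) * Var j) * hh \<epsilon> y (int (n - j)))"
    unfolding mult.assoc
    by (subst fps_mult_left_const_nth, subst fps_mult_nth)
      (simp add: BA P_def P'_def atLeast0AtMost del: of_nat_diff)
  also have "\<dots> = (\<Sum>j\<le>n. Const (\<epsilon> * (1 + y ^ Suc j)) * Var j * hh \<epsilon> y (int (n - j)))"
    unfolding sum_distrib_left
    by (intro sum.cong refl) (simp only: Const_mult Const_add Const_1 mult_1 algebra_simps)
  finally show ?thesis .
qed

subsection \<open>The Fock space\<close>

lemma fscale_single: "fscale c (single m x) = single m (Const c * x)"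
  by (simp add: fscale_def mult_single)

lemma fscale_add_left: "fscale (a + b) v = fscale a v + fscale b v"
  by (simp add: fscale_def Const_add single_add distrib_right)

lemma fscale_fscale: "fscale a (fscale b v) = fscale (a * b) v"
  by (simp add: fscale_def mult.assoc[symmetric] mult_single Const_mult)

lemma fscale_1 [simp]: "fscale 1 v = v" and fscale_0 [simp]: "fscale 0 v = 0"
  by (simp_all add: fscale_def)

lemma single_sum: "single m (\<Sum>i\<in>I. f i) = (\<Sum>i\<in>I. single m (f i))"
  by (induction I rule: infinite_finite_induct) (auto simp: single_add)

lemma exp_coeff_single:
  assumes "\<And>r x. A r (single m x) = single m (a r x)"
  shows "exp_coeff A k (single m x) = single m (comp_exp a k x)"
proof -
  have "foldr A ns (single m x) = single m (foldr a ns x)" for ns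
    by (induction ns) (simp_all add: assms)
  thus ?thesis
    by (simp add: exp_coeff_def comp_exp_def compositions_def single_sum fscale_single)
qed

lemma fun_del_single: "fun_del i g (single m f) = single m (Const (g (2 * m + int i)) * f)"
  by (cases "f = 0") (simp_all add: fun_del_def fscale_single)

text \<open>The hypotheses on \<open>c\<close> and \<open>c'\<close> say that, after rescaling z by
  s, the two exponentials are H(z) H(yz) and the translation. The exponent \<open>a\<close> is what
  remains of -n - 1 once z^(t \<partial>) has contributed its power of z.\<close>

lemma vertex_mode_single:
  fixes q s y \<epsilon> :: "'k::field_char_0"
  assumes q: "\<And>r. 1 + q ^ (2 * r) \<noteq> 0" and s: "s \<noteq> 0"
    and c: "\<And>r. r \<ge> 1 \<Longrightarrow> c r = \<epsilon> * (1 + y ^ r) * s ^ r / of_nat r"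
    and c': "\<And>r. r \<ge> 1 \<Longrightarrow> c' r * (of_nat r / (1 + q ^ (2 * r))) = - \<epsilon> * inverse s ^ r"
    and a: "a = - n - 1 - t * (2 * m + int i)"
  shows "vertex_mode q i c c' t n (single m f) =
    single (m + t) (Const (s powi a) * vertex_op \<epsilon> (hh \<epsilon> y) a f)"
proof -
  define G where "G k = Const (s ^ k) * hh \<epsilon> y (int k)" for k
  have G0: "G 0 = 1" by (simp add: G_def hh_def hz_def)
  have G_Suc: "Const (of_nat (Suc k)) * G (Suc k) =
      (\<Sum>j\<le>k. Const (of_nat (Suc j) * c (Suc j)) * Var j * G (k - j))" for k
  proof -
    have "Const (of_nat (Suc k)) * G (Suc k) =
        Const (s ^ Suc k) * (Const (of_nat (Suc k)) * hh \<epsilon> y (int (Suc k)))"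
      unfolding G_def by (simp only: mult.left_commute)
    also have "\<dots> = (\<Sum>j\<le>k. Const (of_nat (Suc j) * c (Suc j)) * Var j * G (k - j))"
      unfolding hh_rec sum_distrib_left
    proof (intro sum.cong refl)
      fix j assume "j \<in> {..k}"
      hence "s ^ Suc k = s ^ (k - j) * s ^ Suc j" by (simp add: power_add[symmetric])
      moreover have "of_nat (Suc j) * c (Suc j) = \<epsilon> * (1 + y ^ Suc j) * s ^ Suc j"
        by (simp add: c del: of_nat_Suc power_Suc)
      ultimately show "Const (s ^ Suc k) * (Const (\<epsilon> * (1 + y ^ Suc j)) * Var j * hh \<epsilon> y (int (k - j))) =
          Const (of_nat (Suc j) * c (Suc j)) * Var j * G (k - j)"
        unfolding G_def by (simp only: Const_mult mult_ac)
    qed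
    finally show ?thesis .
  qed
  let ?cr = "\<lambda>r w. fscale (c r) (heis q (- int r) w)"
  let ?an = "\<lambda>r w. fscale (c' r) (heis q (int r) w)"
  \<comment> \<open>Compositions have no part 0, so only the operators of index at least 1
    matter.\<close>
  have cong: "exp_coeff A k v = exp_coeff A' k v" if "\<And>r w. r \<ge> 1 \<Longrightarrow> A r w = A' r w"
    for A A' :: "nat \<Rightarrow> 'k fock \<Rightarrow> 'k fock" and k v
  proof -
    have "0 \<notin> set ns \<Longrightarrow> foldr A ns v = foldr A' ns v" for ns
      by (induction ns) (auto simp: that)
    thus ?thesis unfolding exp_coeff_def by (intro sum.cong refl) auto
  qed
  have creation: "exp_coeff ?cr k (single m' x) = single m' (G k * x)" for k m' x
  proof -
    have "exp_coeff ?cr k (single m' x) =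
        exp_coeff (\<lambda>r w. single 0 (Const (c r)) * (single 0 (Var (r - 1)) * w)) k (single m' x)"
      by (rule cong) (simp add: heis_def fscale_def)
    also have "\<dots> = single m' (comp_exp (\<lambda>r x. Const (c r) * (Var (r - 1) * x)) k x)"
      by (rule exp_coeff_single) (simp add: mult_single)
    finally show ?thesis
      by (simp only: comp_exp_creation[OF G0 G_Suc])
  qed
  have annihilation: "exp_coeff ?an k (single m' x) = single m' (Const (inverse s ^ k) * trans_coeff \<epsilon> k x)" for k m' x
  proof -
    have "exp_coeff ?an k (single m' x) =
        exp_coeff (\<lambda>r w. fscale (- \<epsilon> * inverse s ^ r) (Poly_Mapping.map (partial_deriv (r - 1)) w)) k (single m' x)"
    proof (rule cong)
      fix r :: nat and w :: "'k fock" assume r: "r \<ge> 1"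
      have "fscale (c' r) (heis q (int r) w) =
          fscale (c' r * (of_nat r / (1 + q ^ (2 * r)))) (Poly_Mapping.map (partial_deriv (r - 1)) w)"
        using r by (simp add: heis_def fscale_fscale)
      thus "fscale (c' r) (heis q (int r) w) =
          fscale (- \<epsilon> * inverse s ^ r) (Poly_Mapping.map (partial_deriv (r - 1)) w)"
        unfolding c'[OF r] .
    qed
    also have "\<dots> = single m' (comp_exp (\<lambda>r x. Const (- \<epsilon> * inverse s ^ r) * partial_deriv (r - 1) x) k x)"
      by (rule exp_coeff_single) (simp add: fscale_single map_single when_def)
    finally show ?thesis
      by (simp only: comp_exp_annihilation)
  qed
  define d where "d = 2 * m + int i"
  obtain M where M: "\<forall>l\<ge>M. trans_coeff \<epsilon> l f = 0"
    using trans_coeff_eventually_0 by blast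
  define F where "F = (\<lambda>(k :: nat, l :: nat, d' :: int). if int k - int l + t * d' = - n - 1 then
      exp_coeff ?cr k (exp_coeff ?an l (e_alpha t (fun_del i (\<lambda>d''. if d'' = d' then 1 else 0) (single m f))))
      else 0)"
  have F: "F (k, l, d') = (if int k = a + int l \<and> d' = d
      then single (m + t) (G k * (Const (inverse s ^ l) * trans_coeff \<epsilon> l f)) else 0)" for k l d'
  proof -
    have "F (k, l, d') = (if int k - int l + t * d' = - n - 1 then
        single (t + m) (G k * (Const (inverse s ^ l) * trans_coeff \<epsilon> l (Const (if d = d' then 1 else 0) * f))) else 0)"
      by (simp add: F_def fun_del_single e_alpha_def mult_single creation annihilation d_def)
    moreover have "int k - int l + t * d = - n - 1 \<longleftrightarrow> int k = a + int l"
      unfolding a d_def by linarith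
    ultimately show ?thesis by (auto simp: add.commute)
  qed
  \<comment> \<open>Only the eigenvalue \<open>d\<close> and the index k = a + l contribute, and
    \<open>l\<close> is bounded by \<open>M\<close>; the formal sum becomes finite.\<close>
  let ?A = "(\<lambda>l. (nat (a + int l), l, d)) ` {..<M}"
  have "{p. F p \<noteq> 0} \<subseteq> ?A"
  proof
    fix p assume p: "p \<in> {p. F p \<noteq> 0}"
    obtain k l d' where "p = (k, l, d')" by (cases p) auto
    with p have "F (k, l, d') \<noteq> 0" by simp
    hence kl: "int k = a + int l" "d' = d" "trans_coeff \<epsilon> l f \<noteq> 0"
      unfolding F by (auto split: if_splits)
    hence "l < M" using M by (meson not_le)
    thus "p \<in> ?A"
      using kl \<open>p = (k, l, d')\<close> by (intro image_eqI[of _ _ l]) auto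
  qed
  hence "Sum_any F = sum F ?A"
    by (intro Sum_any.expand_superset) auto
  also have "\<dots> = (\<Sum>l<M. F (nat (a + int l), l, d))"
    by (subst sum.reindex) (auto simp: inj_on_def)
  also have "\<dots> = (\<Sum>l<M. single (m + t) (Const (s powi a) * (hh \<epsilon> y (a + int l) * trans_coeff \<epsilon> l f)))"
  proof (intro sum.cong refl)
    fix l
    show "F (nat (a + int l), l, d) = single (m + t) (Const (s powi a) * (hh \<epsilon> y (a + int l) * trans_coeff \<epsilon> l f))"
    proof (cases "a + int l \<ge> 0")
      case True
      define k where "k = nat (a + int l)"
      have k: "int k = a + int l" using True by (simp add: k_def)
      have "s powi a = s powi (int k - int l)" by (simp add: k)
      also have "\<dots> = s ^ k * inverse s ^ l"
        using s by (simp add: power_int_diff field_simps)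
      finally have eq: "G k * (Const (inverse s ^ l) * trans_coeff \<epsilon> l f) =
          Const (s powi a) * (hh \<epsilon> y (int k) * trans_coeff \<epsilon> l f)"
        unfolding G_def by (simp only: Const_mult mult_ac)
      show ?thesis
        unfolding F k_def[symmetric] by (simp only: k eq[unfolded k] simp_thms if_True)
    next
      \<comment> \<open>For a + l < 0 no \<open>k\<close> exists, in agreement with the vanishing of
        \<open>hh\<close> at negative arguments.\<close>
      case False
      hence "hh \<epsilon> y (a + int l) = 0" by (simp add: hh_def hz_def)
      thus ?thesis unfolding F using False by simp
    qed
  qed
  also have "\<dots> = single (m + t) (Const (s powi a) * vertex_op \<epsilon> (hh \<epsilon> y) a f)"
    unfolding vertex_op_eq[OF M] sum_distrib_left single_sum ..
  finally show ?thesis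
    unfolding vertex_mode_def F_def .
qed

section \<open>The lattice in the Fock space, described componentwise\<close>

definition int_fock :: "'k::field_char_0 \<Rightarrow> 'k fock set" where
  "int_fock q = {v. \<forall>m. lookup v m \<in> int_sym q}"

lemma single_in_int_fock: "f \<in> int_sym q \<Longrightarrow> single m f \<in> int_fock q"
  by (simp add: int_fock_def lookup_single when_def)

lemma int_fock_0: "0 \<in> int_fock q"
  by (simp add: int_fock_def)

lemma int_fock_add: "v \<in> int_fock q \<Longrightarrow> w \<in> int_fock q \<Longrightarrow> v + w \<in> int_fock q"
  by (simp add: int_fock_def lookup_add int_sym.add)

lemma int_fock_sum: "(\<And>i. i \<in> I \<Longrightarrow> v i \<in> int_fock q) \<Longrightarrow> (\<Sum>i\<in>I. v i) \<in> int_fock q"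
  by (induction I rule: infinite_finite_induct) (auto intro: int_fock_0 int_fock_add)

lemma lookup_fscale: "lookup (fscale c v) m = Const c * lookup v m"
  unfolding fscale_def mult_map_scale_conv_mult[symmetric] by (simp add: map.rep_eq when_def)

lemma int_fock_scale: "c \<in> laurent_ring q \<Longrightarrow> v \<in> int_fock q \<Longrightarrow> fscale c v \<in> int_fock q"
  by (simp add: int_fock_def lookup_fscale int_sym.mult int_sym.Const)

lemma schur_lattice_add:
  assumes "q \<noteq> 0" "v \<in> schur_lattice q" "w \<in> schur_lattice q"
  shows "v + w \<in> schur_lattice q"
proof -
  obtain B c where B: "v = (\<Sum>b\<in>B. fscale (c b) b)" "finite B" "B \<subseteq> schur_basis" "c ` B \<subseteq> laurent_ring q"
    using assms(2) unfolding schur_lattice_def by blast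
  obtain B' c' where B': "w = (\<Sum>b\<in>B'. fscale (c' b) b)" "finite B'" "B' \<subseteq> schur_basis" "c' ` B' \<subseteq> laurent_ring q"
    using assms(3) unfolding schur_lattice_def by blast
  \<comment> \<open>A lattice vector carries one coefficient per basis element, so both families are
    extended by zero to the union and added.\<close>
  define e where "e b = (if b \<in> B then c b else 0) + (if b \<in> B' then c' b else 0)" for b
  have "v = (\<Sum>b\<in>B \<union> B'. fscale (if b \<in> B then c b else 0) b)"
    unfolding B(1) using B B' by (intro sum.mono_neutral_cong_left) auto
  moreover have "w = (\<Sum>b\<in>B \<union> B'. fscale (if b \<in> B' then c' b else 0) b)"
    unfolding B'(1) using B B' by (intro sum.mono_neutral_cong_left) auto
  ultimately have "v + w = (\<Sum>b\<in>B \<union> B'. fscale (e b) b)"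
    by (simp only: e_def fscale_add_left sum.distrib)
  moreover have "e ` (B \<union> B') \<subseteq> laurent_ring q"
    using B(4) B'(4) assms(1) by (auto simp: e_def laurent_ring_0 image_subset_iff intro!: laurent_ring_add)
  ultimately show ?thesis
    unfolding schur_lattice_def using B B' by blast
qed

lemma schur_lattice_eq_int_fock:
  assumes "q \<noteq> 0"
  shows "schur_lattice q = int_fock q"
proof (intro Set.set_eqI iffI)
  fix v assume "v \<in> schur_lattice q"
  thus "v \<in> int_fock q"
    unfolding schur_lattice_def schur_basis_def
    by (auto intro!: int_fock_sum int_fock_scale) (auto intro!: single_in_int_fock schur_in_int_sym)
next
  fix v assume v: "v \<in> int_fock q"
  have zero: "0 \<in> schur_lattice q"
    unfolding schur_lattice_def by (auto intro!: exI[of _ "{}"])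
  have one: "fscale c (single m (schur \<mu>)) \<in> schur_lattice q" if "c \<in> laurent_ring q" "is_partition \<mu>" for c m \<mu>
    unfolding schur_lattice_def schur_basis_def using that
    by (intro CollectI exI[of _ "{single m (schur \<mu>)}"] exI[of _ "\<lambda>_. c"]) auto
  have "single m f \<in> schur_lattice q" if "f \<in> laurent_span q (schur ` {\<mu>. is_partition \<mu>})" for m f
    using that
  proof (induction rule: laurent_span.induct)
    case (step c s f)
    thus ?case
      using one by (auto simp: single_add fscale_single[symmetric] intro!: schur_lattice_add[OF assms])
  qed (simp add: zero)
  hence comp: "single m (lookup v m) \<in> schur_lattice q" for m
    using int_sym_subset_span_schur[OF assms] v by (auto simp: int_fock_def)
  have sums: "(\<Sum>m\<in>I. w m) \<in> schur_lattice q" if "\<And>m. w m \<in> schur_lattice q" for I and w :: "int \<Rightarrow> 'a fock"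
    using that by (induction I rule: infinite_finite_induct) (auto intro: zero schur_lattice_add[OF assms])
  have "(\<Sum>m\<in>keys v. single m (lookup v m)) \<in> schur_lattice q"
    by (rule sums) (rule comp)
  thus "v \<in> schur_lattice q" by (simp only: sum_single_lookup)
qed

section \<open>Nonvanishing denominators and quantum integers\<close>

lemma not_algebraic_imp:
  fixes q :: "'k::field_char_0"
  assumes "\<not> algebraic q"
  shows "q \<noteq> 0" and "n > 0 \<Longrightarrow> q ^ n \<noteq> 1" and "1 + q ^ n \<noteq> 0"
proof -
  show "q \<noteq> 0"
    using assms algebraic_def[of "0::'k"] by (auto intro!: exI[of _ "[:0, 1:]"] simp: coeff_pCons split: nat.splits)
  have pow: "q ^ n \<noteq> 1" if "n > 0" for n
  proof
    assume "q ^ n = 1"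
    moreover have "coeff (monom 1 n - 1 :: 'k poly) n \<noteq> 0" using that by simp
    hence "monom 1 n - 1 \<noteq> (0 :: 'k poly)" by fastforce
    ultimately have "algebraic q"
      by (intro algebraicI[of "monom 1 n - 1"]) (auto simp: poly_monom)
    thus False using assms by blast
  qed
  thus "n > 0 \<Longrightarrow> q ^ n \<noteq> 1" .
  show "1 + q ^ n \<noteq> 0"
  proof
    assume "1 + q ^ n = 0"
    hence "q ^ n = - 1" by (simp add: eq_neg_iff_add_eq_0 add.commute)
    hence "q ^ (2 * n) = 1" by (simp add: power_mult power2_eq_square mult.commute[of 2])
    hence "n = 0" using pow[of "2 * n"] by auto
    thus False using \<open>1 + q ^ n = 0\<close> by simp
  qed
qed

text \<open>Stated for a pair of mutually inverse elements, to cover q and its inverse at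
  once.\<close>

lemma geometric_sum_eq:
  fixes p p' :: "'k::field"
  assumes "p * p' = 1" "p \<noteq> p'"
  shows "(\<Sum>j\<le>k. (p ^ 2) ^ j) = p ^ k * ((p ^ Suc k - p' ^ Suc k) / (p - p'))"
proof -
  let ?S = "\<Sum>j\<le>k. (p ^ 2) ^ j"
  have "p \<noteq> 0" using assms(1) by auto
  have "p * (?S * (p - p')) = ?S * (p * p - p * p')" by (simp only: algebra_simps)
  also have "\<dots> = p ^ Suc k * p ^ Suc k - 1"
    using sum_gp_basic[of "p ^ 2" k] assms(1)
    by (simp add: algebra_simps power2_eq_square power_mult_distrib)
  also have "\<dots> = p ^ Suc k * p ^ Suc k - (p * p') ^ Suc k" by (simp add: assms(1))
  also have "\<dots> = p * (p ^ k * (p ^ Suc k - p' ^ Suc k))"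
    by (simp add: power_mult_distrib algebra_simps)
  finally have "?S * (p - p') = p ^ k * (p ^ Suc k - p' ^ Suc k)"
    using \<open>p \<noteq> 0\<close> by simp
  thus ?thesis using assms(2) by (simp add: nonzero_eq_divide_eq)
qed

text \<open>The quantum integer is invariant under inverting q, so both values of y give it up to a
  power of q.\<close>

lemma qint_eq:
  fixes q :: "'k::field_char_0"
  assumes "q \<noteq> 0" "q ^ 2 \<noteq> 1"
  shows "(\<Sum>j\<le>k. (q ^ 2) ^ j) = q ^ k * qint q (Suc k)"
    and "(\<Sum>j\<le>k. (inverse q ^ 2) ^ j) = inverse q ^ k * qint q (Suc k)"
proof -
  have ne: "q \<noteq> inverse q"
  proof
    assume "q = inverse q"
    hence "q * q = q * inverse q" by simp
    thus False using assms by (simp add: power2_eq_square)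
  qed
  show "(\<Sum>j\<le>k. (q ^ 2) ^ j) = q ^ k * qint q (Suc k)"
    unfolding qint_def by (rule geometric_sum_eq) (use assms ne in auto)
  have "(\<Sum>j\<le>k. (inverse q ^ 2) ^ j) =
      inverse q ^ k * ((inverse q ^ Suc k - q ^ Suc k) / (inverse q - q))"
    by (rule geometric_sum_eq) (use assms ne in auto)
  also have "(inverse q ^ Suc k - q ^ Suc k) / (inverse q - q) = qint q (Suc k)"
    unfolding qint_def by (metis minus_diff_eq minus_divide_divide)
  finally show "(\<Sum>j\<le>k. (inverse q ^ 2) ^ j) = inverse q ^ k * qint q (Suc k)" .
qed

lemma qint_neq_0:
  fixes q :: "'k::field_char_0"
  assumes "\<not> algebraic q"
  shows "qint q (Suc k) \<noteq> 0"
proof -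
  note q = not_algebraic_imp[OF assms]
  have ne: "q ^ Suc j \<noteq> inverse q ^ Suc j" for j
  proof
    assume "q ^ Suc j = inverse q ^ Suc j"
    hence "q ^ Suc j * q ^ Suc j = (q * inverse q) ^ Suc j"
      by (simp only: power_mult_distrib)
    hence "q ^ (Suc j + Suc j) = 1" using q(1) by (simp only: power_add) simp
    thus False using q(2)[of "Suc j + Suc j"] by simp
  qed
  from ne[of k] ne[of 0] show ?thesis by (simp add: qint_def)
qed

section \<open>Divided powers of the Chevalley generators\<close>

lemma laurent_ring_powi: "q \<noteq> 0 \<Longrightarrow> q powi n \<in> laurent_ring q"
  by (auto simp: power_int_def intro: laurent_ring_power laurent_ring_q laurent_ring_inverse_q)

text \<open>The common form of the four Chevalley generators e_j and f_j: a vertex operator whose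
  exponent depends on \<open>m\<close>, times a coefficient \<open>u m\<close>. Since the exponent
  drops by 2 at each application, the exponents in a power form a chain.\<close>

definition shifted_vertex ::
  "'k::field_char_0 \<Rightarrow> 'k \<Rightarrow> 'k \<Rightarrow> int \<Rightarrow> (int \<Rightarrow> 'k) \<Rightarrow> (int \<Rightarrow> int) \<Rightarrow> ('k fock \<Rightarrow> 'k fock) \<Rightarrow> bool" where
  "shifted_vertex q \<epsilon> y t u \<alpha> Y \<longleftrightarrow> (\<forall>m. u m \<in> laurent_ring q \<and> \<alpha> (m + t) = \<alpha> m - 2 \<and>
    (\<forall>f. Y (single m f) = single (m + t) (Const (u m) * vertex_op \<epsilon> (hh \<epsilon> y) (\<alpha> m) f)))"

text \<open>The exponents run from \<open>\<alpha> m\<close> in the first application down to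
  \<open>\<alpha> m - 2 * (int n - 1)\<close> in the last, which \<open>foldr\<close> lists
  first.\<close>

lemma shifted_vertex_power:
  assumes Y: "shifted_vertex q \<epsilon> y t u \<alpha> Y"
  shows "\<exists>c\<in>laurent_ring q. \<forall>f. (Y ^^ n) (single m f) =
    single (m + int n * t) (Const c * foldr (vertex_op \<epsilon> (hh \<epsilon> y)) (chain n (\<alpha> m - 2 * (int n - 1))) f)"
proof (induction n)
  case 0
  show ?case by (intro bexI[of _ 1]) (simp_all add: laurent_ring_1)
next
  case (Suc n)
  then obtain c where c: "c \<in> laurent_ring q" "\<And>f. (Y ^^ n) (single m f) =
    single (m + int n * t) (Const c * foldr (vertex_op \<epsilon> (hh \<epsilon> y)) (chain n (\<alpha> m - 2 * (int n - 1))) f)"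
    by blast
  have \<alpha>: "\<alpha> (m + int n * t) = \<alpha> m - 2 * int n" for n
  proof (induction n)
    case (Suc n)
    have "\<alpha> (m + int (Suc n) * t) = \<alpha> ((m + int n * t) + t)" by (simp add: algebra_simps)
    thus ?case using Y Suc unfolding shifted_vertex_def by simp
  qed simp
  have "(Y ^^ Suc n) (single m f) = single (m + int (Suc n) * t) (Const (u (m + int n * t) * c) *
      foldr (vertex_op \<epsilon> (hh \<epsilon> y)) (chain (Suc n) (\<alpha> m - 2 * (int (Suc n) - 1))) f)" for f
  proof -
    have "(Y ^^ Suc n) (single m f) = single ((m + int n * t) + t) (Const (u (m + int n * t)) *
        vertex_op \<epsilon> (hh \<epsilon> y) (\<alpha> m - 2 * int n) (Const c * foldr (vertex_op \<epsilon> (hh \<epsilon> y)) (chain n (\<alpha> m - 2 * (int n - 1))) f))"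
      using Y unfolding shifted_vertex_def by (simp add: c(2) \<alpha>)
    moreover have "\<alpha> m - 2 * (int n - 1) = \<alpha> m - 2 * int n + 2" by simp
    ultimately show ?thesis
      by (simp add: vertex_op_Const_mult Const_mult mult.assoc algebra_simps)
  qed
  moreover have "u (m + int n * t) * c \<in> laurent_ring q"
    using Y c(1) unfolding shifted_vertex_def by (blast intro: laurent_ring_mult)
  ultimately show ?case by blast
qed

text \<open>The scalar from \<open>foldr_vertex_op_chain\<close> is a power of q times
  \<open>qfact q n\<close>, which the divided power cancels; \<open>vand_op\<close> is
  integral.\<close>

lemma shifted_vertex_divided_power:
  fixes q :: "'k::field_char_0"
  assumes q: "\<not> algebraic q" and Y: "shifted_vertex q \<epsilon> y t u \<alpha> Y" and \<epsilon>: "\<epsilon> = 1 \<or> \<epsilon> = - 1"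
    and y: "y = q ^ 2 \<or> y = inverse q ^ 2" and f: "f \<in> int_sym q"
  shows "fscale (inverse (qfact q n)) ((Y ^^ n) (single m f)) \<in> int_fock q"
proof -
  note q' = not_algebraic_imp[OF q]
  have q2: "q ^ 2 \<noteq> 1" using q'(2)[of 2] by simp
  obtain c where c: "c \<in> laurent_ring q" "(Y ^^ n) (single m f) =
    single (m + int n * t) (Const c * foldr (vertex_op \<epsilon> (hh \<epsilon> y)) (chain n (\<alpha> m - 2 * (int n - 1))) f)"
    using shifted_vertex_power[OF Y] by blast
  define v where "v = vand_op \<epsilon> (hh \<epsilon> y) n (chain n (\<alpha> m - 2 * (int n - 1))) f"
  have yA: "y \<in> laurent_ring q"
    using y by (auto intro: laurent_ring_power laurent_ring_q laurent_ring_inverse_q)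
  have v: "v \<in> int_sym q"
    unfolding v_def by (rule vand_op_in_int_sym[OF _ refl \<epsilon> yA f]) (use \<epsilon> in auto)
  \<comment> \<open>The square root of \<open>y\<close> in the Laurent ring.\<close>
  define p where "p = (if y = q ^ 2 then q else inverse q)"
  have p: "p \<in> laurent_ring q" by (simp add: p_def laurent_ring_q laurent_ring_inverse_q)
  have "(\<Prod>k<n. \<Sum>j\<le>k. y ^ j) = (\<Prod>k<n. p ^ k) * (\<Prod>k<n. qint q (Suc k))"
    unfolding prod.distrib[symmetric]
    by (intro prod.cong refl) (use y qint_eq[OF q'(1) q2] in \<open>auto simp: p_def\<close>)
  also have "(\<Prod>k<n. qint q (Suc k)) = qfact q n"
    unfolding qfact_def by (rule prod.reindex_bij_witness[of _ "\<lambda>k. k - 1" Suc]) auto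
  finally have prod: "(\<Prod>k<n. \<Sum>j\<le>k. y ^ j) = (\<Prod>k<n. p ^ k) * qfact q n" .
  have "qfact q n \<noteq> 0"
    unfolding qfact_def using qint_neq_0[OF q] by (auto simp: Suc_le_eq dest!: gr0_implies_Suc)
  hence "inverse (qfact q n) * (c * (\<Prod>k<n. \<Sum>j\<le>k. y ^ j)) = c * (\<Prod>k<n. p ^ k)"
    unfolding prod by simp
  moreover have "\<epsilon> * \<epsilon> = 1" using \<epsilon> by auto
  ultimately have "fscale (inverse (qfact q n)) ((Y ^^ n) (single m f)) =
      single (m + int n * t) (Const (c * (\<Prod>k<n. p ^ k)) * v)"
    by (simp only: c(2) fscale_single foldr_vertex_op_chain[OF _ refl] v_def[symmetric]
        Const_mult[symmetric] mult.assoc[symmetric])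
  moreover have "(\<Prod>k<n. p ^ k) \<in> laurent_ring q" for n
    by (induction n) (auto intro: laurent_ring_mult laurent_ring_power p laurent_ring_1)
  ultimately show ?thesis
    by (auto intro!: single_in_int_fock int_sym.mult int_sym.Const laurent_ring_mult c(1) v)
qed

text \<open>The rescaling is s = q, because (1 + q^(2r)) q^(-r) = (1 + q^(-2r)) q^r.\<close>

lemma X_plus_single:
  fixes q :: "'k::field_char_0"
  assumes "\<not> algebraic q" and a: "a = - n - 1 - (2 * m + int i)"
  shows "X_plus q i n (single m f) =
    single (m + 1) (Const (q powi a) * vertex_op 1 (hh 1 (inverse q ^ 2)) a f)"
  unfolding X_plus_def
proof (rule vertex_mode_single)
  note q = not_algebraic_imp[OF assms(1)]
  show "1 + q ^ (2 * r) \<noteq> 0" for r by (rule q(3))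
  show "q \<noteq> 0" by (rule q(1))
  fix r :: nat assume r: "r \<ge> 1"
  have "(1 + q ^ (2 * r)) * inverse q ^ r = (1 + (inverse q ^ 2) ^ r) * q ^ r"
    using q(1) by (simp add: field_simps power_mult[symmetric] power_add[symmetric] mult_2_right)
  thus "(1 + q ^ (2 * r)) * inverse q ^ r / of_nat r = 1 * (1 + (inverse q ^ 2) ^ r) * q ^ r / of_nat r"
    by simp
  show "- ((1 + q ^ (2 * r)) * inverse q ^ r / of_nat r) * (of_nat r / (1 + q ^ (2 * r))) = - 1 * inverse q ^ r"
  proof -
    have "- (X * b / c) * (c / X) = - 1 * b" if "X \<noteq> 0" "c \<noteq> 0" for X b c :: 'k
      using that by simp
    from this[OF q(3)[of "2 * r"], of "of_nat r"] r show ?thesis by simp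
  qed
qed (simp add: a)

text \<open>The coefficients already have the required form with y = q^2, so s = 1.\<close>

lemma X_minus_single:
  fixes q :: "'k::field_char_0"
  assumes "\<not> algebraic q" and a: "a = - n - 1 + (2 * m + int i)"
  shows "X_minus q i n (single m f) = single (m - 1) (vertex_op (- 1) (hh (- 1) (q ^ 2)) a f)"
proof -
  note q = not_algebraic_imp[OF assms(1)]
  have "X_minus q i n (single m f) =
      single (m + (- 1)) (Const (1 powi a) * vertex_op (- 1) (hh (- 1) (q ^ 2)) a f)"
    unfolding X_minus_def
  proof (rule vertex_mode_single)
    show "1 + q ^ (2 * r) \<noteq> 0" for r by (rule q(3))
    fix r :: nat assume r: "r \<ge> 1"
    show "- ((1 + q ^ (2 * r)) / of_nat r) = (- 1) * (1 + (q ^ 2) ^ r) * 1 ^ r / of_nat r"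
      by (simp add: power_mult minus_divide_left)
    show "(1 + q ^ (2 * r)) / of_nat r * (of_nat r / (1 + q ^ (2 * r))) = - (- 1) * inverse 1 ^ r"
      using q(3)[of "2 * r"] r by simp
  qed (simp_all add: a)
  thus ?thesis by simp
qed

lemma linear_fscale_sum:
  assumes "Vector_Spaces.linear fscale fscale T"
  shows "T v = (\<Sum>m\<in>keys v. T (single m (lookup v m)))"
proof -
  interpret T: Vector_Spaces.linear fscale fscale T by fact
  show ?thesis
    unfolding T.sum[symmetric] by (simp only: sum_single_lookup)
qed

theorem theorem4p1:
  fixes q h :: "'k::field_char_0" and i :: nat
    and scale :: "'k \<Rightarrow> 'u::ring_1 \<Rightarrow> 'u"
    and e f K Ki :: "nat \<Rightarrow> 'u" and D Di :: 'u
    and \<rho> :: "'u \<Rightarrow> 'k fock \<Rightarrow> 'k fock"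
  assumes "\<not> algebraic q" and "h ^ 2 = q"
    and "i \<in> {0, 1}"
    and "quantum_affine_sl2 scale q e f K Ki D Di"
    and "fock_representation scale \<rho>"
    and "chevalley_action q i e f K \<rho>"
  shows "\<forall>u \<in> integral_form scale q e f K Ki. \<forall>v \<in> schur_lattice q. \<rho> u v \<in> schur_lattice q"
proof -
  note q = not_algebraic_imp[OF assms(1)]
  interpret quantum_affine_sl2 scale q e f K Ki D Di by fact
  have lin: "Vector_Spaces.linear fscale fscale (\<rho> x)"
    and \<rho>_add: "\<rho> (x + y) v = \<rho> x v + \<rho> y v"
    and \<rho>_scale: "\<rho> (scale c x) v = fscale c (\<rho> x v)"
    and \<rho>_1: "\<rho> 1 = id" and \<rho>_mult: "\<rho> (x * y) = \<rho> x \<circ> \<rho> y" for x y c v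
    using assms(5) unfolding fock_representation_def by auto
  have act: "\<rho> (e 1) = X_plus q i 0" "\<rho> (f 1) = X_minus q i 0"
    "\<rho> (K 1) = fun_del i (\<lambda>d. q powi d)"
    "\<rho> (e 0) = X_minus q i 1 \<circ> fun_del i (\<lambda>d. q powi (- d))"
    "\<rho> (f 0) = fun_del i (\<lambda>d. q powi d) \<circ> X_plus q i (- 1)"
    "\<rho> (K 0) = fun_del i (\<lambda>d. q powi (1 - d))"
    using assms(6) unfolding chevalley_action_def by auto
  have homogeneous: "\<rho> x v \<in> int_fock q"
    if "\<And>m p. p \<in> int_sym q \<Longrightarrow> \<rho> x (single m p) \<in> int_fock q" "v \<in> int_fock q" for x v
    unfolding linear_fscale_sum[OF lin, of x v]
    using that by (intro int_fock_sum) (simp add: int_fock_def)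
  have \<rho>_power: "\<rho> (x ^ n) = \<rho> x ^^ n" for x n
    by (induction n) (simp_all add: \<rho>_1 \<rho>_mult)
  have divided_power: "\<rho> (divided_power scale q x n) v \<in> int_fock q"
    if "shifted_vertex q \<epsilon> y t w \<alpha> (\<rho> x)" "\<epsilon> = 1 \<or> \<epsilon> = - 1" "y = q ^ 2 \<or> y = inverse q ^ 2" "v \<in> int_fock q"
    for x n v \<epsilon> y t w \<alpha>
  proof (rule homogeneous)
    fix m p assume "p \<in> int_sym q"
    thus "\<rho> (divided_power scale q x n) (single m p) \<in> int_fock q"
      unfolding divided_power_def \<rho>_scale \<rho>_power
      by (rule shifted_vertex_divided_power[OF assms(1) that(1-3)])
  qed (rule that(4))
  have e_shifted: "\<exists>\<epsilon> y t w \<alpha>. (\<epsilon> = 1 \<or> \<epsilon> = - 1) \<and> (y = q ^ 2 \<or> y = inverse q ^ 2) \<and>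
      shifted_vertex q \<epsilon> y t w \<alpha> (\<rho> (e j))" if "j \<in> {0, 1}" for j
  proof (cases "j = 1")
    case True
    have "shifted_vertex q 1 (inverse q ^ 2) 1 (\<lambda>m. q powi (- 1 - (2 * m + int i))) (\<lambda>m. - 1 - (2 * m + int i)) (\<rho> (e 1))"
      unfolding shifted_vertex_def act
      by (auto simp: laurent_ring_powi q(1) intro!: X_plus_single[OF assms(1)])
    thus ?thesis using True by blast
  next
    case False
    have "shifted_vertex q (- 1) (q ^ 2) (- 1) (\<lambda>m. q powi (- (2 * m + int i))) (\<lambda>m. - 2 + (2 * m + int i)) (\<rho> (e 0))"
      unfolding shifted_vertex_def act
      by (auto simp: laurent_ring_powi q(1) fun_del_single vertex_op_Const_mult
          X_minus_single[OF assms(1) refl])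
    thus ?thesis using False that by fastforce
  qed
  have f_shifted: "\<exists>\<epsilon> y t w \<alpha>. (\<epsilon> = 1 \<or> \<epsilon> = - 1) \<and> (y = q ^ 2 \<or> y = inverse q ^ 2) \<and>
      shifted_vertex q \<epsilon> y t w \<alpha> (\<rho> (f j))" if "j \<in> {0, 1}" for j
  proof (cases "j = 1")
    case True
    have "shifted_vertex q (- 1) (q ^ 2) (- 1) (\<lambda>m. 1) (\<lambda>m. - 1 + (2 * m + int i)) (\<rho> (f 1))"
      unfolding shifted_vertex_def act
      by (auto simp: laurent_ring_1 X_minus_single[OF assms(1) refl])
    thus ?thesis using True by blast
  next
    case False
    \<comment> \<open>The operator q^\<partial> acts after the current has raised \<open>m\<close>,
      hence the eigenvalue at \<open>m + 1\<close>; the second power of q is the rescaling factor of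
      the current.\<close>
    have "shifted_vertex q 1 (inverse q ^ 2) 1
      (\<lambda>m. q powi (2 * (m + 1) + int i) * q powi (- (2 * m + int i))) (\<lambda>m. - (2 * m + int i)) (\<rho> (f 0))"
      unfolding shifted_vertex_def act
      by (auto simp: laurent_ring_powi laurent_ring_mult q(1) fun_del_single Const_mult mult.assoc
          X_plus_single[OF assms(1) refl])
    thus ?thesis using False that by fastforce
  qed
  have K_diag: "\<exists>g. \<rho> (K j) = fun_del i (\<lambda>d. q powi (g d))" if "j \<in> {0, 1}" for j
    using that act by auto
  have "\<rho> u v \<in> int_fock q" if "u \<in> integral_form scale q e f K Ki" "v \<in> int_fock q" for u v
    using that
  proof (induction arbitrary: v rule: integral_form.induct)
    case (e j n)
    thus ?case using e_shifted[of j] divided_power by blast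
  next
    case (f j n)
    thus ?case using f_shifted[of j] divided_power by blast
  next
    case (K j)
    then obtain g where "\<rho> (K j) = fun_del i (\<lambda>d. q powi (g d))" using K_diag[of j] by blast
    hence "\<rho> (K j) (single m p) \<in> int_fock q" if "p \<in> int_sym q" for m p
      using that by (simp add: fun_del_single single_in_int_fock int_sym.mult int_sym.Const laurent_ring_powi q(1))
    thus ?case using K(2) by (rule homogeneous)
  next
    case (Ki j)
    then obtain g where g: "\<rho> (K j) = fun_del i (\<lambda>d. q powi (g d))" using K_diag[of j] by blast
    show ?case
    proof (rule homogeneous)
      fix m p assume p: "p \<in> int_sym q"
      let ?g = "g (2 * m + int i)"
      \<comment> \<open>The action of \<open>Ki j\<close> is not prescribed. Writing the vector as
        an image of \<open>K j\<close>, the relation \<open>Ki j * K j = 1\<close> determines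
        it.\<close>
      have "single m p = \<rho> (K j) (single m (Const (q powi (- ?g)) * p))"
        using q(1) by (simp add: g fun_del_single mult.assoc[symmetric] Const_mult[symmetric] power_int_minus)
      hence "\<rho> (Ki j) (single m p) = \<rho> (Ki j * K j) (single m (Const (q powi (- ?g)) * p))"
        by (simp add: \<rho>_mult)
      also have "\<dots> = single m (Const (q powi (- ?g)) * p)"
        using K_inverse(2)[OF Ki(1)] by (simp add: \<rho>_1)
      also have "\<dots> \<in> int_fock q"
        using p by (intro single_in_int_fock int_sym.mult int_sym.Const laurent_ring_powi q(1))
      finally show "\<rho> (Ki j) (single m p) \<in> int_fock q" .
    qed fact
  next
    case one
    thus ?case by (simp add: \<rho>_1)
  next
    case (add x y)
    thus ?case by (simp add: \<rho>_add int_fock_add)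
  next
    case (mult x y)
    thus ?case by (simp add: \<rho>_mult)
  next
    case (scale c x)
    thus ?case by (simp add: \<rho>_scale int_fock_scale)
  qed
  thus ?thesis
    unfolding schur_lattice_eq_int_fock[OF q(1)] by blast
qed

end
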